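(* Suppose that the sparsity pattern $I_{\mathcal{S}}$ is block-diagonal with square blocks and that $R$ has the same sparsity pattern as $I_{\mathcal{S}}$. Then there is no spurious locally optimal controller for large $\alpha$; that is, $K^\dagger(\alpha)=K^*(\alpha)$ for all large $\alpha$.
   Context: Setting. Let $A\in\mathbb{R}^{n\times n}$, $B\in\mathbb{R}^{n\times m}$, $Q\in\mathbb{R}^{n\times n}$ symmetric positive semidefinite, $R\in\mathbb{R}^{m\times m}$ symmetric positive definite, and $D_0\in\mathbb{R}^{n\times n}$ symmetric positive definite. A real square matrix is stable if all its eigenvalues lie in the open left half plane. Let $\mathcal{S}\subseteq\mathbb{R}^{m\times n}$ be a linear subspace specified by fixing certain entries of the matrix to zero; its indicator matrix $I_{\mathcal{S}}\in\{0,1\}^{m\times n}$ has $(i,j)$ entry $1$ if $K_{ij}$ is free and $0$ if $K_{ij}$ is required to be $0$. "$I_{\mathcal{S}}$ is block-diagonal with square blocks" means that $m=n$ and, for some partition of $\{1,\dots,n\}$ into consecutive intervals, $[I_{\mathcal{S}}]_{ij}=1$ exactly when $i,j$ lie in the same interval. "$R$ has the same sparsity pattern as $I_{\mathcal{S}}$" means $R_{ij}=0$ whenever $[I_{\mathcal{S}}]_{ij}=0$. For a damping parameter $\alpha$ and $K\in\mathbb{R}^{m\times n}$ such that $A-\alpha I+BK$ is stable, define $$J(K,\alpha)=\mathbb{E}\int_0^\infty\left[x(t)^\top Qx(t)+u(t)^\top Ru(t)\right]dt,\quad \dot x(t)=(A-\alpha I)x(t)+Bu(t),\ u(t)=Kx(t),$$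 where $x(0)=x_0$ is a random vector with zero mean and $\mathbb{E}[x_0x_0^\top]=D_0$. Equivalently, $J(K,\alpha)=\mathrm{tr}(D_0P)$ where $P$ is the unique solution of $(A-\alpha I+BK)^\top P+P(A-\alpha I+BK)+K^\top RK+Q=0$. Consider the problem: minimize $J(K,\alpha)$ over $K\in\mathcal{S}$ such that $A-\alpha I+BK$ is stable. $K^*(\alpha)$ denotes its set of globally optimal solutions (global minimizers), and $K^\dagger(\alpha)$ its set of locally optimal solutions (local minimizers). "For all large $\alpha$" means: there is $\alpha_0$ such that the assertion holds for all $\alpha\ge\alpha_0$. *)

theory Defs
  imports "HOL-Probability.Probability"
begin

definition symmetric_matrix :: "real^'n^'n \<Rightarrow> bool" where
  "symmetric_matrix M \<longleftrightarrow> transpose M = M"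

definition pos_semidef :: "real^'n^'n \<Rightarrow> bool" where
  "pos_semidef M \<longleftrightarrow> symmetric_matrix M \<and> (\<forall>x. 0 \<le> x \<bullet> (M *v x))"

definition pos_def :: "real^'n^'n \<Rightarrow> bool" where
  "pos_def M \<longleftrightarrow> symmetric_matrix M \<and> (\<forall>x. x \<noteq> 0 \<longrightarrow> 0 < x \<bullet> (M *v x))"

definition eigenvalues :: "real^'n^'n \<Rightarrow> complex set" where
  "eigenvalues M =
    {\<mu>. \<exists>v :: complex^'n. v \<noteq> 0 \<and> (\<chi> i j. complex_of_real (M $ i $ j)) *v v = \<mu> *s v}"

definition stable :: "real^'n^'n \<Rightarrow> bool" where
  "stable M \<longleftrightarrow> (\<forall>\<mu>\<in>eigenvalues M. Re \<mu> < 0)"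


definition sparsity_subspace :: "(real^'n^'m) set \<Rightarrow> bool" where
  "sparsity_subspace S \<longleftrightarrow>
    (\<exists>Z :: ('m \<times> 'n) set. S = {K. \<forall>(i, j)\<in>Z. K $ i $ j = 0})"

definition indicator_matrix :: "(real^'n^'m) set \<Rightarrow> real^'n^'m" where
  "indicator_matrix S = (\<chi> i j. if \<forall>K\<in>S. K $ i $ j = 0 then 0 else 1)"

text \<open>
  A finite linearly ordered index type plays the role of \<open>{1, ..., n}\<close>; the blocks are
  order-convex sets of indices, i.e. consecutive intervals.
\<close>

definition interval_partition :: "'n::linorder set set \<Rightarrow> bool" where
  "interval_partition \<B> \<longleftrightarrow>
    partition_on UNIV \<B> \<and> (\<forall>b\<in>\<B>. \<forall>i\<in>b. \<forall>j\<in>b. {i..j} \<subseteq> b)"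

definition block_diagonal :: "real^('n::{finite,linorder})^('n::{finite,linorder}) \<Rightarrow> bool" where
  "block_diagonal I \<longleftrightarrow>
    (\<exists>\<B>. interval_partition \<B> \<and>
      (\<forall>i j. I $ i $ j = 1 \<longleftrightarrow> (\<exists>b\<in>\<B>. i \<in> b \<and> j \<in> b)))"

definition has_sparsity_pattern :: "real^'n^'m \<Rightarrow> real^'n^'m \<Rightarrow> bool" where
  "has_sparsity_pattern M I \<longleftrightarrow> (\<forall>i j. I $ i $ j = 0 \<longrightarrow> M $ i $ j = 0)"


definition damped :: "real^'n^'n \<Rightarrow> real \<Rightarrow> real^'n^'n" where
  "damped A \<alpha> = A - \<alpha> *\<^sub>R mat 1"

text \<open>
  The initial value problem is linear with constant coefficients, so its solution exists and is
  unique on \<open>[0, \<infinity>)\<close>. The choice only leaves open the values at negative times, which are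
  never used.
\<close>

definition trajectory ::
  "real^'n^'n \<Rightarrow> real^'m^'n \<Rightarrow> real \<Rightarrow> real^'n^'m \<Rightarrow> real^'n \<Rightarrow> real \<Rightarrow> real^'n" where
  "trajectory A B \<alpha> K \<xi> =
    (SOME x. x 0 = \<xi> \<and>
      (\<forall>t\<ge>0. (x has_vector_derivative (damped A \<alpha> *v x t + B *v (K *v x t)))
                (at t within {0..})))"

definition pathwise_cost ::
  "real^'n^'n \<Rightarrow> real^'m^'n \<Rightarrow> real^'n^'n \<Rightarrow> real^'m^'m \<Rightarrow> real \<Rightarrow> real^'n^'m \<Rightarrow> real^'n \<Rightarrow> real"
  where
  "pathwise_cost A B Q R \<alpha> K \<xi> =
    (let x = trajectory A B \<alpha> K \<xi>; u = (\<lambda>t. K *v x t) in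
      LINT t:{0..}|lborel. x t \<bullet> (Q *v x t) + u t \<bullet> (R *v u t))"

definition random_initial_state :: "'w measure \<Rightarrow> ('w \<Rightarrow> real^'n) \<Rightarrow> real^'n^'n \<Rightarrow> bool" where
  "random_initial_state M x\<^sub>0 D\<^sub>0 \<longleftrightarrow>
    prob_space M \<and> x\<^sub>0 \<in> borel_measurable M \<and>
    integrable M x\<^sub>0 \<and> integral\<^sup>L M x\<^sub>0 = 0 \<and>
    (\<forall>i j. integrable M (\<lambda>\<omega>. x\<^sub>0 \<omega> $ i * x\<^sub>0 \<omega> $ j) \<and>
           integral\<^sup>L M (\<lambda>\<omega>. x\<^sub>0 \<omega> $ i * x\<^sub>0 \<omega> $ j) = D\<^sub>0 $ i $ j)"

definition expected_cost ::
  "'w measure \<Rightarrow> ('w \<Rightarrow> real^'n) \<Rightarrow> real^'n^'n \<Rightarrow> real^'m^'n \<Rightarrow> real^'n^'n \<Rightarrow> real^'m^'m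
    \<Rightarrow> real^'n^'m \<Rightarrow> real \<Rightarrow> real" where
  "expected_cost M x\<^sub>0 A B Q R K \<alpha> =
    integral\<^sup>L M (\<lambda>\<omega>. pathwise_cost A B Q R \<alpha> K (x\<^sub>0 \<omega>))"


definition feasible ::
  "real^'n^'n \<Rightarrow> real^'m^'n \<Rightarrow> (real^'n^'m) set \<Rightarrow> real \<Rightarrow> (real^'n^'m) set" where
  "feasible A B S \<alpha> = {K \<in> S. stable (damped A \<alpha> + B ** K)}"

definition global_minimizers :: "('a \<Rightarrow> real) \<Rightarrow> 'a set \<Rightarrow> 'a set" where
  "global_minimizers f X = {x \<in> X. \<forall>y\<in>X. f x \<le> f y}"

definition local_minimizers :: "('a::metric_space \<Rightarrow> real) \<Rightarrow> 'a set \<Rightarrow> 'a set" where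
  "local_minimizers f X = {x \<in> X. \<exists>e>0. \<forall>y \<in> X \<inter> ball x e. f x \<le> f y}"

definition globally_optimal ::
  "'w measure \<Rightarrow> ('w \<Rightarrow> real^'n) \<Rightarrow> real^'n^'n \<Rightarrow> real^'m^'n \<Rightarrow> real^'n^'n \<Rightarrow> real^'m^'m
    \<Rightarrow> (real^'n^'m) set \<Rightarrow> real \<Rightarrow> (real^'n^'m) set" where
  "globally_optimal M x\<^sub>0 A B Q R S \<alpha> =
    global_minimizers (\<lambda>K. expected_cost M x\<^sub>0 A B Q R K \<alpha>) (feasible A B S \<alpha>)"

definition locally_optimal ::
  "'w measure \<Rightarrow> ('w \<Rightarrow> real^'n) \<Rightarrow> real^'n^'n \<Rightarrow> real^'m^'n \<Rightarrow> real^'n^'n \<Rightarrow> real^'m^'m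
    \<Rightarrow> (real^'n^'m) set \<Rightarrow> real \<Rightarrow> (real^'n^'m) set" where
  "locally_optimal M x\<^sub>0 A B Q R S \<alpha> =
    local_minimizers (\<lambda>K. expected_cost M x\<^sub>0 A B Q R K \<alpha>) (feasible A B S \<alpha>)"

end

theory Submission
  imports Defs "HOL-Computational_Algebra.Fundamental_Theorem_Algebra"
begin

text \<open>
  For a stabilizing gain \<open>K\<close> the cost is \<open>J(K, \<alpha>) = P \<bullet> D\<^sub>0\<close>, where \<open>P\<close> solves a Lyapunov equation. Three facts are combined.

  (1) For fixed \<open>K\<close> the cost strictly decreases in \<open>\<alpha>\<close>, and the feasible set grows with \<open>\<alpha>\<close>.

  (2) If \<open>J(K, \<alpha>) \<le> C\<close> with \<open>C\<close> fixed, then the norm of \<open>K\<close> is \<open>O(sqrt \<alpha>)\<close>; on the ball of that radius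
  every gain is stabilizing and, for large \<open>\<alpha>\<close>, the cost is convex. A local minimum of value at most \<open>C\<close> is then global.

  (3) The values of local minima that are not global stay bounded as \<open>\<alpha>\<close> grows. Feasibility and cost
  are first-order definable over the real field, so by quantifier elimination everything definable
  from \<open>\<alpha>\<close> behaves tamely: if such local minima exist for arbitrarily large \<open>\<alpha>\<close>, they exist for all large \<open>\<alpha>\<close>, and their least
  value \<open>v(\<alpha>)\<close> satisfies one-sided sign conditions at each point. Comparing nearby local minimizers through (1)
  shows that \<open>v\<close> is locally decreasing except at countably many parameters, hence, by tameness, at all large ones.
  So \<open>v\<close> is eventually decreasing and therefore bounded.
\<close>

section \<open>Aligning the roots of two functions\<close>

text \<open>The convexity argument works only below a cost level fixed in advance, while nothing so
  far keeps spurious local minima from drifting to higher cost as \<alpha> grows. No continuous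
  branch of local minimizers is available to follow, so only their least value, a function of one
  real variable, is studied. Quantifier elimination is done without syntax: a predicate counts as
  definable if the signs of finitely many polynomials decide it, and closure under existential
  quantification comes from matching the sign diagrams at two environments by an increasing
  bijection of the line. The scale sqrt \<alpha> is natural: bounded cost gives norm K squared =
  O(\<alpha> + norm K), and a closed-loop change of order sqrt \<alpha> is negligible against
  damping \<alpha>. On that scale a step Z produces a positive second-order term of order norm Z
  squared / \<alpha>, and the indefinite cross terms are smaller by a factor 1 / sqrt \<alpha>. The
  theory of Lyapunov equations rests on a comparison principle for quadratic forms and on
  continuation in the damping; neither matrix exponentials nor normal forms enter there.\<close>

definition same_cell :: "real set \<Rightarrow> real \<Rightarrow> real \<Rightarrow> bool" where
  "same_cell Z s t \<longleftrightarrow> (\<forall>z\<in>Z. sgn (s - z) = sgn (t - z))"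

lemma same_cell_iff: "same_cell Z s t \<longleftrightarrow> (\<forall>z\<in>Z. (s < z \<longleftrightarrow> t < z) \<and> (z < s \<longleftrightarrow> z < t))"
  unfolding same_cell_def by (intro ball_cong refl) (simp add: sgn_real_def)

text \<open>The sign 0 is recorded as well, so every point of \<open>Z\<close> is a cell of its own;
  the other cells are the open intervals between such points.\<close>

lemma same_cell_eq: "same_cell Z s t \<Longrightarrow> t \<in> Z \<Longrightarrow> s = t"
  unfolding same_cell_iff by (metis less_irrefl linorder_less_linear)

lemma same_cell_trans: "same_cell Z r s \<Longrightarrow> same_cell Z s t \<Longrightarrow> same_cell Z r t"
  unfolding same_cell_def by simp

lemma same_cell_sym: "same_cell Z s t \<Longrightarrow> same_cell Z t s"
  unfolding same_cell_def by simp

lemma same_cell_between: "same_cell Z s t \<Longrightarrow> s \<le> r \<Longrightarrow> r \<le> t \<Longrightarrow> same_cell Z r t"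
  unfolding same_cell_iff by (meson leD leI le_less_trans less_le_trans)

text \<open>The points of \<open>Z\<close> cut the line into cells, and \<open>\<sigma>\<close> plays the role of the sign of the derivative of \<open>w\<close>. The last two conjuncts
  say that \<open>w\<close> takes both signs near the ends of an unbounded cell.\<close>
definition cell_mono :: "real set \<Rightarrow> (real \<Rightarrow> real) \<Rightarrow> (real \<Rightarrow> real) \<Rightarrow> bool" where
  "cell_mono Z \<sigma> w \<longleftrightarrow>
    (\<forall>t x y. t \<notin> Z \<longrightarrow> x < y \<longrightarrow> (\<forall>z\<in>Z. \<not> (min x t < z \<and> z < max y t)) \<longrightarrow>
       0 < \<sigma> t * (w y - w x)) \<and>
    (\<forall>t. (\<forall>z\<in>Z. t < z) \<longrightarrow> (\<exists>y<t. \<sigma> t * w y < 0)) \<and>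
    (\<forall>t. (\<forall>z\<in>Z. z < t) \<longrightarrow> (\<exists>y>t. 0 < \<sigma> t * w y))"

lemma cell_monoD:
  "cell_mono Z \<sigma> w \<Longrightarrow> t \<notin> Z \<Longrightarrow> x < y \<Longrightarrow> (\<And>z. z \<in> Z \<Longrightarrow> min x t < z \<Longrightarrow> z < max y t \<Longrightarrow> False)
    \<Longrightarrow> \<sigma> t * w x < \<sigma> t * w y"
  unfolding cell_mono_def by (smt (verit) right_diff_distrib)

lemma cell_mono_same_cell:
  assumes "cell_mono Z \<sigma> w" "t \<notin> Z" "x < y" "same_cell Z x t" "same_cell Z y t"
  shows "\<sigma> t * w x < \<sigma> t * w y"
proof (rule cell_monoD[OF assms(1-3)])
  fix z assume z: "z \<in> Z" "min x t < z" "z < max y t"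
  with assms(2) have "z \<noteq> t" by auto
  with z assms(4,5) show False unfolding same_cell_iff by (smt (verit))
qed

text \<open>On a cell off \<open>Z\<close> the function \<sigma> t * w increases strictly, so
  negative values occur exactly if it is negative at the left end of the cell. A cell unbounded to
  the left always contains negative values, and the right-hand side is then vacuous. Hence the signs
  at the points of \<open>Z\<close> answer the question for every \<open>w\<close> with the same
  \<sigma>.\<close>

lemma neg_in_cell_iff:
  assumes Z: "finite Z" and c: "continuous_on UNIV w" and m: "cell_mono Z \<sigma> w" and t: "t \<notin> Z"
  shows "(\<exists>y. same_cell Z y t \<and> \<sigma> t * w y < 0) \<longleftrightarrow>
    (\<forall>z\<in>Z. z < t \<and> {z<..<t} \<inter> Z = {} \<longrightarrow> \<sigma> t * w z < 0)" (is "?L \<longleftrightarrow> ?R")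
proof
  assume ?L
  then obtain y where y: "same_cell Z y t" "\<sigma> t * w y < 0" by blast
  show ?R
  proof (intro ballI impI)
    fix z assume z: "z \<in> Z" "z < t \<and> {z<..<t} \<inter> Z = {}"
    then have "z < y" using y(1) by (auto simp: same_cell_iff)
    have "\<sigma> t * w z < \<sigma> t * w y"
    proof (rule cell_monoD[OF m t \<open>z < y\<close>])
      fix z' assume z': "z' \<in> Z" "min z t < z'" "z' < max y t"
      then have "z < z'" "z' \<noteq> t" using z t by auto
      show False
      proof (cases "z' < t")
        case True then show False using z z' \<open>z < z'\<close> by (auto simp: disjoint_iff)
      next
        case False
        then have "t < z'" using \<open>z' \<noteq> t\<close> by auto
        then have "y < z'" using y(1) z' by (auto simp: same_cell_iff)
        then show False using z' \<open>t < z'\<close> by auto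
      qed
    qed
    then show "\<sigma> t * w z < 0" using y by linarith
  qed
next
  assume R: ?R
  show ?L
  proof (cases "\<exists>z\<in>Z. z < t")
    case True
    define z where "z = Max {z\<in>Z. z < t}"
    have f: "finite {z\<in>Z. z < t}" "{z\<in>Z. z < t} \<noteq> {}" using Z True by auto
    have z: "z \<in> Z" "z < t" using Max_in[OF f] by (auto simp: z_def)
    have zm: "{z<..<t} \<inter> Z = {}"
      using Max_ge[OF f(1)] by (fastforce simp: z_def)
    have "\<sigma> t * w z < 0" using R z zm by auto
    moreover have "continuous_on UNIV (\<lambda>y. \<sigma> t * w y)" by (intro continuous_intros c)
    then have "((\<lambda>y. \<sigma> t * w y) \<longlongrightarrow> \<sigma> t * w z) (at_right z)"
      using continuous_on_def tendsto_within_subset by (metis UNIV_I subset_UNIV)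
    ultimately have "\<forall>\<^sub>F y in at_right z. \<sigma> t * w y < 0" by (rule order_tendstoD(2)[rotated])
    moreover have "\<forall>\<^sub>F y in at_right z. y \<in> {z<..<t}" using z(2) by (rule eventually_at_right_real)
    ultimately have "\<forall>\<^sub>F y in at_right z. \<sigma> t * w y < 0 \<and> y \<in> {z<..<t}" by eventually_elim auto
    then obtain y where y: "\<sigma> t * w y < 0" "y \<in> {z<..<t}"
      using eventually_happens trivial_limit_at_right_real by blast
    have "same_cell Z y t"
      unfolding same_cell_iff
    proof
      fix z' assume z': "z' \<in> Z"
      then have "z' \<le> z \<or> t < z'" using zm t by (metis disjoint_iff greaterThanLessThan_iff linorder_less_linear not_le)
      then show "(y < z' \<longleftrightarrow> t < z') \<and> (z' < y \<longleftrightarrow> z' < t)" using y z by auto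
    qed
    with y show ?L by blast
  next
    case False
    then have "\<forall>z\<in>Z. t < z" using t by (metis linorder_less_linear)
    moreover from this m obtain y where "y < t" "\<sigma> t * w y < 0" unfolding cell_mono_def by blast
    ultimately show ?L unfolding same_cell_iff by (intro exI[of _ y]) force
  qed
qed

text \<open>Replacing w(y) by -w(-y) keeps the sign of the slope and exchanges left with right and
  negative with positive.\<close>

lemma pos_in_cell_iff:
  assumes Z: "finite Z" and c: "continuous_on UNIV w" and m: "cell_mono Z \<sigma> w" and t: "t \<notin> Z"
  shows "(\<exists>y. same_cell Z y t \<and> \<sigma> t * w y > 0) \<longleftrightarrow>
    (\<forall>z\<in>Z. t < z \<and> {t<..<z} \<inter> Z = {} \<longrightarrow> \<sigma> t * w z > 0)"
proof -
  let ?w = "\<lambda>y. - w (- y)" and ?\<sigma> = "\<lambda>y. \<sigma> (- y)" and ?Z = "uminus ` Z"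
  have sc: "same_cell ?Z y (- s) \<longleftrightarrow> same_cell Z (- y) s" for y s
    unfolding same_cell_iff by (auto simp: minus_less_iff less_minus_iff)
  have m': "cell_mono ?Z ?\<sigma> ?w"
    unfolding cell_mono_def
  proof (intro conjI allI impI)
    fix t x y assume *: "t \<notin> ?Z" "x < y" "\<forall>z\<in>?Z. \<not> (min x t < z \<and> z < max y t)"
    have "- t \<notin> Z" using *(1) by (metis add.inverse_inverse imageI)
    then have "\<sigma> (- t) * w (- y) < \<sigma> (- t) * w (- x)"
      using *(2,3) by (intro cell_monoD[OF m]) (fastforce simp: min_def max_def split: if_splits)+
    then show "0 < \<sigma> (- t) * (- w (- y) - - w (- x))" by (simp add: algebra_simps)
  next
    fix t assume "\<forall>z\<in>?Z. t < z"
    then have "\<forall>z\<in>Z. z < - t" by force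
    then obtain y where "y > - t" "0 < \<sigma> (- t) * w y" using m unfolding cell_mono_def by blast
    then show "\<exists>y<t. \<sigma> (- t) * - w (- y) < 0" by (intro exI[of _ "- y"]) auto
  next
    fix t assume "\<forall>z\<in>?Z. z < t"
    then have "\<forall>z\<in>Z. - t < z" by force
    then obtain y where "y < - t" "\<sigma> (- t) * w y < 0" using m unfolding cell_mono_def by blast
    then show "\<exists>y>t. 0 < \<sigma> (- t) * - w (- y)" by (intro exI[of _ "- y"]) auto
  qed
  have c': "continuous_on UNIV ?w"
    by (intro continuous_intros continuous_on_compose2[OF c]) auto
  have t': "- t \<notin> ?Z" using t by auto
  have "(\<exists>y. same_cell ?Z y (- t) \<and> ?\<sigma> (- t) * ?w y < 0) \<longleftrightarrow>
    (\<exists>y. same_cell Z y t \<and> \<sigma> t * w y > 0)"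
    unfolding sc by (metis (no_types, lifting) add.inverse_inverse mult_minus_right neg_less_0_iff_less)
  moreover have "(\<forall>z\<in>?Z. z < - t \<and> {z<..<- t} \<inter> ?Z = {} \<longrightarrow> ?\<sigma> (- t) * ?w z < 0) \<longleftrightarrow>
    (\<forall>z\<in>Z. t < z \<and> {t<..<z} \<inter> Z = {} \<longrightarrow> \<sigma> t * w z > 0)"
  proof -
    have "{- z<..<- t} \<inter> ?Z = uminus ` ({t<..<z} \<inter> Z)" for z
      by (simp add: image_Int)
    then show ?thesis by auto
  qed
  ultimately show ?thesis using neg_in_cell_iff[OF _ c' m' t'] Z by auto
qed

lemma relocate_up:
  fixes a \<eta> \<zeta> b :: real
  assumes "a < \<eta>" "\<eta> \<le> \<zeta>" "\<zeta> < b"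
  obtains g where "strict_mono g" "surj g" "g \<eta> = \<zeta>" "\<And>t. t \<le> a \<or> b \<le> t \<Longrightarrow> g t = t"
proof -
  define m1 m2 where "m1 = (\<zeta> - a) / (\<eta> - a)" and "m2 = (b - \<zeta>) / (b - \<eta>)"
  have m: "1 \<le> m1" "0 < m2" "m2 \<le> 1" using assms by (auto simp: m1_def m2_def)
  \<comment> \<open>The two lines join (a, a) to (\<eta>, \<zeta>) and (\<eta>, \<zeta>) to (b, b).
    Their minimum is concave and can rise above the diagonal only between a and b, so the maximum
    with \<open>t\<close> is the identity elsewhere.\<close>
  define g where "g t = max t (min (a + (t - a) * m1) (b - (b - t) * m2))" for t
  have sm: "strict_mono g"
  proof (rule strict_monoI)
    fix x y :: real assume "x < y"
    then have "(x - a) * m1 < (y - a) * m1" "(b - y) * m2 < (b - x) * m2" using m by auto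
    with \<open>x < y\<close> show "g x < g y" unfolding g_def by linarith
  qed
  have out: "g t = t" if "t \<le> a \<or> b \<le> t" for t
    using that
  proof
    assume "t \<le> a"
    then have "(t - a) * m1 \<le> (t - a) * 1" using m by (intro mult_left_mono_neg) auto
    then show ?thesis unfolding g_def by auto
  next
    assume "b \<le> t"
    then have "(b - t) * m2 \<ge> (b - t) * 1" using m by (intro mult_left_mono_neg) auto
    then show ?thesis unfolding g_def by auto
  qed
  have e1: "(\<eta> - a) * m1 = \<zeta> - a" "(b - \<eta>) * m2 = b - \<zeta>" using assms by (auto simp: m1_def m2_def)
  then have gz: "g \<eta> = \<zeta>" unfolding g_def using assms by auto
  have "continuous_on UNIV g" unfolding g_def by (intro continuous_intros)
  have "\<exists>t. g t = y" for y
  proof (cases "y \<le> a \<or> b \<le> y")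
    case True then show ?thesis using out by blast
  next
    case False
    then have "g a \<le> y" "y \<le> g b" "a \<le> b" using out[of a] out[of b] assms by auto
    then show ?thesis
      using IVT'[of g a y b] continuous_on_subset[OF \<open>continuous_on UNIV g\<close>] by auto
  qed
  then have "surj g" by (metis surjI surj_def)
  show ?thesis using that sm \<open>surj g\<close> gz out by blast
qed

lemma relocate:
  fixes a \<eta> \<zeta> b :: real
  assumes "a < \<eta>" "a < \<zeta>" "\<eta> < b" "\<zeta> < b"
  obtains g where "strict_mono g" "surj g" "g \<eta> = \<zeta>" "\<And>t. t \<le> a \<or> b \<le> t \<Longrightarrow> g t = t"
proof (cases "\<eta> \<le> \<zeta>")
  case True then show ?thesis using relocate_up[of a \<eta> \<zeta> b] assms that by blast
next
  case False
  then obtain g where g: "strict_mono g" "surj g" "g (- \<eta>) = - \<zeta>" "\<And>t. t \<le> - b \<or> - a \<le> t \<Longrightarrow> g t = t"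
    using relocate_up[of "- b" "- \<eta>" "- \<zeta>" "- a"] assms by auto
  show ?thesis
  proof (rule that[of "\<lambda>t. - g (- t)"])
    show "strict_mono (\<lambda>t. - g (- t))" using g(1) by (auto simp: strict_mono_def)
    show "surj (\<lambda>t. - g (- t))" using g(2) unfolding surj_def by (metis add.inverse_inverse)
  qed (use g in auto)
qed

text \<open>The closed interval stays inside the cell and leaves room on both sides of
  \<open>s\<close> and \<open>t\<close>: a map that is the identity outside it can move one point
  onto the other without changing cells.\<close>

lemma cell_interval:
  assumes "finite Z" "t \<notin> Z" "same_cell Z s t"
  obtains a b where "a < s" "a < t" "s < b" "t < b" "\<And>y. a \<le> y \<Longrightarrow> y \<le> b \<Longrightarrow> same_cell Z y t"
proof -
  have s: "s \<notin> Z" using assms same_cell_eq[OF same_cell_sym[OF assms(3)]] by auto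
  obtain a where a: "a < min s t" "\<And>z. z \<in> Z \<Longrightarrow> z < min s t \<Longrightarrow> z < a"
  proof -
    let ?A = "insert (min s t - 1) {z\<in>Z. z < min s t}"
    have "Max ?A < min s t" using assms(1) by (subst Max_less_iff) auto
    then obtain a where a: "Max ?A < a" "a < min s t" using dense by blast
    moreover have "z < a" if "z \<in> Z" "z < min s t" for z
    proof -
      have "z \<le> Max ?A" using that assms(1) by (intro Max_ge) auto
      then show ?thesis using a by auto
    qed
    ultimately show ?thesis using that by blast
  qed
  obtain b where b: "max s t < b" "\<And>z. z \<in> Z \<Longrightarrow> max s t < z \<Longrightarrow> b < z"
  proof -
    let ?A = "insert (max s t + 1) {z\<in>Z. max s t < z}"
    have "max s t < Min ?A" using assms(1) by (subst Min_gr_iff) auto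
    then obtain b where b: "max s t < b" "b < Min ?A" using dense by blast
    moreover have "b < z" if "z \<in> Z" "max s t < z" for z
    proof -
      have "Min ?A \<le> z" using that assms(1) by (intro Min_le) auto
      then show ?thesis using b by auto
    qed
    ultimately show ?thesis using that by blast
  qed
  show ?thesis
  proof (rule that[of a b])
    fix y assume y: "a \<le> y" "y \<le> b"
    show "same_cell Z y t"
      unfolding same_cell_iff
    proof
      fix z assume z: "z \<in> Z"
      then have "z \<noteq> s" "z \<noteq> t" using s assms by auto
      then consider "z < min s t" | "max s t < z"
        using assms(3) z unfolding same_cell_iff by (smt (verit))
      then show "(y < z \<longleftrightarrow> t < z) \<and> (z < y \<longleftrightarrow> z < t)"
        using a(2)[OF z] b(2)[OF z] y by (cases) auto
    qed
  qed (use a b in auto)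
qed

text \<open>In each cell off \<open>Z\<close> both functions are strictly monotone in the same
  direction, so each has at most one root there, and by the endpoint criteria they take negative
  (positive) values in the same cells. So they have roots in the same cells, and \<open>g\<close>
  only has to push each root of \<open>u\<close> onto the root of \<open>f\<close> in its cell, one
  root at a time.\<close>

lemma root_alignment:
  assumes Z: "finite Z" and cu: "continuous_on UNIV u" and cf: "continuous_on UNIV f"
    and mu: "cell_mono Z \<sigma> u" and mf: "cell_mono Z \<sigma> f"
    and ZZ: "\<And>z. z \<in> Z \<Longrightarrow> sgn (u z) = sgn (f z)"
    and fin: "finite {t. u t = 0}"
  obtains g where "strict_mono g" "surj g" "\<And>t. same_cell Z (g t) t" "\<And>t. sgn (u t) = sgn (f (g t))"
proof -
  have sg: "(s * u z < 0 \<longleftrightarrow> s * f z < 0) \<and> (s * u z > 0 \<longleftrightarrow> s * f z > 0)" if "z \<in> Z" for z s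
    using ZZ[OF that] by (auto simp: sgn_if zero_less_mult_iff mult_less_0_iff split: if_splits)
  have neg: "(\<exists>y. same_cell Z y t \<and> \<sigma> t * u y < 0) \<longleftrightarrow> (\<exists>y. same_cell Z y t \<and> \<sigma> t * f y < 0)"
    if "t \<notin> Z" for t
    unfolding neg_in_cell_iff[OF Z cu mu that] neg_in_cell_iff[OF Z cf mf that] using sg by blast
  have pos: "(\<exists>y. same_cell Z y t \<and> \<sigma> t * u y > 0) \<longleftrightarrow> (\<exists>y. same_cell Z y t \<and> \<sigma> t * f y > 0)"
    if "t \<notin> Z" for t
    unfolding pos_in_cell_iff[OF Z cu mu that] pos_in_cell_iff[OF Z cf mf that] using sg by blast
  have root_imp: "(\<exists>y. same_cell Z y t \<and> \<sigma> t * w y < 0) \<and> (\<exists>y. same_cell Z y t \<and> \<sigma> t * w y > 0)"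
    if t: "t \<notin> Z" and m: "cell_mono Z \<sigma> w" and r: "same_cell Z r t" "w r = 0" for t w r
  proof -
    obtain a b where ab: "a < r" "r < b" "\<And>y. a \<le> y \<Longrightarrow> y \<le> b \<Longrightarrow> same_cell Z y t"
      using cell_interval[OF Z t r(1)] by metis
    have "\<sigma> t * w a < \<sigma> t * w r" "\<sigma> t * w r < \<sigma> t * w b"
      using ab by (auto intro!: cell_mono_same_cell[OF m t])
    moreover have "same_cell Z a t" "same_cell Z b t" using ab by auto
    ultimately show ?thesis using r(2) by auto
  qed
  have imp_root: "\<exists>r. same_cell Z r t \<and> w r = 0"
    if t: "t \<notin> Z" and c: "continuous_on UNIV w" and m: "cell_mono Z \<sigma> w"
      and y: "same_cell Z y t" "\<sigma> t * w y < 0" and x: "same_cell Z x t" "\<sigma> t * w x > 0" for t w x y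
  proof -
    have "y < x"
      using cell_mono_same_cell[OF m t _ x(1) y(1)] x y by (metis linorder_less_linear order_less_trans order_less_irrefl)
    have "continuous_on {y..x} (\<lambda>s. \<sigma> t * w s)" by (intro continuous_intros continuous_on_subset[OF c]) auto
    then obtain r where "y \<le> r" "r \<le> x" "\<sigma> t * w r = 0"
      using IVT'[of "\<lambda>s. \<sigma> t * w s" y 0 x] x y \<open>y < x\<close> by auto
    moreover have "same_cell Z r t"
      using same_cell_trans[OF same_cell_between[OF same_cell_trans[OF y(1) same_cell_sym[OF x(1)]]] x(1)]
        calculation by simp
    ultimately show ?thesis using x by (metis less_irrefl mult_eq_0_iff)
  qed
  have roots: "(\<exists>r. same_cell Z r t \<and> u r = 0) \<longleftrightarrow> (\<exists>r. same_cell Z r t \<and> f r = 0)" if "t \<notin> Z" for t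
    using root_imp[OF that mu] root_imp[OF that mf] imp_root[OF that cu mu] imp_root[OF that cf mf]
      neg[OF that] pos[OF that] by meson
  have unique: "r = r'" if "t \<notin> Z" "cell_mono Z \<sigma> w" "same_cell Z r t" "same_cell Z r' t" "w r = 0" "w r' = 0"
    for t w r r'
    using cell_mono_same_cell[OF that(2,1)] that(3-) by (metis linorder_less_linear order_less_irrefl)
  define X where "X = {t. t \<notin> Z \<and> u t = 0}"
  have "finite X" using fin by (rule rev_finite_subset) (auto simp: X_def)
  have "\<exists>g. strict_mono g \<and> surj g \<and> (\<forall>t. same_cell Z (g t) t) \<and> (\<forall>\<xi>\<in>Y. f (g \<xi>) = 0)"
    if "Y \<subseteq> X" for Y
    using finite_subset[OF that \<open>finite X\<close>] that
  proof (induction Y)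
    case empty
    show ?case by (intro exI[of _ id]) (auto simp: strict_mono_def same_cell_def)
  next
    case (insert \<xi> Y)
    then obtain g where g: "strict_mono g" "surj g" "\<And>t. same_cell Z (g t) t" "\<And>\<eta>. \<eta> \<in> Y \<Longrightarrow> f (g \<eta>) = 0" by auto
    have \<xi>: "\<xi> \<notin> Z" "u \<xi> = 0" using insert by (auto simp: X_def)
    then obtain \<zeta> where \<zeta>: "same_cell Z \<zeta> \<xi>" "f \<zeta> = 0"
    proof -
      have "same_cell Z \<xi> \<xi>" by (simp add: same_cell_def)
      then show ?thesis using roots[OF \<xi>(1)] \<xi>(2) that by blast
    qed
    have g\<xi>: "g \<xi> \<notin> Z" using same_cell_eq[OF same_cell_sym[OF g(3)[of \<xi>]]] \<xi>(1) by auto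
    have "same_cell Z \<zeta> (g \<xi>)" by (rule same_cell_trans[OF \<zeta>(1) same_cell_sym[OF g(3)]])
    then obtain a b where ab: "a < \<zeta>" "a < g \<xi>" "\<zeta> < b" "g \<xi> < b"
      and ab2: "\<And>y. a \<le> y \<Longrightarrow> y \<le> b \<Longrightarrow> same_cell Z y (g \<xi>)"
      using cell_interval[OF Z g\<xi>] by metis
    obtain k where k: "strict_mono k" "surj k" "k (g \<xi>) = \<zeta>" "\<And>t. t \<le> a \<or> b \<le> t \<Longrightarrow> k t = t"
      using relocate[of a "g \<xi>" \<zeta> b] ab by metis
    have kc: "same_cell Z (k t) t" for t
    proof (cases "t \<le> a \<or> b \<le> t")
      case True then show ?thesis using k(4) by (simp add: same_cell_def)
    next
      case False
      then have "k a \<le> k t" "k t \<le> k b" using k(1) by (auto simp: strict_mono_less_eq)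
      then have "a \<le> k t" "k t \<le> b" using k(4) by auto
      moreover have "a \<le> t" "t \<le> b" using False by auto
      ultimately have "same_cell Z (k t) (g \<xi>)" "same_cell Z t (g \<xi>)" using ab2 by auto
      then show ?thesis by (rule same_cell_trans[OF _ same_cell_sym])
    qed
    have "f (k (g \<eta>)) = 0" if "\<eta> \<in> Y" for \<eta>
    proof -
      have \<eta>: "\<eta> \<notin> Z" "u \<eta> = 0" "\<eta> \<noteq> \<xi>" using insert that by (auto simp: X_def)
      \<comment> \<open>A root placed earlier and lying in \<open>[a, b]\<close> would give
        \<open>u\<close> two roots in the cell of \<xi>; hence \<open>k\<close> leaves the earlier
        roots where they are.\<close>
      have "\<not> (a \<le> g \<eta> \<and> g \<eta> \<le> b)"
      proof
        assume "a \<le> g \<eta> \<and> g \<eta> \<le> b"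
        then have "same_cell Z (g \<eta>) (g \<xi>)" using ab2 by auto
        then have "same_cell Z \<eta> \<xi>"
          by (rule same_cell_trans[OF same_cell_sym[OF g(3)] same_cell_trans[OF _ g(3)]])
        moreover have "same_cell Z \<xi> \<xi>" by (simp add: same_cell_def)
        ultimately show False using unique[OF \<xi>(1) mu] \<xi> \<eta> by blast
      qed
      then have "k (g \<eta>) = g \<eta>" using k(4)[of "g \<eta>"] by linarith
      then show ?thesis using g(4) that by simp
    qed
    moreover have "surj (k \<circ> g)" using k(2) g(2) by (rule comp_surj[rotated])
    moreover have "strict_mono (k \<circ> g)" using k(1) g(1) by (rule strict_mono_o)
    moreover have "same_cell Z ((k \<circ> g) t) t" for t using same_cell_trans[OF kc g(3)] by simp
    ultimately show ?case using k(3) \<zeta>(2) by (intro exI[of _ "k \<circ> g"]) (auto simp: o_def)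
  qed
  then obtain g where g: "strict_mono g" "surj g" "\<And>t. same_cell Z (g t) t" "\<And>\<xi>. \<xi> \<in> X \<Longrightarrow> f (g \<xi>) = 0"
    by (meson order_refl)
  have "sgn (u t) = sgn (f (g t))" for t
  proof (cases "t \<in> Z")
    case True
    then show ?thesis using same_cell_eq[OF g(3)] ZZ by auto
  next
    case t: False
    have "\<sigma> t \<noteq> 0"
    proof -
      have "same_cell Z t t" by (simp add: same_cell_def)
      then obtain a b where ab: "a < t" "\<And>y. a \<le> y \<Longrightarrow> y \<le> b \<Longrightarrow> same_cell Z y t" "t < b"
        using cell_interval[OF Z t] by metis
      then have "\<sigma> t * u a < \<sigma> t * u t" using cell_mono_same_cell[OF mu t] by auto
      then show ?thesis by auto
    qed
    have *: "sgn (\<sigma> t * u t) = sgn (\<sigma> t * f (g t))"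
    proof (cases "\<exists>r. same_cell Z r t \<and> u r = 0")
      case True
      then obtain r where r: "same_cell Z r t" "u r = 0" by blast
      have "r \<notin> Z" using r(1) t same_cell_eq[OF same_cell_sym[OF r(1)]] by auto
      then have fr: "f (g r) = 0" using g(4) r by (auto simp: X_def)
      have sgr: "same_cell Z (g r) t" by (rule same_cell_trans[OF g(3) r(1)])
      have tt: "same_cell Z t t" by (simp add: same_cell_def)
      consider "t < r" | "t = r" | "r < t" by linarith
      then show ?thesis
      proof cases
        case 1
        then have "g t < g r" using g(1) by (simp add: strict_mono_def)
        then have "\<sigma> t * f (g t) < 0" using cell_mono_same_cell[OF mf t _ g(3) sgr] fr by auto
        moreover have "\<sigma> t * u t < 0" using cell_mono_same_cell[OF mu t 1 tt r(1)] r by auto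
        ultimately show ?thesis by simp
      next
        case 2 then show ?thesis using r fr by simp
      next
        case 3
        then have "g r < g t" using g(1) by (simp add: strict_mono_def)
        then have "\<sigma> t * f (g t) > 0" using cell_mono_same_cell[OF mf t _ sgr g(3)] fr by auto
        moreover have "\<sigma> t * u t > 0" using cell_mono_same_cell[OF mu t 3 r(1) tt] r by auto
        ultimately show ?thesis by simp
      qed
    next
      case False
      then have Ff: "\<not> (\<exists>r. same_cell Z r t \<and> f r = 0)" using roots[OF t] by blast
      have tt: "same_cell Z t t" by (simp add: same_cell_def)
      consider "\<sigma> t * u t > 0" | "\<sigma> t * u t < 0" using False tt \<open>\<sigma> t \<noteq> 0\<close>
        by (metis linorder_less_linear mult_eq_0_iff)
      then show ?thesis
      proof cases
        case 1
        then have "\<not> (\<exists>y. same_cell Z y t \<and> \<sigma> t * u y < 0)"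
          using imp_root[OF t cu mu _ _ tt] False by blast
        then have "\<not> \<sigma> t * f (g t) < 0" using neg[OF t] g(3) by blast
        moreover have "f (g t) \<noteq> 0" using Ff g(3) by blast
        ultimately have "\<sigma> t * f (g t) > 0" using \<open>\<sigma> t \<noteq> 0\<close> by (metis linorder_less_linear mult_eq_0_iff)
        then show ?thesis using 1 by simp
      next
        case 2
        then have "\<not> (\<exists>y. same_cell Z y t \<and> \<sigma> t * u y > 0)"
          using imp_root[OF t cu mu tt] False by blast
        then have "\<not> \<sigma> t * f (g t) > 0" using pos[OF t] g(3) by blast
        moreover have "f (g t) \<noteq> 0" using Ff g(3) by blast
        ultimately have "\<sigma> t * f (g t) < 0" using \<open>\<sigma> t \<noteq> 0\<close> by (metis linorder_less_linear mult_eq_0_iff)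
        then show ?thesis using 2 by simp
      qed
    qed
    then show ?thesis using \<open>\<sigma> t \<noteq> 0\<close> by (simp add: sgn_mult sgn_0_0)
  qed
  then show ?thesis by (rule that[OF g(1-3)])
qed

section \<open>Quantifier elimination over the reals\<close>

inductive_set polyfun :: "(('v \<Rightarrow> real) \<Rightarrow> real) set" where
  polyfun_const: "(\<lambda>_. c) \<in> polyfun"
| polyfun_var: "(\<lambda>e. e i) \<in> polyfun"
| polyfun_add: "f \<in> polyfun \<Longrightarrow> g \<in> polyfun \<Longrightarrow> (\<lambda>e. f e + g e) \<in> polyfun"
| polyfun_mult: "f \<in> polyfun \<Longrightarrow> g \<in> polyfun \<Longrightarrow> (\<lambda>e. f e * g e) \<in> polyfun"

lemmas polyfun_intros = polyfun.intros

lemma polyfun_uminus: "f \<in> polyfun \<Longrightarrow> (\<lambda>e. - f e) \<in> polyfun"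
  using polyfun_mult[OF polyfun_const[of "-1"]] by simp

lemma polyfun_diff: "f \<in> polyfun \<Longrightarrow> g \<in> polyfun \<Longrightarrow> (\<lambda>e. f e - g e) \<in> polyfun"
  using polyfun_add[OF _ polyfun_uminus] by simp

lemma polyfun_power: "f \<in> polyfun \<Longrightarrow> (\<lambda>e. f e ^ k) \<in> polyfun"
  by (induction k) (auto intro: polyfun_intros)

lemma polyfun_sum: "(\<And>i. i \<in> I \<Longrightarrow> f i \<in> polyfun) \<Longrightarrow> (\<lambda>e. \<Sum>i\<in>I. f i e) \<in> polyfun"
  by (induction I rule: infinite_finite_induct) (auto intro: polyfun_intros)

lemma polyfun_if: "f \<in> polyfun \<Longrightarrow> g \<in> polyfun \<Longrightarrow> (\<lambda>e. if b then f e else g e) \<in> polyfun"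
  by (cases b) auto

text \<open>\<open>d\<close> bounds the number of coefficients, not the degree: the degree bound is \<open>d - 1\<close>,
  and \<open>d = 0\<close> forces the zero polynomial.\<close>
definition param_poly :: "nat \<Rightarrow> (('v \<Rightarrow> real) \<Rightarrow> real poly) \<Rightarrow> bool" where
  "param_poly d F \<longleftrightarrow> (\<forall>n. (\<lambda>e. coeff (F e) n) \<in> polyfun) \<and> (\<forall>e n. d \<le> n \<longrightarrow> coeff (F e) n = 0)"

lemma param_poly_mono: "param_poly d F \<Longrightarrow> d \<le> d' \<Longrightarrow> param_poly d' F"
  unfolding param_poly_def by auto

lemma param_poly_coeff: "param_poly d F \<Longrightarrow> (\<lambda>e. coeff (F e) n) \<in> polyfun"
  unfolding param_poly_def by auto

text \<open>Dropping the formal leading coefficient lowers the bound at all environments, but leaves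
  the polynomial unchanged only where that coefficient vanishes; it serves the degenerate branch of
  the elimination.\<close>

definition trunc_poly :: "nat \<Rightarrow> (('v \<Rightarrow> real) \<Rightarrow> real poly) \<Rightarrow> ('v \<Rightarrow> real) \<Rightarrow> real poly" where
  "trunc_poly d F e = F e - monom (coeff (F e) d) d"

lemma param_poly_trunc: "param_poly (Suc d) F \<Longrightarrow> param_poly d (trunc_poly d F)"
  unfolding param_poly_def trunc_poly_def
  by (auto intro!: polyfun_diff polyfun_if polyfun_const simp: Suc_le_eq)

lemma trunc_poly_eq: "coeff (F e) d = 0 \<Longrightarrow> trunc_poly d F e = F e"
  by (simp add: trunc_poly_def)

lemma param_poly_pderiv: "param_poly (Suc d) F \<Longrightarrow> param_poly d (\<lambda>e. pderiv (F e))"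
  unfolding param_poly_def coeff_pderiv by (auto intro!: polyfun_intros)

lemma param_poly_smult: "c \<in> polyfun \<Longrightarrow> param_poly d F \<Longrightarrow> param_poly d (\<lambda>e. smult (c e) (F e))"
  unfolding param_poly_def by (auto intro!: polyfun_intros)

text \<open>Division that multiplies by the leading coefficient instead of dividing by it, so
  coefficients stay polynomial. Only values at roots of \<open>q\<close> matter, hence no quotient
  is kept.\<close>

lemma pseudo_remainder:
  assumes q: "param_poly (Suc dq) q" and p: "param_poly dp p"
  shows "\<exists>r k. param_poly dq r \<and>
    (\<forall>e t. poly (q e) t = 0 \<longrightarrow> poly (r e) t = coeff (q e) dq ^ k * poly (p e) t)"
  using p
proof (induction dp arbitrary: p)
  case 0
  then show ?case by (intro exI[of _ p] exI[of _ 0]) (auto intro: param_poly_mono)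
next
  case (Suc dp)
  show ?case
  proof (cases "Suc dp \<le> dq")
    case True
    then show ?thesis using Suc.prems by (intro exI[of _ p] exI[of _ 0]) (auto intro: param_poly_mono)
  next
    case False
    define s where "s e = smult (coeff (q e) dq) (p e) - monom (coeff (p e) dp) (dp - dq) * q e" for e
    have "param_poly dp s"
      unfolding param_poly_def
    proof (intro conjI allI impI)
      fix n
      show "(\<lambda>e. coeff (s e) n) \<in> polyfun"
        unfolding s_def coeff_diff coeff_smult coeff_monom_mult
        by (intro polyfun_diff polyfun_mult polyfun_if polyfun_const)
          (use q Suc.prems in \<open>auto simp: param_poly_def\<close>)
    next
      fix e n assume "dp \<le> n"
      then consider "n = dp" | "Suc dp \<le> n" by linarith
      then show "coeff (s e) n = 0"
      proof cases
        case 1 then show ?thesis using False by (simp add: s_def coeff_monom_mult)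
      next
        case 2
        then have "Suc dq \<le> n - (dp - dq)" using False by auto
        then show ?thesis using q Suc.prems 2 by (simp add: s_def coeff_monom_mult param_poly_def)
      qed
    qed
    then obtain r k where r: "param_poly dq r"
      "\<And>e t. poly (q e) t = 0 \<Longrightarrow> poly (r e) t = coeff (q e) dq ^ k * poly (s e) t"
      using Suc.IH by blast
    have "poly (r e) t = coeff (q e) dq ^ Suc k * poly (p e) t" if "poly (q e) t = 0" for e t
      using r(2)[OF that] that by (simp add: s_def)
    then show ?thesis using r(1) by blast
  qed
qed

text \<open>A second factor \<open>coeff (q e) dq ^ k\<close> turns the power of the leading
  coefficient into an even one, so the remainder has the sign of \<open>p\<close> whatever the sign
  of that coefficient.\<close>

lemma pseudo_remainder_sgn:
  assumes q: "param_poly (Suc dq) q" and p: "param_poly dp p"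
  shows "\<exists>r. param_poly dq r \<and>
    (\<forall>e t. coeff (q e) dq \<noteq> 0 \<longrightarrow> poly (q e) t = 0 \<longrightarrow> sgn (poly (r e) t) = sgn (poly (p e) t))"
proof -
  obtain r k where r: "param_poly dq r"
    "\<And>e t. poly (q e) t = 0 \<Longrightarrow> poly (r e) t = coeff (q e) dq ^ k * poly (p e) t"
    using pseudo_remainder[OF q p] by blast
  show ?thesis
  proof (intro exI[of _ "\<lambda>e. smult (coeff (q e) dq ^ k) (r e)"] conjI allI impI)
    show "param_poly dq (\<lambda>e. smult (coeff (q e) dq ^ k) (r e))"
      by (intro param_poly_smult polyfun_power param_poly_coeff[OF q] r)
    fix e t assume *: "coeff (q e) dq \<noteq> 0" "poly (q e) t = 0"
    have "(sgn (coeff (q e) dq) ^ k)\<^sup>2 = ((sgn (coeff (q e) dq))\<^sup>2) ^ k"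
      by (simp add: mult.commute flip: power_mult)
    also have "\<dots> = 1" using *(1) by (simp add: sgn_real_def)
    finally show "sgn (poly (smult (coeff (q e) dq ^ k) (r e)) t) = sgn (poly (p e) t)"
      using * by (simp add: r(2) sgn_mult flip: mult.assoc power2_eq_square)
  qed
qed

section \<open>Sign diagrams of families of univariate polynomials\<close>

definition same_signs :: "('v \<Rightarrow> real) \<Rightarrow> ('v \<Rightarrow> real) \<Rightarrow> (('v \<Rightarrow> real) \<Rightarrow> real) set \<Rightarrow> bool" where
  "same_signs e e' F \<longleftrightarrow> (\<forall>f\<in>F. sgn (f e) = sgn (f e'))"

text \<open>One reparametrization of the line serves the whole family: this says that the sign
  diagrams agree, including the order of all roots, without listing roots. Surjectivity makes
  \<open>h\<close> continuous and lets points of the target line be pulled back.\<close>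

definition sign_matched :: "('v \<Rightarrow> real) \<Rightarrow> ('v \<Rightarrow> real) \<Rightarrow> (nat \<times> (('v \<Rightarrow> real) \<Rightarrow> real poly)) set \<Rightarrow> bool" where
  "sign_matched e e' Ps \<longleftrightarrow> (\<exists>h::real \<Rightarrow> real. strict_mono h \<and> surj h \<and>
    (\<forall>x\<in>Ps. \<forall>t. sgn (poly (snd x e) t) = sgn (poly (snd x e') (h t))))"

lemma increasing_tail:
  fixes p :: "real poly"
  assumes "0 < degree p"
  shows "\<exists>y. \<bar>poly p y\<bar> > C \<and> y < c" "\<exists>y. \<bar>poly p y\<bar> > C \<and> c < y"
proof -
  have *: "\<exists>y. \<bar>poly q y\<bar> > C \<and> c < y" if "0 < degree q" for c and q :: "real poly"
  proof -
    obtain a p' where q: "q = pCons a p'" by (cases q)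
    then have "p' \<noteq> 0" using that by auto
    from poly_infinity[OF this, of "C + 1" a] obtain r where
      r: "\<And>z. r \<le> norm z \<Longrightarrow> C + 1 \<le> norm (poly (pCons a p') z)" by blast
    have "C + 1 \<le> \<bar>poly q (\<bar>r\<bar> + \<bar>c\<bar> + 1)\<bar>" using r[of "\<bar>r\<bar> + \<bar>c\<bar> + 1"] q by auto
    then show ?thesis by (intro exI[of _ "\<bar>r\<bar> + \<bar>c\<bar> + 1"]) auto
  qed
  show "\<exists>y. \<bar>poly p y\<bar> > C \<and> c < y" by (rule *[OF assms])
  have "0 < degree (pcompose p [:0, -1:])" using assms by (simp add: degree_pcompose)
  from *[OF this, of "- c"] show "\<exists>y. \<bar>poly p y\<bar> > C \<and> y < c"
    unfolding poly_pcompose by (metis minus_less_iff minus_minus mult.commute mult_minus1 poly_0 poly_pCons add_0 mult_zero_right add_0_right mult_1)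
qed

text \<open>The derivative of \<open>p2\<close> at \<open>h t\<close> has the sign of the derivative
  of \<open>p\<close> at \<open>t\<close>, so the mean value theorem makes \<open>p2\<close>
  composed with \<open>h\<close> monotone in the direction prescribed by \<open>p\<close>. The case
  of \<open>p\<close> itself is \<open>h = id\<close>.\<close>

lemma cell_mono_poly:
  fixes p p2 :: "real poly" and h :: "real \<Rightarrow> real"
  assumes h: "strict_mono h" "surj h" and Z: "finite Z"
    and d: "\<And>t. sgn (poly (pderiv p) t) = sgn (poly (pderiv p2) (h t))"
    and roots: "\<And>t. poly (pderiv p) t = 0 \<Longrightarrow> t \<in> Z"
  shows "cell_mono Z (\<lambda>t. sgn (poly (pderiv p) t)) (\<lambda>t. poly p2 (h t))"
proof -
  let ?\<sigma> = "\<lambda>t. sgn (poly (pderiv p) t)"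
  have const: "?\<sigma> x = ?\<sigma> y" if noz: "\<And>z. z \<in> Z \<Longrightarrow> x \<le> z \<Longrightarrow> z \<le> y \<Longrightarrow> False" and xy: "x \<le> y" for x y
  proof (rule ccontr)
    assume "?\<sigma> x \<noteq> ?\<sigma> y"
    then have ne: "x \<noteq> y" by auto
    have "poly (pderiv p) x \<noteq> 0" "poly (pderiv p) y \<noteq> 0" using roots noz xy by (meson order_refl)+
    then have "poly (pderiv p) x * poly (pderiv p) y < 0"
      using \<open>?\<sigma> x \<noteq> ?\<sigma> y\<close> by (auto simp: mult_less_0_iff sgn_real_def split: if_splits)
    then obtain z where "x < z" "z < y" "poly (pderiv p) z = 0"
      using poly_IVT[of x y "pderiv p"] xy ne by auto
    then show False using roots noz[of z] by auto
  qed
  have d1: "0 < degree p2"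
  proof (rule ccontr)
    assume "\<not> 0 < degree p2"
    then have "pderiv p2 = 0" by (simp add: pderiv_eq_0_iff)
    then have "poly (pderiv p) t = 0" for t using d[of t] by (simp add: sgn_zero_iff)
    then have "UNIV \<subseteq> Z" using roots by auto
    then show False using Z infinite_UNIV_char_0 finite_subset by blast
  qed
  have m: "0 < ?\<sigma> t * (poly p2 (h y) - poly p2 (h x))"
    if t: "t \<notin> Z" "x < y" "\<forall>z\<in>Z. \<not> (min x t < z \<and> z < max y t)" for t x y
  proof -
    have "h x < h y" using h t by (simp add: strict_mono_def)
    then obtain s where s: "h x < s" "s < h y"
      "poly p2 (h y) - poly p2 (h x) = (h y - h x) * poly (pderiv p2) s"
      using poly_MVT by blast
    \<comment> \<open>The mean value point is pulled back to \<open>r\<close> between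
      \<open>x\<close> and \<open>y\<close>. No point of \<open>Z\<close> separates \<open>r\<close>
      from \<open>t\<close>, so the derivative of \<open>p\<close> has the same sign at
      both.\<close>
    obtain r where r: "s = h r" using h(2) by (metis surjD)
    then have "x < r" "r < y" using s h(1) by (auto simp: strict_mono_less)
    have "?\<sigma> (min r t) = ?\<sigma> (max r t)"
    proof (rule const)
      fix z assume z: "z \<in> Z" "min r t \<le> z" "z \<le> max r t"
      then have "z \<noteq> t" using t by auto
      then have "min x t < z \<and> z < max y t"
        using z(2,3) \<open>x < r\<close> \<open>r < y\<close> by (auto simp: min_def max_def split: if_splits)
      then show False using t(3) z(1) by blast
    qed simp
    then have "?\<sigma> r = ?\<sigma> t" by (cases "r \<le> t") auto
    then have "sgn (poly (pderiv p2) s) = ?\<sigma> t" using d[of r] r by simp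
    moreover have "poly (pderiv p) t \<noteq> 0" using roots t by auto
    ultimately have "0 < ?\<sigma> t * poly (pderiv p2) s"
      by (auto simp: sgn_real_def split: if_splits)
    then have "0 < (h y - h x) * (?\<sigma> t * poly (pderiv p2) s)" using \<open>h x < h y\<close> by simp
    then show ?thesis unfolding s(3) by (simp only: mult.left_commute)
  qed
  show ?thesis
    unfolding cell_mono_def
  proof (intro conjI allI impI)
    fix t assume t: "\<forall>z\<in>Z. t < z"
    then have tz: "t \<notin> Z" by auto
    obtain s where s: "\<bar>poly p2 s\<bar> > \<bar>poly p2 (h t)\<bar>" "s < h t"
      using increasing_tail(1)[OF d1] by blast
    obtain r where r: "s = h r" using h(2) by (metis surjD)
    then have "r < t" using s h(1) by (auto simp: strict_mono_less)
    then have "0 < ?\<sigma> t * (poly p2 (h t) - poly p2 (h r))" using t by (intro m[OF tz]) auto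
    \<comment> \<open>The value at \<open>h r\<close> is larger in modulus than the one at
      \<open>h t\<close>, so the sign of their difference is decided by the value at
      \<open>h r\<close>.\<close>
    then have "?\<sigma> t * poly p2 (h r) < 0" using s r
      by (auto simp: sgn_real_def split: if_splits)
    then show "\<exists>y<t. ?\<sigma> t * poly p2 (h y) < 0" using \<open>r < t\<close> by blast
  next
    fix t assume t: "\<forall>z\<in>Z. z < t"
    then have tz: "t \<notin> Z" by auto
    obtain s where s: "\<bar>poly p2 s\<bar> > \<bar>poly p2 (h t)\<bar>" "h t < s"
      using increasing_tail(2)[OF d1] by blast
    obtain r where r: "s = h r" using h(2) by (metis surjD)
    then have "t < r" using s h(1) by (auto simp: strict_mono_less)
    then have "0 < ?\<sigma> t * (poly p2 (h r) - poly p2 (h t))" using t by (intro m[OF tz]) auto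
    then have "0 < ?\<sigma> t * poly p2 (h r)" using s r
      by (auto simp: sgn_real_def split: if_splits)
    then show "\<exists>y>t. 0 < ?\<sigma> t * poly p2 (h y)" using \<open>t < r\<close> by blast
  qed (rule m)
qed

lemma strict_mono_surj_continuous:
  fixes h :: "real \<Rightarrow> real"
  assumes "strict_mono h" "surj h"
  shows "continuous_on UNIV h"
proof -
  have "mono h" using assms(1) by (rule strict_mono_mono)
  then have "continuous_on UNIV h"
    by (intro continuous_onI_mono) (use assms(2) in \<open>auto simp: mono_def\<close>)
  then show ?thesis .
qed

text \<open>The Cohen--Hoermander step: the signs of \<open>p\<close> at the critical points of \<open>p\<close> and at the roots of
  the other polynomials determine all the signs of \<open>p\<close>.\<close>
lemma sign_matching_extend:
  fixes p p2 :: "real poly"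
  assumes h: "strict_mono h" "surj h" and I: "finite I"
    and q: "\<And>i t. i \<in> I \<Longrightarrow> sgn (poly (q i) t) = sgn (poly (q2 i) (h t))"
    and q0: "\<And>i. i \<in> I \<Longrightarrow> q i \<noteq> 0"
    and d: "\<And>t. sgn (poly (pderiv p) t) = sgn (poly (pderiv p2) (h t))"
    and d0: "pderiv p \<noteq> 0"
    and r: "\<And>i t. i \<in> I \<Longrightarrow> poly (q i) t = 0 \<Longrightarrow> sgn (poly p t) = sgn (poly p2 (h t))"
    and rd: "\<And>t. poly (pderiv p) t = 0 \<Longrightarrow> sgn (poly p t) = sgn (poly p2 (h t))"
  shows "\<exists>h'. strict_mono h' \<and> surj h' \<and> (\<forall>i\<in>I. \<forall>t. sgn (poly (q i) t) = sgn (poly (q2 i) (h' t))) \<and>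
    (\<forall>t. sgn (poly p t) = sgn (poly p2 (h' t)))"
proof -
  define Z where "Z = {t. poly (pderiv p) t = 0} \<union> (\<Union>i\<in>I. {t. poly (q i) t = 0})"
  have Z: "finite Z" unfolding Z_def using I q0 d0 by (auto intro: poly_roots_finite)
  have "p \<noteq> 0" using d0 by auto
  have "cell_mono Z (\<lambda>t. sgn (poly (pderiv p) t)) (\<lambda>t. poly p (id t))"
    by (rule cell_mono_poly[OF _ _ Z]) (auto simp: Z_def strict_mono_def)
  then have mp: "cell_mono Z (\<lambda>t. sgn (poly (pderiv p) t)) (poly p)" by simp
  have mp2: "cell_mono Z (\<lambda>t. sgn (poly (pderiv p) t)) (\<lambda>t. poly p2 (h t))"
    by (rule cell_mono_poly[OF h Z d]) (auto simp: Z_def)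
  have "continuous_on UNIV (\<lambda>t. poly p2 (h t))"
    by (intro continuous_intros strict_mono_surj_continuous h)
  moreover have "continuous_on UNIV (poly p)" by (intro continuous_intros)
  moreover have "sgn (poly p z) = sgn (poly p2 (h z))" if "z \<in> Z" for z
    using that r rd by (auto simp: Z_def)
  ultimately obtain g where g: "strict_mono g" "surj g" "\<And>t. same_cell Z (g t) t"
    "\<And>t. sgn (poly p t) = sgn (poly p2 (h (g t)))"
    using root_alignment[OF Z _ _ mp mp2 _ poly_roots_finite[OF \<open>p \<noteq> 0\<close>]] by blast
  \<comment> \<open>The map \<open>g\<close> moves points only within their cells, and
    \<open>Z\<close> contains all roots of \<open>q i\<close>; so composing with \<open>g\<close>
    does not disturb the matches already achieved.\<close>
  have "sgn (poly (q i) t) = sgn (poly (q2 i) (h (g t)))" if i: "i \<in> I" for i t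
  proof -
    have "sgn (poly (q i) t) = sgn (poly (q i) (g t))"
    proof (cases "t \<in> Z")
      case True then show ?thesis using same_cell_eq[OF g(3)] by simp
    next
      case t: False
      have nz: "poly (q i) s \<noteq> 0" if "same_cell Z s t" for s
      proof
        assume "poly (q i) s = 0"
        then have "s \<in> Z" using i by (auto simp: Z_def)
        then show False using t same_cell_eq[OF same_cell_sym[OF that]] by auto
      qed
      have tt: "same_cell Z t t" by (simp add: same_cell_def)
      show ?thesis
      proof (rule ccontr)
        assume ne: "\<not> ?thesis"
        then have "poly (q i) t * poly (q i) (g t) < 0"
          using nz[OF tt] nz[OF g(3)] by (auto simp: mult_less_0_iff sgn_real_def split: if_splits)
        moreover have "t \<noteq> g t" using ne by auto
        ultimately obtain s where s: "min t (g t) < s" "s < max t (g t)" "poly (q i) s = 0"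
          using poly_IVT[of t "g t" "q i"] poly_IVT[of "g t" t "q i"]
          by (cases "t < g t") (auto simp: mult.commute)
        have "same_cell Z s t"
        proof (cases "t < g t")
          case True
          then have "same_cell Z s (g t)"
            using s by (intro same_cell_between[OF same_cell_sym[OF g(3)]]) auto
          then show ?thesis by (rule same_cell_trans[OF _ g(3)])
        next
          case False
          then show ?thesis using s by (intro same_cell_between[OF g(3)]) auto
        qed
        then show False using nz s by blast
      qed
    qed
    then show ?thesis using q[OF i] by simp
  qed
  moreover have "strict_mono (h \<circ> g)" by (rule strict_mono_o[OF h(1) g(1)])
  moreover have "surj (h \<circ> g)" by (rule comp_surj[OF g(2) h(2)])
  ultimately show ?thesis using g(4) by (intro exI[of _ "h \<circ> g"]) (simp add: o_def)
qed

lemma param_poly_0: "param_poly 0 P \<Longrightarrow> P e = 0"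
  unfolding param_poly_def by (auto simp: poly_eq_iff)

text \<open>Induction on the multiset of coefficient bounds. A member \<open>p\<close> of largest
  bound is exchanged for its derivative and its remainders modulo that derivative and all other
  members. Since \<open>p\<close> has the largest bound, all of these have smaller ones. The new
  family is matched by induction, its remainders carry the signs of \<open>p\<close> at the critical
  points and at the roots of the others, and \<open>sign_matching_extend\<close> recovers
  \<open>p\<close>. Remainders are meaningful only where leading coefficients do not vanish, which
  is why truncated families are treated as well.\<close>

lemma sign_matched_determined:
  fixes Ps :: "(nat \<times> (('v \<Rightarrow> real) \<Rightarrow> real poly)) multiset"
  assumes "\<forall>x\<in>#Ps. param_poly (fst x) (snd x)"
  shows "\<exists>F. finite F \<and> F \<subseteq> polyfun \<and> (\<forall>e e'. same_signs e e' F \<longrightarrow> sign_matched e e' (set_mset Ps))"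
  using assms
proof (induction Ps rule: wf_induct_rule[OF wf_inv_image[OF wf_mult[OF wf_less_than]], of "image_mset fst"])
  case (1 Ps)
  let ?det = "\<lambda>F Ps. finite F \<and> F \<subseteq> polyfun \<and> (\<forall>e e'. same_signs e e' F \<longrightarrow> sign_matched e e' (set_mset Ps))"
  \<comment> \<open>A member with bound 0 gives index 0 by truncated subtraction, where its
    coefficient vanishes anyway.\<close>
  define leads where "leads = (\<lambda>x e. coeff (snd x e) (fst x - 1)) ` set_mset Ps"
  have leads: "finite leads" "leads \<subseteq> polyfun"
    using "1.prems" by (auto simp: leads_def intro: param_poly_coeff)
  show ?case
  proof (cases "\<forall>x\<in>#Ps. fst x \<le> 1")
    case True
    have "sign_matched e e' (set_mset Ps)" if "same_signs e e' leads" for e e'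
      unfolding sign_matched_def
    proof (intro exI[of _ id] conjI ballI allI)
      fix x t assume x: "x \<in># Ps"
      then have "coeff (snd x e) n = 0" if "1 \<le> n" for e n
        using "1.prems" True that unfolding param_poly_def by (metis le_trans)
      then have "degree (snd x e) = 0" for e
        using degree_le[of 0 "snd x e"] by auto
      then have a: "poly (snd x e) t = coeff (snd x e) 0" for e t by (simp add: poly_altdef)
      have "fst x - 1 = 0" using True x by auto
      have "sgn (coeff (snd x e) (fst x - 1)) = sgn (coeff (snd x e') (fst x - 1))"
        using that x unfolding same_signs_def leads_def by auto
      then show "sgn (poly (snd x e) t) = sgn (poly (snd x e') (id t))"
        using a \<open>fst x - 1 = 0\<close> by simp
    qed (auto simp: strict_mono_def)
    then show ?thesis using leads by blast
  next
    case False
    define D where "D = Max (fst ` set_mset Ps)"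
    have ne: "fst ` set_mset Ps \<noteq> {}" using False by auto
    have "D \<in> fst ` set_mset Ps" unfolding D_def by (rule Max_in) (use ne in auto)
    then obtain p where p: "(D, p) \<in># Ps" by auto
    have Dmax: "fst x \<le> D" if "x \<in># Ps" for x unfolding D_def using that by (intro Max_ge) auto
    have "2 \<le> D" using False Dmax by fastforce
    then obtain d where d: "D = Suc d" "1 \<le> d" by (cases D) auto
    have pp: "param_poly (Suc d) p" using "1.prems" p d by auto
    define Rest where "Rest = Ps - {#(Suc d, p)#}"
    have Ps: "Ps = Rest + {#(Suc d, p)#}" using p d by (simp add: Rest_def)
    define Qs where "Qs = Rest + {#(d, \<lambda>e. pderiv (p e))#}"
    have Qs: "param_poly (fst x) (snd x)" "fst x \<le> Suc d" if "x \<in># Qs" for x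
      using that "1.prems" Dmax[of x] d param_poly_pderiv[OF pp] by (auto simp: Qs_def Ps)
    have "\<exists>r. 0 < fst x \<longrightarrow> param_poly (fst x - 1) r \<and> (\<forall>e t. coeff (snd x e) (fst x - 1) \<noteq> 0 \<longrightarrow>
        poly (snd x e) t = 0 \<longrightarrow> sgn (poly (r e) t) = sgn (poly (p e) t))" if "x \<in># Qs" for x
      using pseudo_remainder_sgn[of "fst x - 1" "snd x", OF _ pp] Qs[OF that] by (cases "fst x") auto
    then obtain R where R: "\<And>x. x \<in># Qs \<Longrightarrow> 0 < fst x \<Longrightarrow> param_poly (fst x - 1) (R x)"
      "\<And>x e t. x \<in># Qs \<Longrightarrow> 0 < fst x \<Longrightarrow> coeff (snd x e) (fst x - 1) \<noteq> 0 \<Longrightarrow>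
        poly (snd x e) t = 0 \<Longrightarrow> sgn (poly (R x e) t) = sgn (poly (p e) t)" by metis
    define Rs where "Rs = image_mset (\<lambda>x. (fst x - 1, R x)) (filter_mset (\<lambda>x. 0 < fst x) Qs)"
    have "\<exists>F. ?det F (Rest + ({#(d, \<lambda>e. pderiv (p e))#} + Rs))"
    proof (rule "1.IH")
      have "(image_mset fst Rest + image_mset fst ({#(d, \<lambda>e. pderiv (p e))#} + Rs), image_mset fst Rest + {#Suc d#})
          \<in> mult less_than"
      proof (rule one_step_implies_mult)
        show "\<forall>k\<in>#image_mset fst ({#(d, \<lambda>e. pderiv (p e))#} + Rs). \<exists>j\<in>#{#Suc d#}. (k, j) \<in> less_than"
          using Qs(2) by (auto simp: Rs_def less_Suc_eq_le) (metis fst_conv Suc_pred le_trans not_less_eq_eq Suc_leI diff_le_self le_SucE)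
      qed simp
      then show "(Rest + ({#(d, \<lambda>e. pderiv (p e))#} + Rs), Ps) \<in> inv_image (mult less_than) (image_mset fst)"
        by (simp add: Ps)
      show "\<forall>x\<in>#Rest + ({#(d, \<lambda>e. pderiv (p e))#} + Rs). param_poly (fst x) (snd x)"
        using Qs(1) R(1) by (auto simp: Rs_def Qs_def)
    qed
    then obtain F1 where F1: "?det F1 (Rest + ({#(d, \<lambda>e. pderiv (p e))#} + Rs))" by blast
    \<comment> \<open>The family that replaces \<open>Ps\<close> at environments where the leading
      coefficient of \<open>x\<close> vanishes.\<close>
    have "\<exists>F. 0 < fst x \<longrightarrow> ?det F (Ps - {#x#} + {#(fst x - 1, trunc_poly (fst x - 1) (snd x))#})" if x: "x \<in># Ps" for x
    proof (cases "0 < fst x")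
      case True
      then have fx: "Suc (fst x - 1) = fst x" by simp
      have "\<exists>F. ?det F (Ps - {#x#} + {#(fst x - 1, trunc_poly (fst x - 1) (snd x))#})"
      proof (rule "1.IH")
        have "(image_mset fst (Ps - {#x#}) + {#fst x - 1#}, image_mset fst (Ps - {#x#}) + {#fst x#}) \<in> mult less_than"
          by (rule one_step_implies_mult) (use True in auto)
        moreover have "image_mset fst Ps = image_mset fst (Ps - {#x#}) + {#fst x#}"
          using x by (metis image_mset_add_mset insert_DiffM add_mset_add_single)
        ultimately show "(Ps - {#x#} + {#(fst x - 1, trunc_poly (fst x - 1) (snd x))#}, Ps)
          \<in> inv_image (mult less_than) (image_mset fst)" by simp
        have "param_poly (fst x - 1) (trunc_poly (fst x - 1) (snd x))"
          by (rule param_poly_trunc) (use "1.prems" x fx in auto)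
        then show "\<forall>y\<in>#Ps - {#x#} + {#(fst x - 1, trunc_poly (fst x - 1) (snd x))#}. param_poly (fst y) (snd y)"
          using "1.prems" by (auto dest: in_diffD)
      qed
      then show ?thesis by blast
    qed simp
    then obtain T where T: "\<And>x. x \<in># Ps \<Longrightarrow> 0 < fst x \<Longrightarrow>
        ?det (T x) (Ps - {#x#} + {#(fst x - 1, trunc_poly (fst x - 1) (snd x))#})" by metis
    define F where "F = leads \<union> F1 \<union> (\<Union>x\<in>{x\<in>set_mset Ps. 0 < fst x}. T x)"
    have lead: "sgn (coeff (snd x e) (fst x - 1)) = sgn (coeff (snd x e') (fst x - 1))"
      if "x \<in># Ps" "same_signs e e' F" for x e e'
    proof -
      have "(\<lambda>e. coeff (snd x e) (fst x - 1)) \<in> F" using that(1) unfolding F_def leads_def by blast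
      from bspec[OF that(2)[unfolded same_signs_def] this] show ?thesis .
    qed
    have "sign_matched e e' (set_mset Ps)" if sF: "same_signs e e' F" for e e'
    \<comment> \<open>The case distinction looks at \<open>e\<close> only: the leading coefficients
      belong to \<open>F\<close>, so they vanish at \<open>e'\<close> exactly where they do at
      \<open>e\<close>.\<close>
    proof (cases "\<exists>x\<in>#Ps. 0 < fst x \<and> coeff (snd x e) (fst x - 1) = 0")
      case True
      then obtain x where x: "x \<in># Ps" "0 < fst x" "coeff (snd x e) (fst x - 1) = 0" by blast
      have "same_signs e e' (T x)" using sF x unfolding same_signs_def F_def by auto
      then obtain h where h: "strict_mono h" "surj h"
        "\<And>y t. y \<in># Ps - {#x#} + {#(fst x - 1, trunc_poly (fst x - 1) (snd x))#} \<Longrightarrow>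
          sgn (poly (snd y e) t) = sgn (poly (snd y e') (h t))"
        using T[OF x(1,2)] unfolding sign_matched_def by blast
      have z: "coeff (snd x e') (fst x - 1) = 0" using x(3) lead[OF x(1) sF] by (simp add: sgn_0_0)
      have "sgn (poly (snd y e) t) = sgn (poly (snd y e') (h t))" if "y \<in># Ps" for y t
      proof (cases "y = x")
        case True
        then show ?thesis using h(3)[of "(fst x - 1, trunc_poly (fst x - 1) (snd x))" t]
          by (simp add: trunc_poly_eq[of "snd x", OF x(3)] trunc_poly_eq[of "snd x", OF z] del: One_nat_def)
      next
        case False
        then have "y \<in># Ps - {#x#}" using that by (simp add: in_diff_count)
        then show ?thesis using h(3)[of y t] by simp
      qed
      then show ?thesis unfolding sign_matched_def using h(1,2) by blast
    next
      case nz: False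
      have "same_signs e e' F1" using sF unfolding same_signs_def F_def by auto
      then obtain h where h: "strict_mono h" "surj h"
        "\<And>y t. y \<in># Rest + ({#(d, \<lambda>e. pderiv (p e))#} + Rs) \<Longrightarrow> sgn (poly (snd y e) t) = sgn (poly (snd y e') (h t))"
        using F1 unfolding sign_matched_def by blast
      have nz': "coeff (snd x e) (fst x - 1) \<noteq> 0 \<and> coeff (snd x e') (fst x - 1) \<noteq> 0"
        if "x \<in># Ps" "0 < fst x" for x using nz lead[OF that(1) sF] that by (metis sgn_0_0)
      have nzd: "coeff (pderiv (p e)) (d - 1) \<noteq> 0 \<and> coeff (pderiv (p e')) (d - 1) \<noteq> 0"
        using nz'[of "(Suc d, p)"] d by (simp add: Ps coeff_pderiv)
      have nzQ: "coeff (snd x e) (fst x - 1) \<noteq> 0 \<and> coeff (snd x e') (fst x - 1) \<noteq> 0"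
        if "x \<in># Qs" "0 < fst x" for x
        using that nz' nzd by (auto simp: Qs_def Ps)
      have rr: "sgn (poly (p e) t) = sgn (poly (p e') (h t))"
        if "x \<in># Qs" "0 < fst x" "poly (snd x e) t = 0" for x t
      proof -
        have "sgn (poly (snd x e) t) = sgn (poly (snd x e') (h t))"
          using h(3)[of x t] that(1) by (auto simp: Qs_def)
        then have "poly (snd x e') (h t) = 0" using that(3) by (simp add: sgn_0_0)
        then have "sgn (poly (R x e') (h t)) = sgn (poly (p e') (h t))"
          using R(2)[OF that(1,2)] nzQ[OF that(1,2)] by blast
        moreover have "sgn (poly (R x e) t) = sgn (poly (p e) t)"
          using R(2)[OF that(1,2)] nzQ[OF that(1,2)] that(3) by blast
        moreover have "sgn (poly (R x e) t) = sgn (poly (R x e') (h t))"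
          using h(3)[of "(fst x - 1, R x)" t] that(1,2) by (auto simp: Rs_def)
        ultimately show ?thesis by simp
      qed
      \<comment> \<open>Members with bound 0 are identically zero: they have infinitely many roots,
        so they must stay out of \<open>Z\<close>, and they match under any
        \<open>h\<close>.\<close>
      let ?I = "{x\<in>set_mset Rest. 0 < fst x}"
      have "\<exists>h'. strict_mono h' \<and> surj h' \<and> (\<forall>i\<in>?I. \<forall>t. sgn (poly (snd i e) t) = sgn (poly (snd i e') (h' t))) \<and>
        (\<forall>t. sgn (poly (p e) t) = sgn (poly (p e') (h' t)))"
      proof (rule sign_matching_extend[OF h(1,2)])
        show "finite ?I" by simp
        show "sgn (poly (snd i e) t) = sgn (poly (snd i e') (h t))" if "i \<in> ?I" for i t
          using h(3) that by auto
        show "snd i e \<noteq> 0" if "i \<in> ?I" for i using nz'[of i] that by (auto simp: Ps)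
        show "sgn (poly (pderiv (p e)) t) = sgn (poly (pderiv (p e')) (h t))" for t
          using h(3)[of "(d, \<lambda>e. pderiv (p e))"] by simp
        show "pderiv (p e) \<noteq> 0" using nzd by auto
        show "sgn (poly (p e) t) = sgn (poly (p e') (h t))" if "i \<in> ?I" "poly (snd i e) t = 0" for i t
          using rr[of i t] that by (auto simp: Qs_def)
        show "sgn (poly (p e) t) = sgn (poly (p e') (h t))" if "poly (pderiv (p e)) t = 0" for t
          using rr[of "(d, \<lambda>e. pderiv (p e))" t] that d by (auto simp: Qs_def)
      qed
      then obtain h' where h': "strict_mono h'" "surj h'"
        "\<And>i t. i \<in> ?I \<Longrightarrow> sgn (poly (snd i e) t) = sgn (poly (snd i e') (h' t))"
        "\<And>t. sgn (poly (p e) t) = sgn (poly (p e') (h' t))" by blast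
      have "sgn (poly (snd x e) t) = sgn (poly (snd x e') (h' t))" if "x \<in># Ps" for x t
      proof (cases "x = (Suc d, p)")
        case True then show ?thesis using h'(4) by simp
      next
        case False
        then have xR: "x \<in># Rest" using that by (auto simp: Ps)
        show ?thesis
        proof (cases "fst x = 0")
          case True
          then have "param_poly 0 (snd x)" using "1.prems" that by auto
          then show ?thesis by (simp add: param_poly_0)
        next
          case False then show ?thesis using h'(3)[of x t] xR by simp
        qed
      qed
      then show ?thesis unfolding sign_matched_def using h'(1,2) by blast
    qed
    moreover have "finite F" unfolding F_def using leads F1 T by auto
    moreover have "F \<subseteq> polyfun" unfolding F_def using leads F1 T by auto
    ultimately show ?thesis by blast
  qed
qed

text \<open>A semantic substitute for quantifier-free formulas in the language of ordered fields.\<close>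
definition sign_determined :: "(('v \<Rightarrow> real) \<Rightarrow> bool) \<Rightarrow> bool" where
  "sign_determined \<phi> \<longleftrightarrow>
    (\<exists>F. finite F \<and> F \<subseteq> polyfun \<and> (\<forall>e e'. same_signs e e' F \<longrightarrow> \<phi> e = \<phi> e'))"

lemma polyfun_as_param_poly:
  assumes "f \<in> polyfun"
  shows "\<exists>d P. param_poly d P \<and> (\<forall>e t. f (e(i := t)) = poly (P e) t)"
  using assms
proof induction
  case (polyfun_const c)
  show ?case
    by (intro exI[of _ 1] exI[of _ "\<lambda>_. [:c:]"])
      (auto simp: param_poly_def coeff_pCons intro!: polyfun_intros split: nat.split)
next
  case (polyfun_var j)
  show ?case
  proof (cases "i = j")
    case True
    then show ?thesis
      by (intro exI[of _ 2] exI[of _ "\<lambda>_. [:0, 1:]"])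
        (auto simp: param_poly_def coeff_pCons intro!: polyfun_intros split: nat.split)
  next
    case False
    have "(\<lambda>e. coeff [:e j:] n) \<in> polyfun" for n :: nat
      by (cases n) (auto intro: polyfun_intros)
    then show ?thesis using False
      by (intro exI[of _ 1] exI[of _ "\<lambda>e. [:e j:]"])
        (auto simp: param_poly_def coeff_pCons split: nat.split)
  qed
next
  case (polyfun_add f g)
  then obtain d P d' P' where P: "param_poly d P" "\<And>e t. f (e(i := t)) = poly (P e) t"
    "param_poly d' P'" "\<And>e t. g (e(i := t)) = poly (P' e) t" by metis
  then show ?case
    by (intro exI[of _ "max d d'"] exI[of _ "\<lambda>e. P e + P' e"])
      (auto simp: param_poly_def fun_upd_def intro!: polyfun_intros)
next
  case (polyfun_mult f g)
  then obtain d P d' P' where P: "param_poly d P" "\<And>e t. f (e(i := t)) = poly (P e) t"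
    "param_poly d' P'" "\<And>e t. g (e(i := t)) = poly (P' e) t" by metis
  have "coeff (P e * P' e) n = 0" if "d + d' \<le> n" for e n
    unfolding coeff_mult
  proof (intro sum.neutral ballI)
    fix k assume "k \<in> {..n}"
    then have "d \<le> k \<or> d' \<le> n - k" using that by auto
    then show "coeff (P e) k * coeff (P' e) (n - k) = 0" using P by (auto simp: param_poly_def)
  qed
  then have "param_poly (d + d') (\<lambda>e. P e * P' e)"
    using P(1,3) by (auto simp: param_poly_def coeff_mult intro!: polyfun_sum polyfun_intros)
  then show ?case using P(2,4) by (intro exI[of _ "d + d'"] exI[of _ "\<lambda>e. P e * P' e"]) (auto simp: fun_upd_def)
qed

text \<open>The polynomials deciding \<phi> are read as univariate in variable \<open>i\<close>. If
  their sign diagrams at \<open>e\<close> and \<open>e'\<close> are matched by \<open>h\<close>, a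
  witness \<open>t\<close> at \<open>e\<close> becomes the witness \<open>h t\<close> at
  \<open>e'\<close>.\<close>

theorem sign_determined_ex:
  assumes "sign_determined \<phi>"
  shows "sign_determined (\<lambda>e. \<exists>t. \<phi> (e(i := t)))"
proof -
  obtain F where F: "finite F" "F \<subseteq> polyfun" "\<And>e e'. same_signs e e' F \<Longrightarrow> \<phi> e = \<phi> e'"
    using assms unfolding sign_determined_def by blast
  obtain d P where P: "\<And>f. f \<in> F \<Longrightarrow> param_poly (d f) (P f)"
    "\<And>f e t. f \<in> F \<Longrightarrow> f (e(i := t)) = poly (P f e) t"
    using polyfun_as_param_poly[of _ i] F(2) by (metis subsetD)
  define Ps where "Ps = mset_set ((\<lambda>f. (d f, P f)) ` F)"
  have Ps: "set_mset Ps = (\<lambda>f. (d f, P f)) ` F" unfolding Ps_def using F(1) by simp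
  have "\<forall>x\<in>#Ps. param_poly (fst x) (snd x)" using P(1) by (auto simp: Ps)
  from sign_matched_determined[OF this] obtain G where
    G: "finite G" "G \<subseteq> polyfun" "\<And>e e'. same_signs e e' G \<Longrightarrow> sign_matched e e' (set_mset Ps)" by blast
  have *: "\<exists>t. \<phi> (e'(i := t))" if s: "same_signs e e' G" and t: "\<phi> (e(i := t))" for e e' t
  proof -
    obtain h where h: "\<And>f t. f \<in> F \<Longrightarrow> sgn (poly (P f e) t) = sgn (poly (P f e') (h t))"
      using G(3)[OF s] unfolding sign_matched_def Ps by auto
    then have "same_signs (e(i := t)) (e'(i := h t)) F"
      unfolding same_signs_def using P(2) by auto
    then show ?thesis using F(3) t by blast
  qed
  have "(\<exists>t. \<phi> (e(i := t))) = (\<exists>t. \<phi> (e'(i := t)))" if "same_signs e e' G" for e e'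
    using *[OF that] *[of e' e] that by (auto simp: same_signs_def)
  then show ?thesis using G(1,2) unfolding sign_determined_def by blast
qed

section \<open>Definable relations between vectors and matrices\<close>

lemma sign_determined_rel:
  assumes "f \<in> polyfun" "g \<in> polyfun"
  shows sign_determined_less: "sign_determined (\<lambda>e. f e < g e)"
    and sign_determined_eq: "sign_determined (\<lambda>e. f e = g e)"
proof -
  have p: "(\<lambda>e. g e - f e) \<in> polyfun" using assms by (intro polyfun_diff)
  have "same_signs e e' {\<lambda>e. g e - f e} \<Longrightarrow> (f e < g e) = (f e' < g e') \<and> (f e = g e) = (f e' = g e')" for e e'
    by (auto simp: same_signs_def sgn_real_def split: if_splits)
  then show "sign_determined (\<lambda>e. f e < g e)" "sign_determined (\<lambda>e. f e = g e)"
    unfolding sign_determined_def using p by (intro exI[of _ "{\<lambda>e. g e - f e}"]; simp)+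
qed

lemma sign_determined_const: "sign_determined (\<lambda>_. b)"
  unfolding sign_determined_def by (intro exI[of _ "{}"]) auto

lemma sign_determined_not: "sign_determined \<phi> \<Longrightarrow> sign_determined (\<lambda>e. \<not> \<phi> e)"
  unfolding sign_determined_def by meson

lemma sign_determined_conj:
  assumes "sign_determined \<phi>" "sign_determined \<psi>"
  shows "sign_determined (\<lambda>e. \<phi> e \<and> \<psi> e)"
proof -
  obtain F G where FG: "finite F" "F \<subseteq> polyfun" "\<And>e e'. same_signs e e' F \<Longrightarrow> \<phi> e = \<phi> e'"
    "finite G" "G \<subseteq> polyfun" "\<And>e e'. same_signs e e' G \<Longrightarrow> \<psi> e = \<psi> e'"
    using assms unfolding sign_determined_def by meson
  have "(\<phi> e \<and> \<psi> e) = (\<phi> e' \<and> \<psi> e')" if "same_signs e e' (F \<union> G)" for e e'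
  proof -
    have "same_signs e e' F" "same_signs e e' G" using that by (auto simp: same_signs_def)
    from FG(3)[OF this(1)] FG(6)[OF this(2)] show ?thesis by simp
  qed
  then show ?thesis unfolding sign_determined_def using FG(1,2,4,5)
    by (intro exI[of _ "F \<union> G"]) auto
qed

lemma sign_determined_disj:
  "sign_determined \<phi> \<Longrightarrow> sign_determined \<psi> \<Longrightarrow> sign_determined (\<lambda>e. \<phi> e \<or> \<psi> e)"
  using sign_determined_not[OF sign_determined_conj[OF sign_determined_not sign_determined_not], of \<phi> \<psi>] by simp

lemma sign_determined_imp:
  "sign_determined \<phi> \<Longrightarrow> sign_determined \<psi> \<Longrightarrow> sign_determined (\<lambda>e. \<phi> e \<longrightarrow> \<psi> e)"
  unfolding imp_conv_disj by (intro sign_determined_disj sign_determined_not)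

lemma sign_determined_le:
  "f \<in> polyfun \<Longrightarrow> g \<in> polyfun \<Longrightarrow> sign_determined (\<lambda>e. f e \<le> g e)"
  unfolding not_less[symmetric] by (intro sign_determined_not sign_determined_less)

lemma sign_determined_ball:
  "finite I \<Longrightarrow> (\<And>i. i \<in> I \<Longrightarrow> sign_determined (\<phi> i)) \<Longrightarrow> sign_determined (\<lambda>e. \<forall>i\<in>I. \<phi> i e)"
  by (induction I rule: finite_induct) (auto intro: sign_determined_const sign_determined_conj)

text \<open>Vectors and matrices are quantified through their finitely many entries;
  \<open>g\<close> supplies all new entries at once.\<close>

lemma sign_determined_ex_override:
  "finite V \<Longrightarrow> sign_determined \<phi> \<Longrightarrow> sign_determined (\<lambda>e. \<exists>g. \<phi> (override_on e g V))"
proof (induction V rule: finite_induct)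
  case (insert v V)
  have o: "override_on (e(v := t)) g V = override_on e (g(v := t)) (insert v V)" for e g t
    using insert(2) by (auto simp: override_on_def)
  have "(\<exists>t g. \<phi> (override_on (e(v := t)) g V)) \<longleftrightarrow> (\<exists>g. \<phi> (override_on e g (insert v V)))" for e
    unfolding o by (metis fun_upd_triv)
  then show ?case using sign_determined_ex[OF insert.IH[OF insert.prems], of v] by (simp only:)
qed simp

lemma polyfun_rename: "f \<in> polyfun \<Longrightarrow> (\<lambda>e. f (e \<circ> \<rho>)) \<in> polyfun"
  by (induction rule: polyfun.induct) (auto intro: polyfun_intros)

lemma sign_determined_rename:
  assumes "sign_determined \<phi>"
  shows "sign_determined (\<lambda>e. \<phi> (e \<circ> \<rho>))"
proof -
  obtain F where F: "finite F" "F \<subseteq> polyfun" "\<And>e e'. same_signs e e' F \<Longrightarrow> \<phi> e = \<phi> e'"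
    using assms unfolding sign_determined_def by meson
  have "\<phi> (e \<circ> \<rho>) = \<phi> (e' \<circ> \<rho>)" if "same_signs e e' ((\<lambda>f e. f (e \<circ> \<rho>)) ` F)" for e e'
    by (rule F(3)) (use that in \<open>auto simp: same_signs_def\<close>)
  moreover have "(\<lambda>f e. f (e \<circ> \<rho>)) ` F \<subseteq> polyfun"
    using F(2) by (intro image_subsetI polyfun_rename) auto
  ultimately show ?thesis unfolding sign_determined_def using F(1)
    by (intro exI[of _ "(\<lambda>f e. f (e \<circ> \<rho>)) ` F"]) auto
qed

text \<open>The filters along which one-variable polynomials have eventually constant sign.\<close>
definition tame_filter :: "real filter \<Rightarrow> bool" where
  "tame_filter F \<longleftrightarrow> (\<forall>Z. finite Z \<longrightarrow> (\<exists>C. is_interval C \<and> C \<inter> Z = {} \<and> (\<forall>\<^sub>F t in F. t \<in> C)))"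

lemma tame_at_top: "tame_filter at_top"
  unfolding tame_filter_def
proof (intro allI impI)
  fix Z :: "real set" assume Z: "finite Z"
  have "z < Max (insert 0 Z) + 1" if "z \<in> Z" for z
  proof -
    have "z \<le> Max (insert 0 Z)" using Z that by (intro Max_ge) auto
    then show ?thesis by linarith
  qed
  then show "\<exists>C. is_interval C \<and> C \<inter> Z = {} \<and> (\<forall>\<^sub>F t in at_top. t \<in> C)"
    by (intro exI[of _ "{Max (insert 0 Z) + 1..}"]) (force simp: is_interval_ci eventually_ge_at_top simp del: Max_insert)
qed

lemma tame_at_right: "tame_filter (at_right s)"
  unfolding tame_filter_def
proof (intro allI impI)
  fix Z :: "real set" assume Z: "finite Z"
  define b where "b = Min (insert (s + 1) {z\<in>Z. s < z})"
  have "s < b" unfolding b_def using Z by (subst Min_gr_iff) auto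
  moreover have "b \<le> z" if "z \<in> Z" "s < z" for z unfolding b_def using Z that by (intro Min_le) auto
  then have "{s<..<b} \<inter> Z = {}" by fastforce
  ultimately show "\<exists>C. is_interval C \<and> C \<inter> Z = {} \<and> (\<forall>\<^sub>F t in at_right s. t \<in> C)"
    using eventually_at_right_real is_interval_oo by blast
qed

lemma tame_at_left: "tame_filter (at_left s)"
  unfolding tame_filter_def
proof (intro allI impI)
  fix Z :: "real set" assume Z: "finite Z"
  define b where "b = Max (insert (s - 1) {z\<in>Z. z < s})"
  have "b < s" unfolding b_def using Z by (subst Max_less_iff) auto
  moreover have "z \<le> b" if "z \<in> Z" "z < s" for z unfolding b_def using Z that by (intro Max_ge) auto
  then have "{b<..<s} \<inter> Z = {}" by fastforce
  ultimately show "\<exists>C. is_interval C \<and> C \<inter> Z = {} \<and> (\<forall>\<^sub>F t in at_left s. t \<in> C)"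
    using eventually_at_left_real is_interval_oo by blast
qed

lemma poly_sgn_const:
  fixes p :: "real poly"
  assumes C: "is_interval C" "\<And>t. t \<in> C \<Longrightarrow> poly p t \<noteq> 0" and xy: "x \<in> C" "y \<in> C"
  shows "sgn (poly p x) = sgn (poly p y)"
proof -
  have le: "sgn (poly p x) = sgn (poly p y)" if "x < y" "x \<in> C" "y \<in> C" for x y
  proof (rule ccontr)
    assume "sgn (poly p x) \<noteq> sgn (poly p y)"
    then have "poly p x * poly p y < 0"
      using C(2)[OF \<open>x \<in> C\<close>] C(2)[OF \<open>y \<in> C\<close>] by (auto simp: mult_less_0_iff sgn_real_def split: if_splits)
    then obtain z where z: "x < z" "z < y" "poly p z = 0" using poly_IVT[OF \<open>x < y\<close>] by blast
    have "z \<in> C" using C(1) \<open>x \<in> C\<close> \<open>y \<in> C\<close> z unfolding is_interval_1 by (meson less_imp_le)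
    then show False using C(2) z(3) by blast
  qed
  consider "x < y" | "x = y" | "y < x" by linarith
  then show ?thesis
  proof cases
    case 1 then show ?thesis using le xy by blast
  next
    case 2 then show ?thesis by simp
  next
    case 3 then show ?thesis using le[OF _ xy(2,1)] by simp
  qed
qed

text \<open>In variable \<open>i\<close> each deciding polynomial is zero or has finitely many
  roots. On an interval avoiding these roots all signs, and with them \<phi>, are constant, and a
  tame filter eventually lies in such an interval.\<close>

lemma sign_determined_germ:
  assumes \<phi>: "sign_determined \<phi>" and F: "tame_filter F"
  shows "(\<forall>\<^sub>F t in F. \<phi> (e(i := t))) \<or> (\<forall>\<^sub>F t in F. \<not> \<phi> (e(i := t)))"
proof -
  obtain G where G: "finite G" "G \<subseteq> polyfun" "\<And>e e'. same_signs e e' G \<Longrightarrow> \<phi> e = \<phi> e'"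
    using \<phi> unfolding sign_determined_def by blast
  have "\<exists>P. \<forall>t. f (e(i := t)) = poly P t" if "f \<in> G" for f
    using polyfun_as_param_poly[of f i] G(2) that by blast
  then obtain P where P: "\<And>f t. f \<in> G \<Longrightarrow> f (e(i := t)) = poly (P f) t" by metis
  define Z where "Z = (\<Union>f\<in>{f\<in>G. P f \<noteq> 0}. {t. poly (P f) t = 0})"
  have "finite Z" unfolding Z_def using G(1) by (auto intro: poly_roots_finite)
  then obtain C where C: "is_interval C" "C \<inter> Z = {}" "\<forall>\<^sub>F t in F. t \<in> C"
    using F unfolding tame_filter_def by blast
  have same: "\<phi> (e(i := x)) = \<phi> (e(i := y))" if xy: "x \<in> C" "y \<in> C" for x y
  proof (rule G(3))
    show "same_signs (e(i := x)) (e(i := y)) G"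
      unfolding same_signs_def
    proof
      fix f assume f: "f \<in> G"
      show "sgn (f (e(i := x))) = sgn (f (e(i := y)))"
      proof (cases "P f = 0")
        case True then show ?thesis unfolding P[OF f] by simp
      next
        case False
        then have "poly (P f) t \<noteq> 0" if "t \<in> C" for t using C(2) f that unfolding Z_def by auto
        then show ?thesis unfolding P[OF f] by (rule poly_sgn_const[OF C(1) _ xy])
      qed
    qed
  qed
  show ?thesis
  proof (cases "\<exists>x\<in>C. \<phi> (e(i := x))")
    case True
    then have "\<phi> (e(i := y))" if "y \<in> C" for y using same that by blast
    then show ?thesis using C(3) by (intro disjI1) (auto elim: eventually_mono)
  next
    case False
    then show ?thesis using C(3) by (intro disjI2) (auto elim: eventually_mono)
  qed
qed

section \<open>Environments holding scalars, vectors and matrices\<close>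

datatype 'n var = Sc nat | Vc nat 'n | Mt nat 'n 'n

type_synonym 'n env = "'n var \<Rightarrow> real"

definition sc :: "'n env \<Rightarrow> nat \<Rightarrow> real" where "sc e k = e (Sc k)"
definition vc :: "'n::finite env \<Rightarrow> nat \<Rightarrow> real^'n" where "vc e k = (\<chi> i. e (Vc k i))"
definition mt :: "'n::finite env \<Rightarrow> nat \<Rightarrow> real^'n^'n" where "mt e k = (\<chi> i j. e (Mt k i j))"

definition put_sc :: "'n env \<Rightarrow> nat \<Rightarrow> real \<Rightarrow> 'n env" where "put_sc e k x = e(Sc k := x)"
definition put_vc :: "'n::finite env \<Rightarrow> nat \<Rightarrow> real^'n \<Rightarrow> 'n env" where
  "put_vc e k x = (\<lambda>v. case v of Vc l i \<Rightarrow> if l = k then x $ i else e v | _ \<Rightarrow> e v)"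
definition put_mt :: "'n::finite env \<Rightarrow> nat \<Rightarrow> real^'n^'n \<Rightarrow> 'n env" where
  "put_mt e k x = (\<lambda>v. case v of Mt l i j \<Rightarrow> if l = k then x $ i $ j else e v | _ \<Rightarrow> e v)"

lemma put_simps [simp]:
  "sc (put_sc e k x) l = (if l = k then x else sc e l)" "vc (put_sc e k x) l = vc e l" "mt (put_sc e k x) l = mt e l"
  "sc (put_vc e k v) l = sc e l" "vc (put_vc e k v) l = (if l = k then v else vc e l)" "mt (put_vc e k v) l = mt e l"
  "sc (put_mt e k m) l = sc e l" "vc (put_mt e k m) l = vc e l" "mt (put_mt e k m) l = (if l = k then m else mt e l)"
  by (simp_all add: sc_def vc_def mt_def put_sc_def put_vc_def put_mt_def vec_eq_iff)

text \<open>In the quantifier rules the index \<open>k\<close> names a variable that does not occur in \<open>\<psi>\<close>.\<close>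
lemma sign_determined_ex_sc:
  assumes "sign_determined (\<lambda>e. \<psi> e (sc e k))" "\<And>e x y. \<psi> (put_sc e k y) x = \<psi> e x"
  shows "sign_determined (\<lambda>e. \<exists>x. \<psi> e x)"
proof -
  have "\<psi> (e(Sc k := t)) (sc (e(Sc k := t)) k) = \<psi> e t" for e t
    using assms(2)[of e t t] by (simp add: put_sc_def sc_def)
  then show ?thesis using sign_determined_ex[OF assms(1), of "Sc k"] by (simp only:)
qed

lemma sign_determined_ex_vc:
  fixes \<psi> :: "'n::finite env \<Rightarrow> real^'n \<Rightarrow> bool"
  assumes "sign_determined (\<lambda>e. \<psi> e (vc e k))" "\<And>e x y. \<psi> (put_vc e k y) x = \<psi> e x"
  shows "sign_determined (\<lambda>e. \<exists>x. \<psi> e x)"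
proof -
  have "finite (range (Vc k :: 'n \<Rightarrow> 'n var))" by simp
  from sign_determined_ex_override[OF this assms(1)]
  have s: "sign_determined (\<lambda>e. \<exists>g. \<psi> (override_on e g (range (Vc k))) (vc (override_on e g (range (Vc k))) k))" .
  have "override_on e g (range (Vc k)) = put_vc e k (\<chi> i. g (Vc k i))" for e :: "'n env" and g
    by (rule ext) (auto simp: override_on_def put_vc_def split: var.split)
  then have "(\<exists>g. \<psi> (override_on e g (range (Vc k))) (vc (override_on e g (range (Vc k))) k)) \<longleftrightarrow>
      (\<exists>g. \<psi> e (\<chi> i. g (Vc k i)))" for e by (simp add: assms(2))
  moreover have "(\<exists>g. \<psi> e (\<chi> i. g (Vc k i))) \<longleftrightarrow> (\<exists>x. \<psi> e x)" for e
  proof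
    assume "\<exists>x. \<psi> e x"
    then obtain x where x: "\<psi> e x" by blast
    show "\<exists>g. \<psi> e (\<chi> i. g (Vc k i))"
      by (rule exI[where x = "\<lambda>v. case v of Vc l i \<Rightarrow> x $ i | _ \<Rightarrow> 0"]) (simp add: x vec_lambda_eta)
  qed blast
  ultimately show ?thesis using s by simp
qed

lemma sign_determined_ex_mt:
  fixes \<psi> :: "'n::finite env \<Rightarrow> real^'n^'n \<Rightarrow> bool"
  assumes "sign_determined (\<lambda>e. \<psi> e (mt e k))" "\<And>e x y. \<psi> (put_mt e k y) x = \<psi> e x"
  shows "sign_determined (\<lambda>e. \<exists>x. \<psi> e x)"
proof -
  let ?V = "range (\<lambda>(i, j). Mt k i j) :: 'n var set"
  have "finite ?V" by simp
  from sign_determined_ex_override[OF this assms(1)]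
  have s: "sign_determined (\<lambda>e. \<exists>g. \<psi> (override_on e g ?V) (mt (override_on e g ?V) k))" .
  have "override_on e g ?V = put_mt e k (\<chi> i j. g (Mt k i j))" for e :: "'n env" and g
    by (rule ext) (auto simp: override_on_def put_mt_def image_iff split: var.split)
  then have "(\<exists>g. \<psi> (override_on e g ?V) (mt (override_on e g ?V) k)) \<longleftrightarrow> (\<exists>g. \<psi> e (\<chi> i j. g (Mt k i j)))" for e
    by (simp add: assms(2))
  moreover have "(\<exists>g. \<psi> e (\<chi> i j. g (Mt k i j))) \<longleftrightarrow> (\<exists>x. \<psi> e x)" for e
  proof
    assume "\<exists>x. \<psi> e x"
    then obtain x where x: "\<psi> e x" by blast
    show "\<exists>g. \<psi> e (\<chi> i j. g (Mt k i j))"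
      by (rule exI[where x = "\<lambda>v. case v of Mt l i j \<Rightarrow> x $ i $ j | _ \<Rightarrow> 0"]) (simp add: x vec_lambda_eta)
  qed blast
  ultimately show ?thesis using s by simp
qed

lemma sign_determined_all_sc:
  assumes "sign_determined (\<lambda>e. \<psi> e (sc e k))" "\<And>e x y. \<psi> (put_sc e k y) x = \<psi> e x"
  shows "sign_determined (\<lambda>e. \<forall>x. \<psi> e x)"
proof -
  have "sign_determined (\<lambda>e. \<exists>x. \<not> \<psi> e x)"
    by (rule sign_determined_ex_sc[where \<psi> = "\<lambda>e x. \<not> \<psi> e x" and k = k])
      (simp_all only: assms(2) sign_determined_not[OF assms(1)])
  from sign_determined_not[OF this] show ?thesis by simp
qed

lemma sign_determined_all_vc:
  fixes \<psi> :: "'n::finite env \<Rightarrow> real^'n \<Rightarrow> bool"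
  assumes "sign_determined (\<lambda>e. \<psi> e (vc e k))" "\<And>e x y. \<psi> (put_vc e k y) x = \<psi> e x"
  shows "sign_determined (\<lambda>e. \<forall>x. \<psi> e x)"
proof -
  have "sign_determined (\<lambda>e. \<exists>x. \<not> \<psi> e x)"
    by (rule sign_determined_ex_vc[where \<psi> = "\<lambda>e x. \<not> \<psi> e x" and k = k])
      (simp_all only: assms(2) sign_determined_not[OF assms(1)])
  from sign_determined_not[OF this] show ?thesis by simp
qed

lemma sign_determined_all_mt:
  fixes \<psi> :: "'n::finite env \<Rightarrow> real^'n^'n \<Rightarrow> bool"
  assumes "sign_determined (\<lambda>e. \<psi> e (mt e k))" "\<And>e x y. \<psi> (put_mt e k y) x = \<psi> e x"
  shows "sign_determined (\<lambda>e. \<forall>x. \<psi> e x)"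
proof -
  have "sign_determined (\<lambda>e. \<exists>x. \<not> \<psi> e x)"
    by (rule sign_determined_ex_mt[where \<psi> = "\<lambda>e x. \<not> \<psi> e x" and k = k])
      (simp_all only: assms(2) sign_determined_not[OF assms(1)])
  from sign_determined_not[OF this] show ?thesis by simp
qed

definition polyvec :: "('n::finite env \<Rightarrow> real^'m) \<Rightarrow> bool" where
  "polyvec f \<longleftrightarrow> (\<forall>i. (\<lambda>e. f e $ i) \<in> polyfun)"

definition polymat :: "('n::finite env \<Rightarrow> real^'m^'k) \<Rightarrow> bool" where
  "polymat f \<longleftrightarrow> (\<forall>i j. (\<lambda>e. f e $ i $ j) \<in> polyfun)"

lemma polyfun_sc: "(\<lambda>e. sc e k) \<in> polyfun"
  unfolding sc_def by (rule polyfun_var)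

lemma polyfun_inner_mat: "polymat f \<Longrightarrow> polymat g \<Longrightarrow> (\<lambda>e. f e \<bullet> g e) \<in> polyfun"
  unfolding inner_vec_def polymat_def by (auto intro!: polyfun_sum polyfun_mult)

lemma polyvec_intros:
  "polyvec (\<lambda>e. vc e k)" "polyvec (\<lambda>_. c)"
  "polyvec f \<Longrightarrow> polyvec g \<Longrightarrow> polyvec (\<lambda>e. f e + g e)"
  "polyvec f \<Longrightarrow> polyvec g \<Longrightarrow> polyvec (\<lambda>e. f e - g e)"
  "r \<in> polyfun \<Longrightarrow> polyvec f \<Longrightarrow> polyvec (\<lambda>e. r e *\<^sub>R f e)"
  "polymat m \<Longrightarrow> polyvec f \<Longrightarrow> polyvec (\<lambda>e. m e *v f e)"
  by (auto simp: polyvec_def polymat_def vc_def matrix_vector_mult_def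
    intro!: polyfun_intros polyfun_diff polyfun_sum)

lemma polymat_intros:
  "polymat (\<lambda>e. mt e k)" "polymat (\<lambda>_. C)"
  "polymat m \<Longrightarrow> polymat m' \<Longrightarrow> polymat (\<lambda>e. m e + m' e)"
  "polymat m \<Longrightarrow> polymat m' \<Longrightarrow> polymat (\<lambda>e. m e - m' e)"
  "r \<in> polyfun \<Longrightarrow> polymat m \<Longrightarrow> polymat (\<lambda>e. r e *\<^sub>R m e)"
  "polymat m \<Longrightarrow> polymat m'' \<Longrightarrow> polymat (\<lambda>e. m e ** m'' e)"
  "polymat m \<Longrightarrow> polymat (\<lambda>e. transpose (m e))"
  by (auto simp: polymat_def mt_def matrix_matrix_mult_def transpose_def
    intro!: polyfun_intros polyfun_diff polyfun_sum)

lemma sign_determined_vec_eq: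
  assumes "polyvec f" "polyvec g"
  shows "sign_determined (\<lambda>e. f e = g e)"
proof -
  have "sign_determined (\<lambda>e. \<forall>i\<in>UNIV. f e $ i = g e $ i)"
    using assms by (intro sign_determined_ball sign_determined_eq) (auto simp: polyvec_def)
  then show ?thesis by (simp add: vec_eq_iff)
qed

lemma sign_determined_mat_eq:
  assumes "polymat f" "polymat g"
  shows "sign_determined (\<lambda>e. f e = g e)"
proof -
  have "sign_determined (\<lambda>e. \<forall>i\<in>UNIV. \<forall>j\<in>UNIV. f e $ i $ j = g e $ i $ j)"
    using assms by (intro sign_determined_ball sign_determined_eq) (auto simp: polymat_def)
  then show ?thesis by (simp add: vec_eq_iff)
qed

text \<open>Definability is proved once with the free variables in fixed slots, so that the
  remaining slots are free for bound variables; renaming then moves it to arbitrary slots.\<close>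

lemma sign_determined_rename_vars:
  fixes \<Psi> :: "real^'n::finite^'n \<Rightarrow> real \<Rightarrow> real \<Rightarrow> bool"
  assumes "sign_determined (\<lambda>e. \<Psi> (mt e 0) (sc e 0) (sc e 1))"
  shows "sign_determined (\<lambda>e. \<Psi> (mt e k) (sc e i) (sc e j))"
proof -
  define \<rho> :: "'n var \<Rightarrow> 'n var" where
    "\<rho> v = (case v of Sc l \<Rightarrow> if l = 0 then Sc i else Sc j | Mt l a b \<Rightarrow> Mt k a b | _ \<Rightarrow> v)" for v
  have "mt (e \<circ> \<rho>) 0 = mt e k" "sc (e \<circ> \<rho>) 0 = sc e i" "sc (e \<circ> \<rho>) 1 = sc e j" for e
    by (simp_all add: mt_def sc_def \<rho>_def)
  then show ?thesis using sign_determined_rename[OF assms, of \<rho>] by simp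
qed

lemma sign_determined_germ_sc:
  fixes \<Psi> :: "real \<Rightarrow> real \<Rightarrow> bool"
  assumes "sign_determined (\<lambda>e :: 'n env. \<Psi> (sc e 0) (sc e 1))" "tame_filter F"
  shows "(\<forall>\<^sub>F t in F. \<Psi> a t) \<or> (\<forall>\<^sub>F t in F. \<not> \<Psi> a t)"
  using sign_determined_germ[OF assms, of "(\<lambda>_. 0)(Sc 0 := a)" "Sc 1"] by (simp add: sc_def)

section \<open>Local minimum values along a parameter\<close>

text \<open>To \<open>x\<close> assign a precision 1/(n+1) below \<open>\<delta> x\<close> and a
  point \<open>d\<close> of a countable dense set within half that precision of \<open>z x\<close>.
  There are only countably many such pairs, so two members of \<open>X\<close> share one.\<close>

lemma uncountable_close_pair:
  fixes z :: "'i \<Rightarrow> 'b::{metric_space,second_countable_topology}"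
  assumes X: "uncountable X" and \<delta>: "\<And>x. x \<in> X \<Longrightarrow> 0 < \<delta> x"
  obtains x y where "x \<in> X" "y \<in> X" "x \<noteq> y" "dist (z x) (z y) < \<delta> x" "dist (z x) (z y) < \<delta> y"
proof -
  obtain D :: "'b set" where D: "countable D" "\<And>U. open U \<Longrightarrow> U \<noteq> {} \<Longrightarrow> \<exists>d\<in>D. d \<in> U"
    using countable_dense_setE by metis
  have "\<exists>n d. inverse (real (Suc n)) < \<delta> x \<and> d \<in> D \<and> dist (z x) d < inverse (real (Suc n)) / 2" if x: "x \<in> X" for x
  proof -
    obtain n where n: "inverse (real (Suc n)) < \<delta> x" using reals_Archimedean[OF \<delta>[OF x]] by blast
    obtain d where "d \<in> D" "d \<in> ball (z x) (inverse (real (Suc n)) / 2)"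
      using D(2)[of "ball (z x) (inverse (real (Suc n)) / 2)"] by auto
    with n show ?thesis by auto
  qed
  then obtain n d where nd: "\<And>x. x \<in> X \<Longrightarrow> inverse (real (Suc (n x))) < \<delta> x"
    "\<And>x. x \<in> X \<Longrightarrow> d x \<in> D" "\<And>x. x \<in> X \<Longrightarrow> dist (z x) (d x) < inverse (real (Suc (n x))) / 2" by metis
  have "\<not> inj_on (\<lambda>x. (n x, d x)) X"
  proof
    assume "inj_on (\<lambda>x. (n x, d x)) X"
    moreover have "(\<lambda>x. (n x, d x)) ` X \<subseteq> UNIV \<times> D" using nd(2) by auto
    then have "countable ((\<lambda>x. (n x, d x)) ` X)" using D(1) by (meson countable_SIGMA countable_subset uncountable_def countableI_type)
    ultimately show False using X countable_image_inj_on by blast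
  qed
  then obtain x y where xy: "x \<in> X" "y \<in> X" "x \<noteq> y" "n x = n y" "d x = d y" by (auto simp: inj_on_def)
  have "dist (z x) (z y) < inverse (real (Suc (n x)))"
    using nd(3)[OF xy(1)] nd(3)[OF xy(2)] dist_triangle2[of "z x" "z y" "d x"] unfolding xy(4)[symmetric] xy(5)[symmetric] by linarith
  then show ?thesis using that[OF xy(1-3)] nd(1)[OF xy(1)] nd(1)[OF xy(2)] xy(4) by simp
qed

text \<open>If \<open>s < t\<close> are close enough and carry local minimizers that are close enough, then local minimality
  at \<open>t\<close> and monotonicity of \<open>J\<close> in the parameter give \<open>v t \<le> J (K s) t < J (K s) s = v s\<close>. An uncountable set of
  parameters always contains such a pair, so \<open>v\<close> can fail to decrease locally at countably many
  parameters only.\<close>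
theorem local_minimum_values_bounded:
  fixes J :: "'a::{metric_space,second_countable_topology} \<Rightarrow> real \<Rightarrow> real"
    and feas :: "real \<Rightarrow> 'a set"
  defines "bad \<equiv> \<lambda>\<alpha>. local_minimizers (\<lambda>K. J K \<alpha>) (feas \<alpha>) - global_minimizers (\<lambda>K. J K \<alpha>) (feas \<alpha>)"
  defines "T \<equiv> \<lambda>\<alpha> c. \<exists>K\<in>bad \<alpha>. J K \<alpha> = c"
  defines "G \<equiv> \<lambda>\<alpha> c. T \<alpha> c \<and> (\<forall>c'. T \<alpha> c' \<longrightarrow> c \<le> c')"
  assumes feas: "\<And>\<alpha> \<beta>. \<alpha> \<le> \<beta> \<Longrightarrow> feas \<alpha> \<subseteq> feas \<beta>"
    and nonneg: "\<And>K \<alpha>. K \<in> feas \<alpha> \<Longrightarrow> 0 \<le> J K \<alpha>"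
    and decr: "\<And>K \<alpha> \<beta>. K \<in> feas \<alpha> \<Longrightarrow> \<alpha> < \<beta> \<Longrightarrow> 0 < J K \<alpha> \<Longrightarrow> J K \<beta> < J K \<alpha>"
    and t1: "\<And>\<alpha> c. (\<forall>\<^sub>F x in at_right c. T \<alpha> x) \<or> (\<forall>\<^sub>F x in at_right c. \<not> T \<alpha> x)"
    and t2: "(\<forall>\<^sub>F \<alpha> in at_top. \<exists>c. T \<alpha> c) \<or> (\<forall>\<^sub>F \<alpha> in at_top. \<not> (\<exists>c. T \<alpha> c))"
    and t3: "\<And>s c. (\<forall>\<^sub>F t in at_left s. \<exists>x>c. G t x) \<or> (\<forall>\<^sub>F t in at_left s. \<not> (\<exists>x>c. G t x))"
      "\<And>s c. (\<forall>\<^sub>F t in at_right s. \<exists>x<c. G t x) \<or> (\<forall>\<^sub>F t in at_right s. \<not> (\<exists>x<c. G t x))"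
    and t4: "let P = (\<lambda>s. \<exists>\<epsilon>>0. \<forall>c. G s c \<longrightarrow>
        (\<forall>t x. G t x \<longrightarrow> (s < t \<and> t < s + \<epsilon> \<longrightarrow> x < c) \<and> (s - \<epsilon> < t \<and> t < s \<longrightarrow> c < x)))
      in (\<forall>\<^sub>F s in at_top. P s) \<or> (\<forall>\<^sub>F s in at_top. \<not> P s)"
  shows "(\<forall>\<^sub>F \<alpha> in at_top. bad \<alpha> = {}) \<or> (\<exists>C. \<forall>\<^sub>F \<alpha> in at_top. \<exists>K\<in>bad \<alpha>. J K \<alpha> \<le> C)"
proof -
  have badD: "K \<in> feas \<alpha>" "0 < J K \<alpha>" "\<exists>e>0. \<forall>y\<in>feas \<alpha>. dist K y < e \<longrightarrow> J K \<alpha> \<le> J y \<alpha>" if Kb: "K \<in> bad \<alpha>" for K \<alpha>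
  proof -
    show K: "K \<in> feas \<alpha>" using that by (auto simp: bad_def local_minimizers_def)
    \<comment> \<open>Not being global forces positive cost, as the better point has nonnegative
      cost; this makes the strict decrease in \<alpha> applicable.\<close>
    obtain y where "y \<in> feas \<alpha>" "J y \<alpha> < J K \<alpha>"
      using Kb K by (auto simp: bad_def global_minimizers_def not_le)
    then show "0 < J K \<alpha>" using nonneg by fastforce
    show "\<exists>e>0. \<forall>y\<in>feas \<alpha>. dist K y < e \<longrightarrow> J K \<alpha> \<le> J y \<alpha>"
      using that by (fastforce simp: bad_def local_minimizers_def)
  qed
  have witness: "\<exists>K e. K \<in> bad \<alpha> \<and> J K \<alpha> = c \<and> 0 < e \<and> (\<forall>y\<in>feas \<alpha>. dist K y < e \<longrightarrow> J K \<alpha> \<le> J y \<alpha>)"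
    if "T \<alpha> c" for \<alpha> c
    using that badD(3) unfolding T_def by blast
  have countable: "countable {c. T \<alpha> c}" for \<alpha>
  proof (rule ccontr)
    assume u: "uncountable {c. T \<alpha> c}"
    from witness obtain K e where K: "\<And>c. T \<alpha> c \<Longrightarrow> K c \<in> bad \<alpha>" "\<And>c. T \<alpha> c \<Longrightarrow> J (K c) \<alpha> = c" "\<And>c. T \<alpha> c \<Longrightarrow> 0 < e c"
      "\<And>c y. T \<alpha> c \<Longrightarrow> y \<in> feas \<alpha> \<Longrightarrow> dist (K c) y < e c \<Longrightarrow> J (K c) \<alpha> \<le> J y \<alpha>" by metis
    \<comment> \<open>Two local minimizers lying within each other's radius of minimality have equal
      values.\<close>
    obtain x y where xy: "T \<alpha> x" "T \<alpha> y" "x \<noteq> y" "dist (K x) (K y) < e x" "dist (K x) (K y) < e y"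
      using uncountable_close_pair[OF u, of e K] K(3) by auto
    then have "x \<le> y" "y \<le> x"
      using K(4)[OF xy(1) badD(1)[OF K(1)[OF xy(2)]]] K(4)[OF xy(2) badD(1)[OF K(1)[OF xy(1)]]] K(2)
      by (auto simp: dist_commute)
    with xy show False by auto
  qed
  have attained: "\<exists>c. G \<alpha> c" if "T \<alpha> c0" for \<alpha> c0
  proof -
    let ?X = "{c. T \<alpha> c}"
    have bdd: "bdd_below ?X" unfolding T_def using nonneg badD(1) by (intro bdd_belowI[of _ 0]) auto
    have ne: "?X \<noteq> {}" using that by auto
    \<comment> \<open>By tameness the values either fill an interval to the right of the infimum,
      which countability excludes, or avoid one, which is possible only if the infimum itself is a
      value.\<close>
    have "Inf ?X \<in> ?X"
    proof (rule ccontr)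
      assume n: "Inf ?X \<notin> ?X"
      consider (ev) "\<forall>\<^sub>F x in at_right (Inf ?X). T \<alpha> x" | (nev) "\<forall>\<^sub>F x in at_right (Inf ?X). \<not> T \<alpha> x"
        using t1 by blast
      then show False
      proof cases
        assume "\<forall>\<^sub>F x in at_right (Inf ?X). T \<alpha> x"
        then obtain b where b: "Inf ?X < b" "\<And>x. Inf ?X < x \<Longrightarrow> x < b \<Longrightarrow> T \<alpha> x"
          unfolding eventually_at_right_field by blast
        have "{Inf ?X<..<b} \<subseteq> ?X" using b by auto
        then have "countable {Inf ?X<..<b}" using countable countable_subset by blast
        then show False using b(1) uncountable_open_interval by blast
      next
        assume "\<forall>\<^sub>F x in at_right (Inf ?X). \<not> T \<alpha> x"
        then obtain b where b: "Inf ?X < b" "\<And>x. Inf ?X < x \<Longrightarrow> x < b \<Longrightarrow> \<not> T \<alpha> x"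
          unfolding eventually_at_right_field by blast
        obtain c where c: "c \<in> ?X" "c < b" using b(1) cInf_less_iff[OF ne bdd] by blast
        moreover have "Inf ?X \<le> c" using c bdd by (intro cInf_lower) auto
        ultimately show False using b(2)[of c] n by (cases "c = Inf ?X") auto
      qed
    qed
    then show ?thesis unfolding G_def using cInf_lower[OF _ bdd] by blast
  qed
  have uniq: "x = y" if "G \<alpha> x" "G \<alpha> y" for \<alpha> x y using that unfolding G_def by (meson order_antisym)
  from t2 show ?thesis
  proof
    assume "\<forall>\<^sub>F \<alpha> in at_top. \<not> (\<exists>c. T \<alpha> c)"
    then have "\<forall>\<^sub>F \<alpha> in at_top. bad \<alpha> = {}" by eventually_elim (auto simp: T_def)
    then show ?thesis ..
  next
    assume "\<forall>\<^sub>F \<alpha> in at_top. \<exists>c. T \<alpha> c"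
    then obtain a0 where a0: "\<And>\<alpha>. a0 \<le> \<alpha> \<Longrightarrow> \<exists>c. T \<alpha> c" by (auto simp: eventually_at_top_linorder)
    then have "\<exists>v. G \<alpha> v" if "a0 \<le> \<alpha>" for \<alpha> using attained that by blast
    then obtain v where v: "\<And>\<alpha>. a0 \<le> \<alpha> \<Longrightarrow> G \<alpha> (v \<alpha>)" by metis
    have "T \<alpha> (v \<alpha>)" if "a0 \<le> \<alpha>" for \<alpha> using v[OF that] unfolding G_def by blast
    from witness[OF this] obtain K e where K: "\<And>\<alpha>. a0 \<le> \<alpha> \<Longrightarrow> K \<alpha> \<in> bad \<alpha>" "\<And>\<alpha>. a0 \<le> \<alpha> \<Longrightarrow> J (K \<alpha>) \<alpha> = v \<alpha>"
      "\<And>\<alpha>. a0 \<le> \<alpha> \<Longrightarrow> 0 < e \<alpha>"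
      "\<And>\<alpha> y. a0 \<le> \<alpha> \<Longrightarrow> y \<in> feas \<alpha> \<Longrightarrow> dist (K \<alpha>) y < e \<alpha> \<Longrightarrow> J (K \<alpha>) \<alpha> \<le> J y \<alpha>" by metis
    have pair: "\<exists>s t. s \<in> X \<and> t \<in> X \<and> s < t \<and> t - s < \<delta> s \<and> t - s < \<delta> t \<and> v t < v s"
      if X: "uncountable X" "X \<subseteq> {a0..}" and \<delta>: "\<And>s. s \<in> X \<Longrightarrow> 0 < \<delta> s" for X \<delta>
    proof -
      have "0 < min (e s) (\<delta> s)" if "s \<in> X" for s using that X K(3) \<delta> by auto
      then obtain x y where xy: "x \<in> X" "y \<in> X" "x \<noteq> y"
        "dist (K x, x) (K y, y) < min (e x) (\<delta> x)" "dist (K x, x) (K y, y) < min (e y) (\<delta> y)"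
        \<comment> \<open>The pairs \<open>(K s, s)\<close> live in the product space, so minimizers
          and parameters are close simultaneously.\<close>
        using uncountable_close_pair[OF X(1), of "\<lambda>s. min (e s) (\<delta> s)" "\<lambda>s. (K s, s)"] by auto
      define s t where "s = min x y" and "t = max x y"
      have st: "s \<in> X" "t \<in> X" "s < t" "dist (K s, s) (K t, t) < min (e s) (\<delta> s)"
        "dist (K s, s) (K t, t) < min (e t) (\<delta> t)"
        using xy by (auto simp: s_def t_def min_def max_def dist_commute split: if_splits)
      have d: "dist (K s) (K t) \<le> dist (K s, s) (K t, t)" "t - s \<le> dist (K s, s) (K t, t)"
        using dist_fst_le[of "(K s, s)" "(K t, t)"] dist_snd_le[of "(K s, s)" "(K t, t)"] st(3)
        by (auto simp: dist_real_def)
      have a: "a0 \<le> s" "a0 \<le> t" using st X(2) by auto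
      have "K s \<in> feas t" using badD(1)[OF K(1)[OF a(1)]] feas[of s t] st(3) by auto
      then have "J (K t) t \<le> J (K s) t" using K(4)[OF a(2)] d(1) st(5) by (auto simp: dist_commute)
      also have "\<dots> < J (K s) s" using decr[OF badD(1)[OF K(1)[OF a(1)]] st(3) badD(2)[OF K(1)[OF a(1)]]] .
      finally have "v t < v s" using K(2) a by simp
      then show ?thesis using st d(2) by (intro exI[of _ s] exI[of _ t]) auto
    qed
    define P where "P s \<longleftrightarrow> (\<exists>\<epsilon>>0. \<forall>c. G s c \<longrightarrow>
        (\<forall>t x. G t x \<longrightarrow> (s < t \<and> t < s + \<epsilon> \<longrightarrow> x < c) \<and> (s - \<epsilon> < t \<and> t < s \<longrightarrow> c < x)))" for s
    have "\<not> (\<forall>\<^sub>F s in at_top. \<not> P s)"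
    proof
      assume "\<forall>\<^sub>F s in at_top. \<not> P s"
      then obtain a1 where a1: "\<And>s. a1 \<le> s \<Longrightarrow> \<not> P s" by (auto simp: eventually_at_top_linorder)
      define a where "a = max a0 a1"
      \<comment> \<open>By tameness, a parameter at which \<open>v\<close> fails to decrease locally
        fails on a whole one-sided neighbourhood: on the left (\<open>X1\<close>) no earlier value
        exceeds \<open>v s\<close>, on the right (\<open>X2\<close>) no later value is below it. A
        close pair \<open>s < t\<close> with \<open>v t < v s\<close> contradicts the former at
        \<open>t\<close> and the latter at \<open>s\<close>.\<close>
      define X1 where "X1 = {s\<in>{a<..<a+1}. \<forall>\<^sub>F t in at_left s. \<not> (\<exists>x>v s. G t x)}"
      define X2 where "X2 = {s\<in>{a<..<a+1}. \<forall>\<^sub>F t in at_right s. \<not> (\<exists>x<v s. G t x)}"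
      have "s \<in> X1 \<union> X2" if s: "s \<in> {a<..<a+1}" for s
      proof (rule ccontr)
        assume "s \<notin> X1 \<union> X2"
        then have l: "\<forall>\<^sub>F t in at_left s. \<exists>x>v s. G t x" and r: "\<forall>\<^sub>F t in at_right s. \<exists>x<v s. G t x"
          using t3 s unfolding X1_def X2_def by blast+
        obtain b1 where b1: "b1 < s" "\<And>t. b1 < t \<Longrightarrow> t < s \<Longrightarrow> \<exists>x>v s. G t x"
          using l unfolding eventually_at_left_field by blast
        obtain b2 where b2: "s < b2" "\<And>t. s < t \<Longrightarrow> t < b2 \<Longrightarrow> \<exists>x<v s. G t x"
          using r unfolding eventually_at_right_field by blast
        have Gs: "G s (v s)" using v s by (auto simp: a_def)
        have "P s"
          unfolding P_def
        proof (intro exI[of _ "min (s - b1) (b2 - s)"] conjI allI impI)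
          fix c t x assume c: "G s c" and x: "G t x" and t: "s < t \<and> t < s + min (s - b1) (b2 - s)"
          have "t < b2" using t by (auto simp: min_def split: if_splits)
          then obtain x' where "x' < v s" "G t x'" using b2(2)[of t] t by auto
          then show "x < c" using uniq[OF c Gs] uniq[OF x] by auto
        next
          fix c t x assume c: "G s c" and x: "G t x" and t: "s - min (s - b1) (b2 - s) < t \<and> t < s"
          have "b1 < t" using t by (auto simp: min_def split: if_splits)
          then obtain x' where "x' > v s" "G t x'" using b1(2)[of t] t by auto
          then show "c < x" using uniq[OF c Gs] uniq[OF x] by auto
        qed (use b1 b2 in auto)
        then show False using a1[of s] s by (auto simp: a_def)
      qed
      then have "{a<..<a+1} \<subseteq> X1 \<union> X2" by blast
      then have "uncountable X1 \<or> uncountable X2"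
        using uncountable_open_interval[of a "a + 1"] countable_subset countable_Un by (metis less_add_one)
      then show False
      proof
        assume u: "uncountable X1"
        have "\<exists>d>0. \<forall>t. s - d < t \<longrightarrow> t < s \<longrightarrow> \<not> (\<exists>x>v s. G t x)" if "s \<in> X1" for s
        proof -
          obtain b where "b < s" "\<And>t. b < t \<Longrightarrow> t < s \<Longrightarrow> \<not> (\<exists>x>v s. G t x)"
            using \<open>s \<in> X1\<close> unfolding X1_def eventually_at_left_field by blast
          then show ?thesis by (intro exI[of _ "s - b"]) auto
        qed
        then obtain d where d: "\<And>s. s \<in> X1 \<Longrightarrow> 0 < d s"
          "\<And>s t. s \<in> X1 \<Longrightarrow> s - d s < t \<Longrightarrow> t < s \<Longrightarrow> \<not> (\<exists>x>v s. G t x)" by metis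
        have "X1 \<subseteq> {a0..}" by (auto simp: X1_def a_def)
        have "\<exists>s t. s \<in> X1 \<and> t \<in> X1 \<and> s < t \<and> t - s < d s \<and> t - s < d t \<and> v t < v s"
          by (rule pair[OF u \<open>X1 \<subseteq> {a0..}\<close> d(1)])
        then obtain s t where st: "s \<in> X1" "t \<in> X1" "s < t" "t - s < d t" "v t < v s"
          by (elim exE conjE)
        have "a0 \<le> s" using st(1) by (auto simp: X1_def a_def)
        then have "G s (v s)" by (rule v)
        moreover have "t - d t < s" using st(4) by linarith
        ultimately show False using d(2)[OF st(2) _ st(3)] st(5) by blast
      next
        assume u: "uncountable X2"
        have "\<exists>d>0. \<forall>t. s < t \<longrightarrow> t < s + d \<longrightarrow> \<not> (\<exists>x<v s. G t x)" if "s \<in> X2" for s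
        proof -
          obtain b where "s < b" "\<And>t. s < t \<Longrightarrow> t < b \<Longrightarrow> \<not> (\<exists>x<v s. G t x)"
            using \<open>s \<in> X2\<close> unfolding X2_def eventually_at_right_field by blast
          then show ?thesis by (intro exI[of _ "b - s"]) auto
        qed
        then obtain d where d: "\<And>s. s \<in> X2 \<Longrightarrow> 0 < d s"
          "\<And>s t. s \<in> X2 \<Longrightarrow> s < t \<Longrightarrow> t < s + d s \<Longrightarrow> \<not> (\<exists>x<v s. G t x)" by metis
        have "X2 \<subseteq> {a0..}" by (auto simp: X2_def a_def)
        have "\<exists>s t. s \<in> X2 \<and> t \<in> X2 \<and> s < t \<and> t - s < d s \<and> t - s < d t \<and> v t < v s"
          by (rule pair[OF u \<open>X2 \<subseteq> {a0..}\<close> d(1)])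
        then obtain s t where st: "s \<in> X2" "t \<in> X2" "s < t" "t - s < d s" "v t < v s"
          by (elim exE conjE)
        have "a0 \<le> t" using st(2) by (auto simp: X2_def a_def)
        then have "G t (v t)" by (rule v)
        moreover have "t < s + d s" using st(4) by linarith
        ultimately show False using d(2)[OF st(1,3)] st(5) by blast
      qed
    qed
    then have "\<forall>\<^sub>F s in at_top. P s" using t4 unfolding P_def Let_def by blast
    then obtain a1 where a1: "\<And>s. a1 \<le> s \<Longrightarrow> P s" by (auto simp: eventually_at_top_linorder)
    define a where "a = max a0 a1"
    have "v t \<le> v a" if "a \<le> t" for t
    proof -
      \<comment> \<open>Bisection turns decrease near every point into decrease on the whole
        interval. The premise is the instance at \<open>a\<close> of the condition that keeps the
        small intervals to the right of \<open>a\<close>, where \<open>v\<close> is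
        controlled.\<close>
      have "a \<le> a \<longrightarrow> v t \<le> v a"
        using that
      proof (induction rule: Bolzano[where P = "\<lambda>x y. a \<le> x \<longrightarrow> v y \<le> v x"])
        case (trans x y z)
        then show ?case by force
      next
        case (local x)
        have "P x" using a1 local by (auto simp: a_def)
        moreover have "G x (v x)" using v local by (auto simp: a_def)
        ultimately obtain \<epsilon> where \<epsilon>: "0 < \<epsilon>"
          "\<And>t y. G t y \<Longrightarrow> x < t \<Longrightarrow> t < x + \<epsilon> \<Longrightarrow> y < v x"
          "\<And>t y. G t y \<Longrightarrow> x - \<epsilon> < t \<Longrightarrow> t < x \<Longrightarrow> v x < y" unfolding P_def by blast
        show ?case
        proof (intro exI[of _ \<epsilon>] conjI allI impI)
          fix p q assume pq: "p \<le> x \<and> x \<le> q \<and> q - p < \<epsilon>" "a \<le> p"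
          have G: "G p (v p)" "G q (v q)" using v pq by (auto simp: a_def)
          have "v x \<le> v p" using \<epsilon>(3)[OF G(1)] pq by (cases "p = x") auto
          moreover have "v q \<le> v x" using \<epsilon>(2)[OF G(2)] pq by (cases "q = x") auto
          ultimately show "v q \<le> v p" by linarith
        qed (rule \<epsilon>(1))
      qed
      then show ?thesis by simp
    qed
    then have "\<exists>K\<in>bad \<alpha>. J K \<alpha> \<le> v a" if "a \<le> \<alpha>" for \<alpha>
      using K(1,2)[of \<alpha>] that by (intro bexI[of _ "K \<alpha>"]) (auto simp: a_def)
    then show ?thesis by (auto simp: eventually_at_top_linorder)
  qed
qed

section \<open>Lyapunov equations\<close>

lemma matrix_mul_bilinear:
  fixes A A' :: "real^'n^'m" and B B' :: "real^'k^'n"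
  shows matrix_mul_add_left: "(A + A') ** B = A ** B + A' ** B"
    and matrix_mul_add_right: "A ** (B + B') = A ** B + A ** B'"
    and matrix_mul_diff_left: "(A - A') ** B = A ** B - A' ** B"
    and matrix_mul_diff_right: "A ** (B - B') = A ** B - A ** B'"
    and matrix_mul_scaleR_left: "(c *\<^sub>R A) ** B = c *\<^sub>R (A ** B)"
    and matrix_mul_scaleR_right: "A ** (c *\<^sub>R B) = c *\<^sub>R (A ** B)"
  by (simp_all add: matrix_matrix_mult_def vec_eq_iff algebra_simps sum.distrib sum_subtractf
    sum_distrib_left)

lemma transpose_linear:
  fixes A B :: "real^'n^'m"
  shows transpose_add: "transpose (A + B) = transpose A + transpose B"
    and transpose_diff: "transpose (A - B) = transpose A - transpose B"
    and transpose_minus: "transpose (- A) = - transpose A"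
    and transpose_scaleR: "transpose (c *\<^sub>R A) = c *\<^sub>R transpose A"
    and transpose_zero: "transpose (0 :: real^'n^'m) = 0"
  by (simp_all add: transpose_def vec_eq_iff)

lemma inner_transpose: "(transpose A *v x) \<bullet> y = x \<bullet> ((A::real^'n^'m) *v y)"
  by (simp add: transpose_matrix_vector dot_lmul_matrix)

lemma symmetric_inner: "symmetric_matrix P \<Longrightarrow> (P *v x) \<bullet> y = x \<bullet> (P *v y)"
  using inner_transpose[of P x y] unfolding symmetric_matrix_def by (simp only:)

text \<open>Evaluated at u - t Y u, the form has the first-order term -2 t times the squared length
  of Y u. For small t > 0 it outweighs the quadratic term, so a nonzero Y u would make the form
  negative.\<close>

lemma pos_semidef_kernel:
  fixes Y :: "real^'n^'n"
  assumes "pos_semidef Y" "u \<bullet> (Y *v u) = 0"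
  shows "Y *v u = 0"
proof (rule ccontr)
  assume ne: "Y *v u \<noteq> 0"
  define w where "w = Y *v u"
  define c where "c = w \<bullet> (Y *v w)"
  have sym: "symmetric_matrix Y" and psd: "\<And>x. 0 \<le> x \<bullet> (Y *v x)" using assms by (auto simp: pos_semidef_def)
  have c: "0 \<le> c" using psd by (simp add: c_def)
  define t where "t = (w \<bullet> w) / (c + 1)"
  have w: "0 < w \<bullet> w" using ne by (simp add: w_def)
  have t: "0 < t" using w c by (simp add: t_def)
  have "u \<bullet> (Y *v w) = w \<bullet> w" using symmetric_inner[OF sym, of u w] by (simp add: w_def inner_commute)
  then have "(u - t *\<^sub>R w) \<bullet> (Y *v (u - t *\<^sub>R w)) = t * (t * c - 2 * (w \<bullet> w))"
    using assms(2)
    by (simp add: matrix_vector_mult_diff_distrib matrix_vector_mult_scaleR inner_diff_left inner_diff_right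
      c_def flip: w_def) (simp add: algebra_simps)
  then have "0 \<le> t * c - 2 * (w \<bullet> w)" using psd[of "u - t *\<^sub>R w"] t by (simp add: zero_le_mult_iff)
  moreover have "t * c \<le> w \<bullet> w"
    using w c by (simp add: t_def field_simps)
  ultimately show False using w by linarith
qed

lemma unit_vector_scale:
  fixes x :: "'a::real_normed_vector"
  assumes "x \<noteq> 0"
  obtains u r where "norm u = 1" "0 < r" "x = r *\<^sub>R u"
  by (rule that[of "x /\<^sub>R norm x" "norm x"]) (use assms in auto)

text \<open>The expression (P x) . (F x) is half the derivative of x . P x along x' = F x, so
  \<open>P\<close> is a strict quadratic Lyapunov function. Comparison arguments use this form of
  stability instead of eigenvalues.\<close>

definition lyap_stable :: "real^'n^'n \<Rightarrow> bool" where
  "lyap_stable F \<longleftrightarrow> (\<exists>P. pos_def P \<and> (\<forall>x. x \<noteq> 0 \<longrightarrow> (P *v x) \<bullet> (F *v x) < 0))"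

lemma sphere_nonempty: "sphere (0::real^'n) 1 \<noteq> {}"
  using vector_choose_size[of 1] by auto

text \<open>A comparison principle. Let \<mu> be the least value of the quotient of the forms
  \<open>X\<close> and \<open>P\<close>, attained at \<open>u\<close>. Then X - \<mu> P is
  semidefinite and vanishes at \<open>u\<close>, so X u = \<mu> P u. If \<mu> were negative, (X u) .
  (F u) = \<mu> (P u) . (F u) would be positive.\<close>

lemma pos_semidef_lyap:
  fixes F :: "real^'n^'n"
  assumes F: "lyap_stable F" and X: "symmetric_matrix X" and neg: "\<And>x. (X *v x) \<bullet> (F *v x) \<le> 0"
  shows "pos_semidef X"
proof (rule ccontr)
  assume "\<not> pos_semidef X"
  then obtain y where y: "y \<bullet> (X *v y) < 0" using X by (auto simp: pos_semidef_def not_le)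
  obtain P where P: "pos_def P" "\<And>x. x \<noteq> 0 \<Longrightarrow> (P *v x) \<bullet> (F *v x) < 0"
    using F by (auto simp: lyap_stable_def)
  have Ppos: "0 < x \<bullet> (P *v x)" if "x \<noteq> 0" for x using P(1) that by (auto simp: pos_def_def)
  have Psym: "symmetric_matrix P" using P(1) by (auto simp: pos_def_def)
  let ?r = "\<lambda>x. (x \<bullet> (X *v x)) / (x \<bullet> (P *v x))"
  have nz: "x \<bullet> (P *v x) \<noteq> 0" if "x \<in> sphere 0 1" for x using Ppos[of x] that by force
  have "continuous_on (sphere 0 1) ?r"
    by (intro continuous_intros ballI nz)
  from continuous_attains_inf[OF compact_sphere sphere_nonempty this]
  obtain u where u: "u \<in> sphere 0 1" "\<forall>x\<in>sphere 0 1. ?r u \<le> ?r x" by blast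
  have "norm u = 1" using u(1) by simp
  then have u0: "u \<noteq> 0" by force
  define \<mu> where "\<mu> = ?r u"
  define Y where "Y = X - \<mu> *\<^sub>R P"
  have Yv: "Y *v x = X *v x - \<mu> *\<^sub>R (P *v x)" for x
    by (simp add: Y_def matrix_vector_mult_diff_rdistrib scaleR_matrix_vector_assoc)
  have Ysym: "symmetric_matrix Y" using X Psym
    by (simp add: Y_def symmetric_matrix_def transpose_def vec_eq_iff)
  have "0 \<le> x \<bullet> (Y *v x)" for x
  proof (cases "x = 0")
    case False
    then obtain w r where w: "norm w = 1" "0 < r" "x = r *\<^sub>R w" by (rule unit_vector_scale)
    have "w \<noteq> 0" using w(1) by auto
    have "\<mu> \<le> ?r w" using bspec[OF u(2), of w] w(1) by (simp add: \<mu>_def)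
    then have "\<mu> * (w \<bullet> (P *v w)) \<le> w \<bullet> (X *v w)" using Ppos[OF \<open>w \<noteq> 0\<close>] by (simp add: pos_le_divide_eq)
    then have "0 \<le> w \<bullet> (Y *v w)" by (simp add: Yv inner_diff_right)
    then show ?thesis using w(2) by (simp add: w(3) matrix_vector_mult_scaleR)
  qed simp
  then have "pos_semidef Y" using Ysym by (simp add: pos_semidef_def)
  moreover have "u \<bullet> (Y *v u) = 0" using Ppos[OF u0] by (simp add: Yv inner_diff_right \<mu>_def)
  ultimately have "Y *v u = 0" by (rule pos_semidef_kernel)
  then have Xu: "X *v u = \<mu> *\<^sub>R (P *v u)" by (simp add: Yv)
  have "y \<noteq> 0" using y by auto
  then obtain w r where w: "norm w = 1" "0 < r" "y = r *\<^sub>R w" by (rule unit_vector_scale)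
  have "w \<bullet> (X *v w) < 0" using y w(2) by (simp add: w(3) matrix_vector_mult_scaleR mult_less_0_iff zero_less_mult_iff)
  moreover have "w \<noteq> 0" using w(1) by auto
  ultimately have "?r w < 0" using Ppos by (simp add: divide_less_0_iff)
  then have "\<mu> < 0" using bspec[OF u(2), of w] w(1) by (simp add: \<mu>_def)
  then have "0 < (X *v u) \<bullet> (F *v u)" using P(2)[OF u0] by (simp add: Xu mult_neg_neg)
  then show False using neg[of u] by linarith
qed

definition lyap :: "real^'n^'n \<Rightarrow> real^'n^'n \<Rightarrow> real^'n^'n \<Rightarrow> bool" where
  "lyap F M P \<longleftrightarrow> symmetric_matrix P \<and> transpose F ** P + P ** F + M = 0"

lemma quad_lyap_op: "symmetric_matrix P \<Longrightarrow> x \<bullet> ((transpose F ** P + P ** F) *v x) = 2 * ((P *v x) \<bullet> (F *v x))"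
  using inner_transpose[of F "P *v x" x] symmetric_inner[of P x "F *v x"]
  by (simp add: matrix_vector_mult_add_rdistrib inner_add_right inner_commute flip: matrix_vector_mul_assoc)

lemma lyap_quad:
  assumes "lyap F M P"
  shows "2 * ((P *v x) \<bullet> (F *v x)) = - (x \<bullet> (M *v x))"
proof -
  have "x \<bullet> ((transpose F ** P + P ** F + M) *v x) = 0" using assms by (simp add: lyap_def)
  then show ?thesis using quad_lyap_op[of P x F] assms
    by (simp add: lyap_def matrix_vector_mult_add_rdistrib inner_add_right)
qed

lemma matrix_eq_0_quad:
  fixes M :: "real^'n^'n"
  assumes "symmetric_matrix M" "\<And>x. x \<bullet> (M *v x) = 0"
  shows "M = 0"
proof -
  have "M *v u = 0" for u by (rule pos_semidef_kernel) (use assms in \<open>auto simp: pos_semidef_def\<close>)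
  then show ?thesis by (simp add: matrix_eq)
qed

lemma symmetric_lyap_op: "symmetric_matrix P \<Longrightarrow> symmetric_matrix (transpose F ** P + P ** F)"
  by (simp add: symmetric_matrix_def matrix_transpose_mul transpose_add add.commute)

text \<open>The comparison principle applies to the difference of two solutions with either
  sign.\<close>

lemma lyap_unique:
  assumes F: "lyap_stable F" and "lyap F M P" "lyap F M P'"
  shows "P = P'"
proof -
  have *: "pos_semidef (P - P')" if "lyap F M P" "lyap F M P'" for P P'
  proof (rule pos_semidef_lyap[OF F])
    show "symmetric_matrix (P - P')" using that by (simp add: lyap_def symmetric_matrix_def transpose_diff)
    show "((P - P') *v x) \<bullet> (F *v x) \<le> 0" for x
      using lyap_quad[OF that(1), of x] lyap_quad[OF that(2), of x]
      by (simp add: matrix_vector_mult_diff_rdistrib inner_diff_left)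
  qed
  have "P - P' = 0"
  proof (rule matrix_eq_0_quad)
    show "symmetric_matrix (P - P')" using *[OF assms(2,3)] by (simp add: pos_semidef_def)
    fix x
    have "0 \<le> x \<bullet> ((P - P') *v x)" "0 \<le> x \<bullet> ((P' - P) *v x)"
      using *[OF assms(2,3)] *[OF assms(3,2)] by (auto simp: pos_semidef_def)
    then show "x \<bullet> ((P - P') *v x) = 0"
      by (simp add: matrix_vector_mult_diff_rdistrib inner_diff_right)
  qed
  then show ?thesis by simp
qed

lemma diff_eq_add_imp_zero:
  fixes a s :: "'a::real_vector"
  assumes "a - s = a + s"
  shows "s = 0"
proof -
  have "2 *\<^sub>R s = (a + s) - (a - s)" by (simp add: scaleR_2)
  then show ?thesis using assms by simp
qed

text \<open>The skew part \<open>X - transpose X\<close> makes the operator injective on all matrices, so that surjectivity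
  follows from a dimension count.\<close>
lemma lyap_exists:
  fixes F :: "real^'n^'n"
  assumes F: "lyap_stable F" and M: "symmetric_matrix M"
  shows "\<exists>P. lyap F M P"
proof -
  let ?Y = "\<lambda>X::real^'n^'n. X + transpose X"
  let ?\<Phi> = "\<lambda>X. (transpose F ** ?Y X + ?Y X ** F) + (X - transpose X)"
  have Ysym: "symmetric_matrix (?Y X)" for X by (simp add: symmetric_matrix_def transpose_add add.commute)
  \<comment> \<open>Transposition keeps the Lyapunov part and negates the skew part, so a symmetric
    right-hand side forces the skew part to vanish.\<close>
  have split: "transpose F ** ?Y X + ?Y X ** F = N \<and> X - transpose X = 0"
    if e: "?\<Phi> X = N" and N: "symmetric_matrix N" for X N
  proof -
    let ?U = "transpose F ** ?Y X + ?Y X ** F"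
    have U: "transpose ?U = ?U" using symmetric_lyap_op[OF Ysym] by (simp add: symmetric_matrix_def)
    have "transpose (?\<Phi> X) = ?U - (X - transpose X)" by (simp only: transpose_add[of ?U] U transpose_diff transpose_transpose) simp
    moreover have "transpose (?\<Phi> X) = ?U + (X - transpose X)" using e N by (simp only: symmetric_matrix_def)
    ultimately have "X - transpose X = 0" using diff_eq_add_imp_zero by metis
    then show ?thesis using e by simp
  qed
  have lin: "linear ?\<Phi>"
    by (rule linearI) (simp_all add: matrix_mul_bilinear transpose_linear algebra_simps)
  moreover have "inj ?\<Phi>"
    unfolding linear_injective_0[OF lin]
  proof (intro allI impI)
    fix X assume "?\<Phi> X = 0"
    then have s: "transpose F ** ?Y X + ?Y X ** F = 0" "X - transpose X = 0"
      using split[of X 0] by (auto simp: symmetric_matrix_def transpose_zero)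
    have "lyap F 0 (?Y X)" using s(1) Ysym[of X] unfolding lyap_def by simp
    moreover have "lyap F 0 0" by (simp add: lyap_def symmetric_matrix_def transpose_zero)
    ultimately have "?Y X = 0" by (rule lyap_unique[OF F])
    then have "X + X = 0" using s(2) by simp
    then show "X = 0" by (simp flip: scaleR_2)
  qed
  ultimately have "surj ?\<Phi>" by (rule linear_injective_imp_surjective) simp
  from surjD[OF this, of "- M"] obtain X where "- M = ?\<Phi> X" by blast
  from this[symmetric] have "transpose F ** ?Y X + ?Y X ** F = - M"
    using split[of X "- M"] M by (auto simp: symmetric_matrix_def transpose_minus)
  then have "lyap F M (?Y X)" using Ysym by (simp add: lyap_def)
  then show ?thesis ..
qed

lemma lyap_pos_semidef:
  assumes "lyap_stable F" "lyap F M P" "pos_semidef M"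
  shows "pos_semidef P"
proof (rule pos_semidef_lyap[OF assms(1)])
  show "symmetric_matrix P" using assms by (simp add: lyap_def)
  fix x
  have "0 \<le> x \<bullet> (M *v x)" using assms(3) by (simp add: pos_semidef_def)
  then show "(P *v x) \<bullet> (F *v x) \<le> 0" using lyap_quad[OF assms(2), of x] by linarith
qed

lemma pos_def_semidef: "pos_def M \<Longrightarrow> pos_semidef M"
  unfolding pos_def_def pos_semidef_def by (metis inner_zero_left less_eq_real_def)

text \<open>A vector on which the form \<open>P\<close> vanishes lies in the kernel of
  \<open>P\<close>, and there the Lyapunov equation makes the form \<open>M\<close> vanish
  too.\<close>

lemma lyap_pos_def_of_semidef:
  assumes "lyap F M P" "pos_semidef P" "pos_def M"
  shows "pos_def P"
proof -
  have "x \<bullet> (P *v x) \<noteq> 0" if "x \<noteq> 0" for x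
  proof
    assume "x \<bullet> (P *v x) = 0"
    then have "P *v x = 0" by (rule pos_semidef_kernel[OF assms(2)])
    then have "x \<bullet> (M *v x) = 0" using lyap_quad[OF assms(1), of x] by simp
    then show False using assms(3) that by (auto simp: pos_def_def)
  qed
  then show ?thesis using assms(2) unfolding pos_def_def pos_semidef_def by (metis less_eq_real_def)
qed

lemma lyap_stableI:
  assumes "lyap F M P" "pos_def P" "pos_def M"
  shows "lyap_stable F"
  unfolding lyap_stable_def
proof (intro exI[of _ P] conjI allI impI assms(2))
  fix x :: "real^'a" assume "x \<noteq> 0"
  then have "0 < x \<bullet> (M *v x)" using assms(3) by (simp add: pos_def_def)
  then show "(P *v x) \<bullet> (F *v x) < 0" using lyap_quad[OF assms(1), of x] by linarith
qed

lemma shift_mult: "(F - s *\<^sub>R mat 1) *v x = F *v x - s *\<^sub>R (x :: real^'n)"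
  by (simp add: matrix_vector_mult_diff_rdistrib flip: scaleR_matrix_vector_assoc)

lemma lyap_stable_shift_mono:
  assumes "lyap_stable (F - s *\<^sub>R mat 1)" "s \<le> s'"
  shows "lyap_stable (F - s' *\<^sub>R mat 1)"
proof -
  obtain P where P: "pos_def P" "\<And>x. x \<noteq> 0 \<Longrightarrow> (P *v x) \<bullet> (F *v x - s *\<^sub>R x) < 0"
    using assms(1) by (auto simp: lyap_stable_def shift_mult)
  have "(P *v x) \<bullet> (F *v x - s' *\<^sub>R x) < 0" if "x \<noteq> 0" for x
  proof -
    have "0 < x \<bullet> (P *v x)" using P(1) that by (auto simp: pos_def_def)
    then have "s * ((P *v x) \<bullet> x) \<le> s' * ((P *v x) \<bullet> x)"
      using assms(2) by (intro mult_right_mono) (auto simp: inner_commute)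
    then show ?thesis using P(2)[OF that] by (simp add: inner_diff_right)
  qed
  then show ?thesis using P(1) by (auto simp: lyap_stable_def shift_mult)
qed

lemma norm_matrix_vector_le: "norm ((A::real^'n^'m) *v x) \<le> norm A * norm x"
proof -
  have "norm (A *v x) \<le> L2_set (\<lambda>i. norm (A $ i) * norm x) UNIV"
    unfolding norm_vec_def[of "A *v x"]
    by (intro L2_set_mono) (auto simp: matrix_vector_mul_component norm_cauchy_schwarz Cauchy_Schwarz_ineq2)
  also have "\<dots> = norm A * norm x"
    by (simp add: norm_vec_def[of A] L2_set_left_distrib)
  finally show ?thesis .
qed

lemma lyap_stable_shift_large:
  assumes "norm F < s"
  shows "lyap_stable (F - s *\<^sub>R mat 1)"
proof -
  have "pos_def (mat 1 :: real^'a^'a)" by (auto simp: pos_def_def symmetric_matrix_def)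
  moreover have "(mat 1 *v x) \<bullet> (F *v x - s *\<^sub>R x) < 0" if "x \<noteq> 0" for x :: "real^'a"
  proof -
    have "x \<bullet> (F *v x) \<le> norm x * norm (F *v x)" by (rule norm_cauchy_schwarz)
    also have "\<dots> \<le> norm x * (norm F * norm x)" by (intro mult_left_mono norm_matrix_vector_le) auto
    also have "\<dots> < s * (norm x)\<^sup>2" using assms that by (simp add: power2_eq_square mult.commute)
    finally show ?thesis by (simp add: inner_diff_right dot_square_norm)
  qed
  ultimately show ?thesis unfolding lyap_stable_def shift_mult by blast
qed

lemma lyap_stable_shift_open:
  fixes F :: "real^'n^'n"
  assumes "lyap_stable (F - s *\<^sub>R mat 1)"
  shows "\<exists>\<delta>>0. lyap_stable (F - (s - \<delta>) *\<^sub>R mat 1)"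
proof -
  obtain P where P: "pos_def P" "\<And>x. x \<noteq> 0 \<Longrightarrow> (P *v x) \<bullet> (F *v x - s *\<^sub>R x) < 0"
    using assms by (auto simp: lyap_stable_def shift_mult)
  let ?q = "\<lambda>x. (P *v x) \<bullet> (F *v x - s *\<^sub>R x)"
  have "continuous_on (sphere 0 1) ?q" by (intro continuous_intros)
  from continuous_attains_sup[OF compact_sphere sphere_nonempty this]
  obtain u where u: "u \<in> sphere 0 1" "\<forall>x\<in>sphere 0 1. ?q x \<le> ?q u" by blast
  have "norm u = 1" using u(1) by simp
  then have "?q u < 0" by (intro P(2)) force
  \<comment> \<open>On the compact sphere the negative form stays below \<open>?q u\<close>.
    Reducing the shift by \<delta> adds at most \<delta> * norm P, which is less than this
    gap.\<close>
  define \<delta> where "\<delta> = - ?q u / (norm P + 1)"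
  have "0 < \<delta>" unfolding \<delta>_def by (intro divide_pos_pos) (use \<open>?q u < 0\<close> in \<open>auto simp: add_nonneg_pos\<close>)
  have d: "\<delta> * norm P < - ?q u"
  proof -
    have "\<delta> * (norm P + 1) = - ?q u" unfolding \<delta>_def using norm_ge_zero[of P] by (simp add: add_nonneg_eq_0_iff)
    then show ?thesis using \<open>0 < \<delta>\<close> by (simp add: distrib_left)
  qed
  have "(P *v x) \<bullet> (F *v x - (s - \<delta>) *\<^sub>R x) < 0" if x: "x \<noteq> 0" for x
  proof -
    obtain w r where w: "norm w = 1" "0 < r" "x = r *\<^sub>R w" using unit_vector_scale[OF x] by blast
    have "(P *v w) \<bullet> w \<le> norm (P *v w) * norm w" by (rule norm_cauchy_schwarz)
    also have "\<dots> \<le> norm P" using norm_matrix_vector_le[of P w] w(1) by simp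
    finally have "\<delta> * ((P *v w) \<bullet> w) \<le> \<delta> * norm P" using \<open>0 < \<delta>\<close> by simp
    moreover have "?q w \<le> ?q u" using bspec[OF u(2), of w] w(1) by simp
    ultimately have "?q w + \<delta> * ((P *v w) \<bullet> w) < 0" using d by linarith
    then have n: "(P *v w) \<bullet> (F *v w - (s - \<delta>) *\<^sub>R w) < 0" by (simp add: inner_diff_right algebra_simps)
    have "(P *v x) \<bullet> (F *v x - (s - \<delta>) *\<^sub>R x) = (r * r) * ((P *v w) \<bullet> (F *v w - (s - \<delta>) *\<^sub>R w))"
      by (simp add: w(3) matrix_vector_mult_scaleR inner_diff_right algebra_simps)
    then show ?thesis using n w(2) by (simp add: mult_less_0_iff)
  qed
  then show ?thesis using P(1) \<open>0 < \<delta>\<close> by (auto simp: lyap_stable_def shift_mult intro!: exI[of _ \<delta>])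
qed

section \<open>Stability and eigenvalues\<close>

text \<open>The vector q(T) v, computed by recursion over the coefficients so that no matrix powers
  are formed.\<close>

definition poly_act :: "complex^'n^'n \<Rightarrow> complex poly \<Rightarrow> complex^'n \<Rightarrow> complex^'n" where
  "poly_act T q = fold_coeffs (\<lambda>a g v. a *s v + g (T *v v)) q (\<lambda>v. 0)"

lemma poly_act_0 [simp]: "poly_act T 0 v = 0"
  by (simp add: poly_act_def)

lemma poly_act_pCons [simp]: "poly_act T (pCons a q) v = a *s v + poly_act T q (T *v v)"
  by (cases "q = 0"; cases "a = 0")
    (auto simp: poly_act_def fold_coeffs_pCons_not_0_0_eq fold_coeffs_pCons_coeff_not_0_eq)

lemma poly_act_add: "poly_act T (p + q) v = poly_act T p v + poly_act T q v"
  by (induction p q arbitrary: v rule: poly_induct2) (simp_all add: vec_eq_iff algebra_simps)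

lemma poly_act_sum: "poly_act T (\<Sum>i\<in>I. p i) v = (\<Sum>i\<in>I. poly_act T (p i) v)"
  by (induction I rule: infinite_finite_induct) (auto simp: poly_act_add)

lemma poly_act_smult: "poly_act T (smult c q) v = c *s poly_act T q v"
  by (induction q arbitrary: v) (simp_all add: vec_eq_iff algebra_simps)

lemma poly_act_vector_add: "poly_act T q (v + w) = poly_act T q v + poly_act T q w"
  by (induction q arbitrary: v w) (simp_all add: matrix_vector_right_distrib vec_eq_iff algebra_simps)

lemma poly_act_vector_scale: "poly_act T q (c *s v) = c *s poly_act T q v"
proof (induction q arbitrary: v)
  case (pCons a q)
  have "T *v (c *s v) = c *s (T *v v)" by (simp add: vector_scalar_commute)
  then show ?case using pCons by (simp add: vector_add_ldistrib vector_smult_assoc mult.commute)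
qed simp

lemma poly_act_linear_factor: "poly_act T ([:-l, 1:] * q) v = poly_act T q (T *v v - l *s v)"
proof -
  have e: "[:-l, 1:] * q = smult (- l) q + pCons 0 q" by simp
  have "poly_act T ([:-l, 1:] * q) v = - l *s poly_act T q v + poly_act T q (T *v v)"
    unfolding e poly_act_add poly_act_smult by simp
  also have "\<dots> = poly_act T q (T *v v + (- l) *s v)"
    unfolding poly_act_vector_add poly_act_vector_scale by simp
  also have "T *v v + (- l) *s v = T *v v - l *s v" by (simp add: vec_eq_iff)
  finally show ?thesis .
qed

lemma poly_act_monom: "poly_act T (monom a k) v = a *s (((*v) T ^^ k) v)"
  by (induction k arbitrary: v) (simp_all add: monom_Suc monom_0 funpow_swap1)

text \<open>Splitting off the linear factors of \<open>q\<close> one at a time, some factor moves a vector outside of \<open>N\<close>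
  into \<open>N\<close>: an eigenvector of \<open>T\<close> modulo \<open>N\<close>.\<close>
lemma eigenvector_modulo:
  assumes N: "0 \<in> N" "\<And>c v. v \<in> N \<Longrightarrow> c *s v \<in> N"
    and q: "q \<noteq> 0" "poly_act T q v = 0" "v \<notin> N"
  shows "\<exists>w l. w \<notin> N \<and> T *v w - l *s w \<in> N"
  using q
proof (induction "degree q" arbitrary: q v)
  case 0
  then obtain a where a: "q = [:a:]" by (metis degree_eq_zeroE)
  then have "a \<noteq> 0" "a *s v = 0" using 0 by auto
  then have "v = 0" by (simp add: vec_eq_iff)
  then show ?case using 0 N by simp
next
  case (Suc d)
  then have "degree q \<noteq> 0" by simp
  then have "\<not> constant (poly q)" by (simp add: constant_degree)
  then obtain l where "poly q l = 0" using fundamental_theorem_of_algebra by blast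
  then obtain r where r: "q = [:-l, 1:] * r" by (metis dvdE poly_eq_0_iff_dvd)
  then have "r \<noteq> 0" using Suc by auto
  have "degree q = degree [:-l, 1:] + degree r"
    unfolding r by (rule degree_mult_eq) (use \<open>r \<noteq> 0\<close> in auto)
  then have d: "d = degree r" using Suc(2) by simp
  show ?case
  proof (cases "T *v v - l *s v \<in> N")
    case True
    then show ?thesis using Suc.prems by blast
  next
    case False
    have "poly_act T r (T *v v - l *s v) = 0" using Suc.prems(2) r poly_act_linear_factor by metis
    then show ?thesis using Suc.hyps(1)[OF d \<open>r \<noteq> 0\<close> _ False] by blast
  qed
qed

text \<open>One vector more than the dimension. Repetitions in the sequence are treated separately,
  because linear dependence is a notion for sets.\<close>

lemma annihilating_relation:
  fixes f :: "nat \<Rightarrow> 'a::euclidean_space"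
  shows "\<exists>c. (\<exists>k\<le>DIM('a). c k \<noteq> 0) \<and> (\<Sum>k\<le>DIM('a). c k *\<^sub>R f k) = 0"
proof (cases "inj_on f {..DIM('a)}")
  case True
  then have "card (f ` {..DIM('a)}) = DIM('a) + 1" by (simp add: card_image)
  then have "dependent (f ` {..DIM('a)})" by (intro dependent_biggerset) auto
  then obtain u where u: "\<exists>v\<in>f ` {..DIM('a)}. u v \<noteq> 0" "(\<Sum>v\<in>f ` {..DIM('a)}. u v *\<^sub>R v) = 0"
    using dependent_finite[of "f ` {..DIM('a)}"] by auto
  then show ?thesis using True by (intro exI[of _ "u \<circ> f"]) (auto simp: sum.reindex)
next
  case False
  then obtain i j where ij: "i \<le> DIM('a)" "j \<le> DIM('a)" "i \<noteq> j" "f i = f j" by (auto simp: inj_on_def)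
  let ?c = "\<lambda>k. if k = i then 1 else if k = j then - 1 else (0::real)"
  have "(\<Sum>k\<le>DIM('a). ?c k *\<^sub>R f k) = (\<Sum>k\<in>{i, j}. ?c k *\<^sub>R f k)"
    using ij by (intro sum.mono_neutral_right) auto
  also have "\<dots> = 0" using ij by simp
  finally show ?thesis using ij by (intro exI[of _ ?c]) auto
qed

definition cvec :: "real^'n \<Rightarrow> complex^'n" where "cvec x = (\<chi> i. complex_of_real (x $ i))"
definition cmat :: "real^'n^'m \<Rightarrow> complex^'n^'m" where "cmat M = (\<chi> i j. complex_of_real (M $ i $ j))"
definition re_vec :: "complex^'n \<Rightarrow> real^'n" where "re_vec v = (\<chi> i. Re (v $ i))"
definition im_vec :: "complex^'n \<Rightarrow> real^'n" where "im_vec v = (\<chi> i. Im (v $ i))"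

lemma cmat_cvec: "cmat M *v cvec x = cvec (M *v x)"
  by (simp add: cmat_def cvec_def matrix_vector_mult_def vec_eq_iff)

lemma re_cmat: "re_vec (cmat M *v v) = M *v re_vec v"
  by (simp add: re_vec_def cmat_def matrix_vector_mult_def vec_eq_iff)

lemma im_cmat: "im_vec (cmat M *v v) = M *v im_vec v"
  by (simp add: im_vec_def cmat_def matrix_vector_mult_def vec_eq_iff)

lemma complex_vec_eq_iff: "v = w \<longleftrightarrow> re_vec v = re_vec w \<and> im_vec v = im_vec w"
  by (auto simp: vec_eq_iff re_vec_def im_vec_def complex_eq_iff)

lemma re_im_simps [simp]:
  "re_vec (v + w) = re_vec v + re_vec w" "im_vec (v + w) = im_vec v + im_vec w"
  "re_vec (v - w) = re_vec v - re_vec w" "im_vec (v - w) = im_vec v - im_vec w"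
  "re_vec 0 = 0" "im_vec 0 = 0" "re_vec (cvec x) = x" "im_vec (cvec x) = 0"
  "re_vec (l *s v) = Re l *\<^sub>R re_vec v - Im l *\<^sub>R im_vec v"
  "im_vec (l *s v) = Re l *\<^sub>R im_vec v + Im l *\<^sub>R re_vec v"
  by (auto simp: vec_eq_iff re_vec_def im_vec_def cvec_def)

lemma eigenvalues_iff: "l \<in> eigenvalues M \<longleftrightarrow> (\<exists>v. v \<noteq> 0 \<and> cmat M *v v = l *s v)"
  by (simp add: eigenvalues_def cmat_def)

text \<open>The real and imaginary parts of the eigenvalue equation for a + i b and \<sigma> + i
  \<omega>. Besides avoiding complex vectors, this makes stability a first-order formula over the
  reals.\<close>

lemma stable_iff:
  "stable F \<longleftrightarrow> (\<forall>\<sigma> \<omega> a b. F *v a = \<sigma> *\<^sub>R a - \<omega> *\<^sub>R b \<longrightarrow> F *v b = \<sigma> *\<^sub>R b + \<omega> *\<^sub>R a \<longrightarrow> a = 0 \<and> b = 0 \<or> \<sigma> < 0)"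
proof
  assume s: "stable F"
  show "\<forall>\<sigma> \<omega> a b. F *v a = \<sigma> *\<^sub>R a - \<omega> *\<^sub>R b \<longrightarrow> F *v b = \<sigma> *\<^sub>R b + \<omega> *\<^sub>R a \<longrightarrow> a = 0 \<and> b = 0 \<or> \<sigma> < 0"
  proof (intro allI impI)
    fix \<sigma> \<omega> and a b :: "real^'a"
    assume *: "F *v a = \<sigma> *\<^sub>R a - \<omega> *\<^sub>R b" "F *v b = \<sigma> *\<^sub>R b + \<omega> *\<^sub>R a"
    define v :: "complex^'a" where "v = (\<chi> i. Complex (a $ i) (b $ i))"
    have v: "re_vec v = a" "im_vec v = b" by (auto simp: v_def re_vec_def im_vec_def vec_eq_iff)
    have "cmat F *v v = Complex \<sigma> \<omega> *s v"
      unfolding complex_vec_eq_iff re_cmat im_cmat by (simp add: v *)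
    then have "v = 0 \<or> Complex \<sigma> \<omega> \<in> eigenvalues F" unfolding eigenvalues_iff by blast
    then have "v = 0 \<or> \<sigma> < 0" using s unfolding stable_def by (metis complex.sel(1))
    then show "a = 0 \<and> b = 0 \<or> \<sigma> < 0" using v by auto
  qed
next
  assume *: "\<forall>\<sigma> \<omega> a b. F *v a = \<sigma> *\<^sub>R a - \<omega> *\<^sub>R b \<longrightarrow> F *v b = \<sigma> *\<^sub>R b + \<omega> *\<^sub>R a \<longrightarrow> a = 0 \<and> b = 0 \<or> \<sigma> < 0"
  show "stable F"
    unfolding stable_def eigenvalues_iff
  proof (intro ballI)
    fix l assume "l \<in> eigenvalues F"
    then obtain v where v: "v \<noteq> 0" "cmat F *v v = l *s v" unfolding eigenvalues_iff by blast
    have "F *v re_vec v = Re l *\<^sub>R re_vec v - Im l *\<^sub>R im_vec v" "F *v im_vec v = Re l *\<^sub>R im_vec v + Im l *\<^sub>R re_vec v"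
      using arg_cong[OF v(2), of re_vec] arg_cong[OF v(2), of im_vec] by (auto simp: re_cmat im_cmat)
    then have "re_vec v = 0 \<and> im_vec v = 0 \<or> Re l < 0" using * by blast
    then show "Re l < 0" using v(1) complex_vec_eq_iff[of v 0] by auto
  qed
qed

text \<open>If \<open>l\<close> were no eigenvalue, T - l would be injective, hence by dimension map
  the invariant space \<open>N\<close> onto itself; then only points of \<open>N\<close> could be
  mapped into \<open>N\<close>.\<close>

lemma eigenvalue_of_modulo:
  fixes T :: "complex^'n^'n"
  assumes N: "subspace N" "\<And>c v. v \<in> N \<Longrightarrow> c *s v \<in> N" "\<And>v. v \<in> N \<Longrightarrow> T *v v \<in> N"
    and w: "w \<notin> N" "T *v w - l *s w \<in> N"
  shows "\<exists>v. v \<noteq> 0 \<and> T *v v = l *s v"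
proof (rule ccontr)
  assume none: "\<not> ?thesis"
  let ?f = "\<lambda>v. T *v v - l *s v"
  have lin: "linear ?f"
  proof (rule linearI)
    show "?f (x + y) = ?f x + ?f y" for x y by (simp add: matrix_vector_right_distrib vector_add_ldistrib)
    have "l *s (r *\<^sub>R x) = r *\<^sub>R (l *s x)" for r and x :: "complex^'n" by (simp add: vec_eq_iff)
    then show "?f (r *\<^sub>R x) = r *\<^sub>R ?f x" for r x
      by (simp add: linear_scale[OF matrix_vector_mul_linear] scaleR_diff_right)
  qed
  have inj: "inj ?f" unfolding linear_injective_0[OF lin] using none by auto
  have sub: "?f ` N \<subseteq> N" using N by (auto intro!: subspace_diff)
  have "dim (?f ` N) = dim N" by (rule dim_image_eq[OF lin]) (use inj in \<open>auto intro: inj_on_subset\<close>)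
  then have "?f ` N = N"
    using subspace_dim_equal[OF linear_subspace_image[OF lin N(1)] N(1) sub] by simp
  then obtain v where "v \<in> N" "?f w = ?f v" using w(2) by (metis (no_types, lifting) imageE)
  then show False using inj w(1) by (auto dest: injD)
qed

text \<open>The form \<open>p\<close> is constant along x' = F x, so its kernel \<open>N\<close> is
  invariant under \<open>F\<close>. An eigenvector \<open>w\<close> modulo \<open>N\<close> with
  eigenvalue \<open>l\<close> satisfies Re l * p(w) = 0 with p(w) nonzero, where p(w) is the form
  summed over real and imaginary parts. So \<open>l\<close>, an eigenvalue of \<open>F\<close>, has
  real part 0.\<close>

lemma neutral_not_stable:
  fixes F :: "real^'n^'n"
  assumes p: "pos_semidef p" "p \<noteq> 0" "transpose F ** p + p ** F = 0"
  shows "\<not> stable F"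
proof
  assume st: "stable F"
  have psym: "symmetric_matrix p" using p by (simp add: pos_semidef_def)
  have pF: "p *v (F *v x) = - (transpose F *v (p *v x))" for x
  proof -
    have "(transpose F ** p + p ** F) *v x = 0" using p(3) by simp
    then have "transpose F *v (p *v x) + p *v (F *v x) = 0"
      by (simp only: matrix_vector_mult_add_rdistrib matrix_vector_mul_assoc)
    then show ?thesis by (simp add: eq_neg_iff_add_eq_0 add.commute)
  qed
  have q0: "(p *v x) \<bullet> (F *v x) = 0" for x
    using quad_lyap_op[OF psym, of x F] p(3) by simp
  define N where "N = {v. p *v re_vec v = 0 \<and> p *v im_vec v = 0}"
  have N: "subspace N"
  proof (rule subspaceI)
    fix c v assume "v \<in> N"
    moreover have "re_vec (c *\<^sub>R v) = c *\<^sub>R re_vec v" "im_vec (c *\<^sub>R v) = c *\<^sub>R im_vec v"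
      by (auto simp: re_vec_def im_vec_def vec_eq_iff)
    ultimately show "c *\<^sub>R v \<in> N" by (simp add: N_def matrix_vector_mult_scaleR)
  qed (auto simp: N_def matrix_vector_right_distrib)
  have Ns: "c *s v \<in> N" if "v \<in> N" for c v
    using that by (simp add: N_def matrix_vector_right_distrib matrix_vector_mult_diff_distrib matrix_vector_mult_scaleR)
  have NF: "cmat F *v v \<in> N" if "v \<in> N" for v
    using that by (simp add: N_def re_cmat im_cmat pF del: transpose_matrix_vector)
  obtain u where u: "p *v u \<noteq> 0" using p(2) by (auto simp: matrix_eq)
  obtain c where c: "\<exists>k\<le>DIM(real^'n). c k \<noteq> 0" "(\<Sum>k\<le>DIM(real^'n). c k *\<^sub>R ((*v) F ^^ k) u) = 0"
    using annihilating_relation[of "\<lambda>k. ((*v) F ^^ k) u"] by blast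
  \<comment> \<open>The dependence among the iterates of \<open>u\<close> under \<open>F\<close>,
    read as a polynomial annihilating \<open>u\<close>.\<close>
  define q where "q = (\<Sum>k\<le>DIM(real^'n). monom (complex_of_real (c k)) k)"
  have "coeff q k = complex_of_real (c k)" if "k \<le> DIM(real^'n)" for k
    using that by (simp add: q_def coeff_sum if_distrib sum.delta cong: if_cong)
  then have "q \<noteq> 0" using c(1) by (metis coeff_0 of_real_eq_0_iff)
  have pw: "((*v) (cmat F) ^^ k) (cvec u) = cvec (((*v) F ^^ k) u)" for k
    by (induction k) (auto simp: cmat_cvec)
  have "poly_act (cmat F) q (cvec u) = (\<Sum>k\<le>DIM(real^'n). complex_of_real (c k) *s cvec (((*v) F ^^ k) u))"
    by (simp add: q_def poly_act_sum poly_act_monom pw)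
  also have "\<dots> = cvec (\<Sum>k\<le>DIM(real^'n). c k *\<^sub>R ((*v) F ^^ k) u)"
    by (simp add: cvec_def vec_eq_iff)
  also have "\<dots> = 0" unfolding c(2) by (simp add: cvec_def vec_eq_iff)
  finally have qa: "poly_act (cmat F) q (cvec u) = 0" .
  have "cvec u \<notin> N" using u by (simp add: N_def)
  from eigenvector_modulo[OF subspace_0[OF N] Ns \<open>q \<noteq> 0\<close> qa this]
  obtain w l where w: "w \<notin> N" "cmat F *v w - l *s w \<in> N" by blast
  from eigenvalue_of_modulo[OF N Ns NF w] have "l \<in> eigenvalues F" by (simp add: eigenvalues_iff)
  then have Rl: "Re l < 0" using st by (simp add: stable_def)
  define a b where "a = re_vec w" and "b = im_vec w"
  have pa: "p *v (F *v a) = Re l *\<^sub>R (p *v a) - Im l *\<^sub>R (p *v b)" and pb: "p *v (F *v b) = Re l *\<^sub>R (p *v b) + Im l *\<^sub>R (p *v a)"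
    using w(2) by (simp_all add: N_def re_cmat im_cmat a_def b_def matrix_vector_right_distrib
      matrix_vector_mult_diff_distrib matrix_vector_mult_scaleR)
  have "0 = a \<bullet> (p *v (F *v a))" "0 = b \<bullet> (p *v (F *v b))"
    using q0[of a] q0[of b] symmetric_inner[OF psym] by auto
  then have "Re l * (a \<bullet> (p *v a)) - Im l * (a \<bullet> (p *v b)) = 0" "Re l * (b \<bullet> (p *v b)) + Im l * (b \<bullet> (p *v a)) = 0"
    unfolding pa pb by (auto simp: inner_diff_right inner_add_right)
  moreover have "a \<bullet> (p *v b) = b \<bullet> (p *v a)" using symmetric_inner[OF psym, of a b] by (simp add: inner_commute)
  ultimately have "Re l * (a \<bullet> (p *v a) + b \<bullet> (p *v b)) = 0" by (simp add: distrib_left)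
  then have "a \<bullet> (p *v a) + b \<bullet> (p *v b) = 0" using Rl by simp
  moreover have "0 \<le> a \<bullet> (p *v a)" "0 \<le> b \<bullet> (p *v b)" using p(1) by (auto simp: pos_semidef_def)
  ultimately have "p *v a = 0" "p *v b = 0" by (auto intro!: pos_semidef_kernel[OF p(1)])
  then show False using w(1) by (simp add: N_def a_def b_def)
qed

lemma stable_shift:
  assumes "stable F" "0 \<le> s"
  shows "stable (F - s *\<^sub>R mat 1)"
proof -
  have sh: "(F - s *\<^sub>R mat 1) *v x = F *v x - s *\<^sub>R x" for x
    by (simp add: matrix_vector_mult_diff_rdistrib flip: scaleR_matrix_vector_assoc)
  show ?thesis
    unfolding stable_iff sh
  proof (intro allI impI)
    fix \<sigma> \<omega> a b assume "F *v a - s *\<^sub>R a = \<sigma> *\<^sub>R a - \<omega> *\<^sub>R b" "F *v b - s *\<^sub>R b = \<sigma> *\<^sub>R b + \<omega> *\<^sub>R a"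
    then have "F *v a = (\<sigma> + s) *\<^sub>R a - \<omega> *\<^sub>R b" "F *v b = (\<sigma> + s) *\<^sub>R b + \<omega> *\<^sub>R a"
      by (simp_all add: algebra_simps)
    then have "a = 0 \<and> b = 0 \<or> \<sigma> + s < 0" using assms(1) unfolding stable_iff by blast
    then show "a = 0 \<and> b = 0 \<or> \<sigma> < 0" using assms(2) by auto
  qed
qed

lemma lyap_scaleR: "lyap F M P \<Longrightarrow> lyap F (c *\<^sub>R M) (c *\<^sub>R P)"
  by (simp add: lyap_def symmetric_matrix_def transpose_scaleR matrix_mul_scaleR_left matrix_mul_scaleR_right
    flip: scaleR_add_right)

lemma lyap_shift: "lyap (F - s *\<^sub>R mat 1) M P \<longleftrightarrow> lyap F (M - (2 * s) *\<^sub>R P) P"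
proof -
  have "transpose (F - s *\<^sub>R mat 1) ** P + P ** (F - s *\<^sub>R mat 1) + M =
      transpose F ** P + P ** F + (M - (2 * s) *\<^sub>R P)"
    by (simp add: transpose_diff transpose_scaleR matrix_mul_diff_left matrix_mul_diff_right
      matrix_mul_scaleR_left matrix_mul_scaleR_right algebra_simps flip: scaleR_add_left)
  then show ?thesis unfolding lyap_def by (simp only:)
qed

lemma linear_tendsto:
  fixes h :: "'a::euclidean_space \<Rightarrow> 'b::real_normed_vector"
  assumes "(f \<longlongrightarrow> l) net" "linear h"
  shows "((\<lambda>x. h (f x)) \<longlongrightarrow> h l) net"
  using assms bounded_linear.tendsto linear_conv_bounded_linear by blast

lemma pos_def_mat_1: "pos_def (mat 1 :: real^'n^'n)"
  by (auto simp: pos_def_def symmetric_matrix_def)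

text \<open>Normalized solutions for \<open>F - s I\<close> converge as \<open>s\<close> decreases to \<open>0\<close>. If the right-hand sides degenerate in the limit,
  the limit is a nonzero form preserved by the flow of \<open>F\<close>, which stability excludes.\<close>
lemma lyap_stable_shift_closed:
  fixes F :: "real^'n^'n"
  assumes st: "stable F" and good: "\<And>s. 0 < s \<Longrightarrow> lyap_stable (F - s *\<^sub>R mat 1)"
  shows "lyap_stable F"
proof -
  define s where "s k = inverse (real (Suc k))" for k
  have s0: "0 < s k" for k by (simp add: s_def)
  have "\<exists>P. lyap (F - s k *\<^sub>R mat 1) (mat 1) P" for k
    by (rule lyap_exists[OF good[OF s0]]) (simp add: symmetric_matrix_def)
  then obtain P where P: "\<And>k. lyap (F - s k *\<^sub>R mat 1) (mat 1) (P k)" by metis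
  \<comment> \<open>This scaling gives norm (p k) + c k = 1: the pairs stay in a compact set, and in
    the limit the form and the right-hand side cannot both vanish.\<close>
  define c where "c k = inverse (1 + norm (P k))" for k
  define p where "p k = c k *\<^sub>R P k" for k
  have c: "0 < c k" "c k \<le> 1" for k by (auto simp: c_def add_pos_nonneg field_simps)
  have "c k * (1 + norm (P k)) = 1" for k
    unfolding c_def using norm_ge_zero[of "P k"] by (simp add: add_nonneg_eq_0_iff)
  then have np: "norm (p k) = 1 - c k" for k using c[of k] by (simp add: p_def algebra_simps)
  have psd: "pos_semidef (P k)" for k
    by (rule lyap_pos_semidef[OF good[OF s0] P pos_def_semidef[OF pos_def_mat_1]])
  have psd': "0 \<le> x \<bullet> (p k *v x)" for k x
    using psd[of k] c[of k] by (simp add: p_def pos_semidef_def flip: scaleR_matrix_vector_assoc)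
  have lp: "lyap (F - s k *\<^sub>R mat 1) (c k *\<^sub>R mat 1) (p k)" for k
    unfolding p_def by (rule lyap_scaleR[OF P])
  have mem: "\<forall>k. (\<lambda>k. (p k, c k)) k \<in> cball 0 1 \<times> {0..1}" using np c by (auto simp: less_imp_le)
  have "compact (cball (0::real^'n^'n) 1 \<times> {0..1::real})" by (intro compact_Times) auto
  from seq_compactE[OF compact_imp_seq_compact[OF this] mem] obtain l r where l: "l \<in> cball (0::real^'n^'n) 1 \<times> {0..1::real}" "strict_mono r"
    "((\<lambda>k. (p k, c k)) \<circ> r) \<longlonglongrightarrow> l" by blast
  define q d where "q = fst l" and "d = snd l"
  have pq: "(\<lambda>k. p (r k)) \<longlonglongrightarrow> q" and cd: "(\<lambda>k. c (r k)) \<longlonglongrightarrow> d"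
    using tendsto_fst[OF l(3)] tendsto_snd[OF l(3)] by (auto simp: q_def d_def o_def)
  have d0: "0 \<le> d" using l(1) by (auto simp: d_def)
  have s_lim: "(\<lambda>k. s (r k)) \<longlonglongrightarrow> 0"
    using LIMSEQ_subseq_LIMSEQ[OF LIMSEQ_inverse_real_of_nat l(2)] by (simp add: s_def o_def)
  have "(\<lambda>k. norm (p (r k))) \<longlonglongrightarrow> norm q" by (intro tendsto_norm pq)
  moreover have "(\<lambda>k. norm (p (r k))) \<longlonglongrightarrow> 1 - d" unfolding np by (intro tendsto_intros cd)
  ultimately have nq: "norm q = 1 - d" by (rule LIMSEQ_unique)
  have lin: "linear (\<lambda>X. transpose F ** X + X ** F)"
    by (rule linearI) (simp_all add: matrix_mul_bilinear algebra_simps)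
  have "(\<lambda>k. transpose (p (r k))) \<longlonglongrightarrow> transpose q"
    by (rule linear_tendsto[OF pq]) (rule linearI, simp_all add: transpose_linear)
  moreover have "transpose (p (r k)) = p (r k)" for k using lp by (auto simp: lyap_def symmetric_matrix_def)
  ultimately have "(\<lambda>k. p (r k)) \<longlonglongrightarrow> transpose q" by simp
  then have qsym: "symmetric_matrix q" unfolding symmetric_matrix_def by (rule LIMSEQ_unique[OF _ pq])
  have "(\<lambda>k. transpose F ** p (r k) + p (r k) ** F + (c (r k) *\<^sub>R mat 1 - (2 * s (r k)) *\<^sub>R p (r k))) \<longlonglongrightarrow>
      transpose F ** q + q ** F + (d *\<^sub>R mat 1 - (2 * 0) *\<^sub>R q)"
    by (rule tendsto_add[OF linear_tendsto[OF pq lin]]) (intro tendsto_intros cd s_lim pq)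
  moreover have "transpose F ** p k + p k ** F + (c k *\<^sub>R mat 1 - (2 * s k) *\<^sub>R p k) = 0" for k
    using lp[of k, unfolded lyap_shift] unfolding lyap_def by blast
  ultimately have "(\<lambda>k. 0) \<longlonglongrightarrow> transpose F ** q + q ** F + (d *\<^sub>R mat 1 - (2 * 0) *\<^sub>R q)" by (simp only:)
  from LIMSEQ_unique[OF tendsto_const this] have "transpose F ** q + q ** F + d *\<^sub>R mat 1 = 0" by simp
  then have lq: "lyap F (d *\<^sub>R mat 1) q" using qsym by (simp add: lyap_def)
  have "0 \<le> x \<bullet> (q *v x)" for x
  proof -
    have "linear (\<lambda>X. x \<bullet> (X *v x))"
      by (rule linearI)
        (simp_all add: matrix_vector_mult_add_rdistrib inner_add_right flip: scaleR_matrix_vector_assoc)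
    from linear_tendsto[OF pq this] show ?thesis by (rule LIMSEQ_le_const) (use psd' in auto)
  qed
  then have qpsd: "pos_semidef q" using qsym by (simp add: pos_semidef_def)
  show ?thesis
  proof (cases "d = 0")
    case True
    then have "q \<noteq> 0" using nq by auto
    then show ?thesis using neutral_not_stable[OF qpsd] lq st True by (simp add: lyap_def)
  next
    case False
    then have "pos_def (d *\<^sub>R mat 1 :: real^'n^'n)"
      using d0 pos_def_mat_1 by (auto simp: pos_def_def symmetric_matrix_def transpose_scaleR simp flip: scaleR_matrix_vector_assoc)
    then show ?thesis using lyap_stableI[OF lq] lyap_pos_def_of_semidef[OF lq qpsd] by blast
  qed
qed

text \<open>Continuation in the shift: the set of s \<ge> 0 for which F - s I has a quadratic
  Lyapunov function contains all large s and is closed upwards. Eigenvalue stability lets the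
  infimum belong to it, and openness then forces the infimum to be 0.\<close>

theorem stable_imp_lyap_stable:
  fixes F :: "real^'n^'n"
  assumes st: "stable F"
  shows "lyap_stable F"
proof -
  let ?S = "{s. 0 \<le> s \<and> lyap_stable (F - s *\<^sub>R mat 1)}"
  have ne: "?S \<noteq> {}" using lyap_stable_shift_large[of F "norm F + 1"] by (auto intro!: exI[of _ "norm F + 1"])
  have bdd: "bdd_below ?S" by (intro bdd_belowI[of _ 0]) auto
  define m where "m = Inf ?S"
  have m0: "0 \<le> m" unfolding m_def by (rule cInf_greatest[OF ne]) auto
  have "lyap_stable ((F - m *\<^sub>R mat 1) - s *\<^sub>R mat 1)" if s: "0 < s" for s
  proof -
    obtain s' where s': "s' \<in> ?S" "s' < m + s"
      using cInf_less_iff[OF ne bdd, of "m + s"] s by (auto simp: m_def)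
    then have "lyap_stable (F - (m + s) *\<^sub>R mat 1)" using lyap_stable_shift_mono[of F s' "m + s"] by auto
    moreover have "F - (m + s) *\<^sub>R mat 1 = (F - m *\<^sub>R mat 1) - s *\<^sub>R mat 1" by (simp add: scaleR_add_left)
    ultimately show ?thesis by simp
  qed
  then have good: "lyap_stable (F - m *\<^sub>R mat 1)"
    by (rule lyap_stable_shift_closed[OF stable_shift[OF st m0]])
  have "m = 0"
  proof (rule ccontr)
    assume "m \<noteq> 0"
    obtain \<delta> where \<delta>: "0 < \<delta>" "lyap_stable (F - (m - \<delta>) *\<^sub>R mat 1)" using lyap_stable_shift_open[OF good] by blast
    have "lyap_stable (F - max 0 (m - \<delta>) *\<^sub>R mat 1)" by (rule lyap_stable_shift_mono[OF \<delta>(2)]) simp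
    then have "m \<le> max 0 (m - \<delta>)" unfolding m_def by (intro cInf_lower[OF _ bdd]) (auto simp: m_def)
    then show False using \<delta>(1) m0 \<open>m \<noteq> 0\<close> by (auto simp: max_def split: if_splits)
  qed
  then show ?thesis using good by simp
qed

section \<open>The quadratic cost\<close>

text \<open>The power series with coefficients F^k \<xi> / k!, handled component by component so
  that termwise differentiation of real series applies.\<close>

lemma linear_ode_solution:
  fixes F :: "real^'n^'n"
  shows "\<exists>x. x 0 = \<xi> \<and> (\<forall>t. (x has_vector_derivative F *v x t) (at t within S))"
proof -
  define y where "y k = (((*v) F ^^ k) \<xi>) /\<^sub>R fact k" for k
  have y_Suc: "F *v y k = real (Suc k) *\<^sub>R y (Suc k)" for k
  proof -
    have "inverse (fact k) = real (Suc k) * inverse (fact (Suc k))" by (simp add: fact_Suc)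
    then show ?thesis by (simp add: y_def matrix_vector_mult_scaleR del: fact_Suc of_nat_Suc)
  qed
  have nb: "norm (((*v) F ^^ k) \<xi>) \<le> norm F ^ k * norm \<xi>" for k
  proof (induction k)
    case (Suc k)
    have "norm (((*v) F ^^ Suc k) \<xi>) \<le> norm F * norm (((*v) F ^^ k) \<xi>)" by (simp add: norm_matrix_vector_le)
    also have "\<dots> \<le> norm F * (norm F ^ k * norm \<xi>)" by (intro mult_left_mono Suc) auto
    finally show ?case by (simp add: mult.assoc)
  qed simp
  have summ: "summable (\<lambda>k. y k $ i * t ^ k)" for i and t :: real
  proof (rule summable_comparison_test')
    show "summable (\<lambda>k. norm \<xi> * (inverse (fact k) * (norm F * \<bar>t\<bar>) ^ k))"
      using summable_exp[of "norm F * \<bar>t\<bar>"] by (intro summable_mult) (simp add: divide_inverse mult.commute)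
    fix k :: nat assume "0 \<le> k"
    have "\<bar>y k $ i\<bar> \<le> norm (y k)" by (rule component_le_norm_cart)
    also have "\<dots> \<le> inverse (fact k) * (norm F ^ k * norm \<xi>)"
      unfolding y_def using nb[of k] by (simp add: divide_inverse mult.commute mult_left_mono)
    finally have "\<bar>y k $ i\<bar> * \<bar>t\<bar> ^ k \<le> inverse (fact k) * (norm F ^ k * norm \<xi>) * \<bar>t\<bar> ^ k"
      by (rule mult_right_mono) simp
    then show "norm (y k $ i * t ^ k) \<le> norm \<xi> * (inverse (fact k) * (norm F * \<bar>t\<bar>) ^ k)"
      by (simp add: abs_mult power_abs power_mult_distrib algebra_simps)
  qed
  define g where "g i t = (\<Sum>k. y k $ i * t ^ k)" for i and t :: real
  define x where "x t = (\<Sum>i\<in>UNIV. g i t *\<^sub>R axis i (1::real))" for t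
  have xc: "x t $ i = g i t" for t i
    by (simp add: x_def axis_def if_distrib cong: if_cong)
  have g': "(g i has_field_derivative (F *v x t) $ i) (at t)" for i t
  proof -
    have "(\<Sum>k. diffs (\<lambda>k. y k $ i) k * t ^ k) = (\<Sum>k. \<Sum>j\<in>UNIV. F $ i $ j * (y k $ j * t ^ k))"
    proof (intro suminf_cong)
      fix k
      have "diffs (\<lambda>k. y k $ i) k = (F *v y k) $ i" unfolding y_Suc by (simp add: diffs_def)
      then show "diffs (\<lambda>k. y k $ i) k * t ^ k = (\<Sum>j\<in>UNIV. F $ i $ j * (y k $ j * t ^ k))"
        by (simp add: matrix_vector_mult_def sum_distrib_right mult.assoc)
    qed
    also have "\<dots> = (\<Sum>j\<in>UNIV. \<Sum>k. F $ i $ j * (y k $ j * t ^ k))"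
      by (intro suminf_sum summable_mult summ)
    also have "\<dots> = (\<Sum>j\<in>UNIV. F $ i $ j * g j t)"
      unfolding g_def by (intro sum.cong refl suminf_mult summ)
    also have "\<dots> = (F *v x t) $ i" by (simp add: matrix_vector_mult_def xc)
    finally show ?thesis
      using termdiffs_strong_converges_everywhere[of "\<lambda>k. y k $ i" t, OF summ] unfolding g_def by simp
  qed
  have "(x has_vector_derivative F *v x t) (at t within S)" for t
  proof -
    have "(x has_vector_derivative (\<Sum>i\<in>UNIV. g i t *\<^sub>R 0 + ((F *v x t) $ i) *\<^sub>R axis i (1::real))) (at t)"
      unfolding x_def[abs_def]
      by (intro has_vector_derivative_sum has_vector_derivative_scaleR has_vector_derivative_const g'[unfolded x_def[abs_def]])
    moreover have "(\<Sum>i\<in>UNIV. g i t *\<^sub>R 0 + ((F *v x t) $ i) *\<^sub>R axis i (1::real)) = F *v x t"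
      by (simp add: vec_eq_iff axis_def if_distrib cong: if_cong)
    ultimately show ?thesis by (auto intro: has_vector_derivative_at_within)
  qed
  moreover have "x 0 = \<xi>"
  proof -
    have "g i 0 = \<xi> $ i" for i unfolding g_def by (simp add: y_def)
    then show ?thesis by (simp add: vec_eq_iff xc)
  qed
  ultimately show ?thesis by blast
qed

lemma has_real_derivative_quadratic:
  fixes F :: "real^'n^'n"
  assumes P: "lyap F M P" and x: "(x has_vector_derivative F *v x t) (at t within S)"
  shows "((\<lambda>t. x t \<bullet> (P *v x t)) has_real_derivative - (x t \<bullet> (M *v x t))) (at t within S)"
proof -
  have "((\<lambda>t. P *v x t) has_vector_derivative P *v (F *v x t)) (at t within S)"
    by (rule bounded_linear.has_vector_derivative[OF matrix_vector_mul_bounded_linear x])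
  then have "((\<lambda>t. x t \<bullet> (P *v x t)) has_vector_derivative (x t \<bullet> (P *v (F *v x t)) + (F *v x t) \<bullet> (P *v x t))) (at t within S)"
    by (rule bounded_bilinear.has_vector_derivative[OF bounded_bilinear_inner x])
  moreover have "x t \<bullet> (P *v (F *v x t)) + (F *v x t) \<bullet> (P *v x t) = - (x t \<bullet> (M *v x t))"
    using lyap_quad[OF P, of "x t"] P symmetric_inner[of P "x t" "F *v x t"]
    by (simp add: lyap_def inner_commute)
  ultimately show ?thesis by (simp add: has_real_derivative_iff_has_vector_derivative)
qed

lemma lyap_diff:
  assumes "lyap F M P" "lyap F N P'"
  shows "lyap F (M - N) (P - P')"
proof -
  have "transpose F ** (P - P') + (P - P') ** F + (M - N) =
      (transpose F ** P + P ** F + M) - (transpose F ** P' + P' ** F + N)"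
    by (simp add: matrix_mul_diff_left matrix_mul_diff_right)
  also have "\<dots> = 0" using assms by (simp add: lyap_def)
  finally show ?thesis using assms by (simp only: lyap_def symmetric_matrix_def transpose_diff)
qed

lemma quad_le_norm: "x \<bullet> ((M::real^'n^'n) *v x) \<le> norm M * (x \<bullet> x)"
proof -
  have "x \<bullet> (M *v x) \<le> norm x * norm (M *v x)" by (rule norm_cauchy_schwarz)
  also have "\<dots> \<le> norm x * (norm M * norm x)" by (intro mult_left_mono norm_matrix_vector_le) auto
  finally show ?thesis by (simp add: dot_square_norm power2_eq_square mult.left_commute)
qed

lemma solution_tendsto_zero:
  fixes F :: "real^'n^'n"
  assumes F: "lyap_stable F" and P: "lyap F (mat 1) P"
    and x: "\<And>t. 0 \<le> t \<Longrightarrow> (x has_vector_derivative F *v x t) (at t within {0..})"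
  shows "((\<lambda>t. x t \<bullet> (P *v x t)) \<longlongrightarrow> 0) at_top"
proof -
  let ?V = "\<lambda>t. x t \<bullet> (P *v x t)"
  \<comment> \<open>The rate at which V = x . P x decays: V' = - x . x, and c V \<le> x . x, so V
    exp(c t) does not increase. The added 1 covers norm P = 0.\<close>
  define c where "c = inverse (norm P + 1)"
  have "0 < norm P + 1" by (simp add: add_nonneg_pos)
  then have c: "0 < c" "c * norm P \<le> 1" by (auto simp: c_def field_simps)
  have V0: "0 \<le> ?V t" for t using lyap_pos_semidef[OF F P pos_def_semidef[OF pos_def_mat_1]] by (auto simp: pos_semidef_def)
  have dV: "(?V has_real_derivative - (x t \<bullet> x t)) (at t within {0..})" if "0 \<le> t" for t
    using has_real_derivative_quadratic[OF P x[OF that]] by simp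
  have decay: "?V t * exp (c * t) \<le> ?V 0" if t: "0 \<le> t" for t
  proof -
    have dW: "((\<lambda>t. ?V t * exp (c * t)) has_real_derivative
        (- (x t \<bullet> x t) * exp (c * t) + (exp (c * t) * c) * ?V t)) (at t within {0..})" if "0 \<le> t" for t
      by (rule derivative_eq_intros dV[OF that] refl)+ simp
    have "?V t * exp (c * t) \<le> ?V 0 * exp (c * 0)"
    proof (rule DERIV_nonpos_imp_decreasing_open[OF t])
      fix s assume s: "0 < s" "s < t"
      have "at s within {0..} = at s" using s by (intro at_within_interior) simp
      then have "((\<lambda>t. ?V t * exp (c * t)) has_real_derivative
        (- (x s \<bullet> x s) * exp (c * s) + (exp (c * s) * c) * ?V s)) (at s)" using dW[of s] s by simp
      moreover have "- (x s \<bullet> x s) * exp (c * s) + (exp (c * s) * c) * ?V s \<le> 0"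
      proof -
        have "c * ?V s \<le> c * (norm P * (x s \<bullet> x s))" using c by (intro mult_left_mono quad_le_norm) auto
        also have "\<dots> = (c * norm P) * (x s \<bullet> x s)" by (simp add: mult.assoc)
        also have "\<dots> \<le> 1 * (x s \<bullet> x s)" by (intro mult_right_mono c) auto
        finally have "exp (c * s) * (c * ?V s) \<le> exp (c * s) * (x s \<bullet> x s)" by (intro mult_left_mono) auto
        then show ?thesis by (simp add: algebra_simps)
      qed
      ultimately show "\<exists>y. ((\<lambda>t. ?V t * exp (c * t)) has_real_derivative y) (at s) \<and> y \<le> 0" by blast
    next
      have "continuous_on {0..} (\<lambda>t. ?V t * exp (c * t))"
        by (rule DERIV_continuous_on[OF dW]) simp
      then show "continuous_on {0..t} (\<lambda>t. ?V t * exp (c * t))" by (rule continuous_on_subset) auto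
    qed
    then show ?thesis by simp
  qed
  have lim: "((\<lambda>t. ?V 0 * exp (- (c * t))) \<longlongrightarrow> 0) at_top"
    by (intro tendsto_mult_right_zero filterlim_compose[OF exp_at_bot] iffD1[OF filterlim_uminus_at_top]
      filterlim_tendsto_pos_mult_at_top[OF tendsto_const c(1) filterlim_ident])
  have le: "\<forall>\<^sub>F t in at_top. ?V t \<le> ?V 0 * exp (- (c * t))"
    using eventually_ge_at_top[of 0]
  proof eventually_elim
    case (elim t)
    then show ?case using decay[OF elim] by (simp add: exp_minus field_simps)
  qed
  show ?thesis
    by (rule tendsto_sandwich[OF always_eventually le tendsto_const lim]) (use V0 in blast)
qed

text \<open>The integrand is minus the derivative of V = x . P x, so the integral is V(0) minus the
  limit of V. The limit is 0 because comparison bounds \<open>P\<close> by norm M times the solution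
  for the identity, along which decay is known.\<close>

lemma integral_quadratic_cost:
  fixes F :: "real^'n^'n"
  assumes F: "lyap_stable F" and P: "lyap F M P" and M: "pos_semidef M"
    and x: "\<And>t. 0 \<le> t \<Longrightarrow> (x has_vector_derivative F *v x t) (at t within {0..})"
  shows "(LINT t:{0..}|lborel. x t \<bullet> (M *v x t)) = x 0 \<bullet> (P *v x 0)"
proof -
  let ?V = "\<lambda>t. x t \<bullet> (P *v x t)" and ?f = "\<lambda>t. x t \<bullet> (M *v x t)"
  have dV: "(?V has_real_derivative - ?f t) (at t within {0..})" if "0 \<le> t" for t
    by (rule has_real_derivative_quadratic[OF P x[OF that]])
  have V0: "0 \<le> ?V t" for t using lyap_pos_semidef[OF F P M] by (auto simp: pos_semidef_def)
  obtain P1 where P1: "lyap F (mat 1) P1" using lyap_exists[OF F] pos_def_mat_1 by (auto simp: pos_def_def)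
  let ?V1 = "\<lambda>t. x t \<bullet> (P1 *v x t)"
  have "pos_semidef (norm M *\<^sub>R P1 - P)"
  proof (rule lyap_pos_semidef[OF F lyap_diff[OF lyap_scaleR[OF P1] P]])
    have "0 \<le> y \<bullet> ((norm M *\<^sub>R mat 1 - M) *v y)" for y
      using quad_le_norm[of y M] by (simp add: matrix_vector_mult_diff_rdistrib inner_diff_right flip: scaleR_matrix_vector_assoc)
    moreover have "symmetric_matrix (norm M *\<^sub>R mat 1 - M)"
      using M by (simp add: pos_semidef_def symmetric_matrix_def transpose_diff transpose_scaleR)
    ultimately show "pos_semidef (norm M *\<^sub>R mat 1 - M)" by (simp add: pos_semidef_def)
  qed
  then have V1: "?V t \<le> norm M * ?V1 t" for t
    by (simp add: pos_semidef_def matrix_vector_mult_diff_rdistrib inner_diff_right flip: scaleR_matrix_vector_assoc)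
  have "((\<lambda>t. norm M * ?V1 t) \<longlongrightarrow> norm M * 0) at_top"
    by (intro tendsto_mult_left solution_tendsto_zero[OF F P1 x])
  then have Vlim: "(?V \<longlongrightarrow> 0) at_top"
    using tendsto_sandwich[OF always_eventually always_eventually tendsto_const, of 0 ?V "\<lambda>t. norm M * ?V1 t"] V0 V1
    by simp
  have "continuous_on {0..} ?V" by (rule DERIV_continuous_on[OF dV]) simp
  then have "(?V \<longlongrightarrow> ?V 0) (at 0 within {0..})" unfolding continuous_on_def by auto
  then have Vright: "(?V \<longlongrightarrow> ?V 0) (at_right 0)" by (rule tendsto_within_subset) auto
  have at: "at t within {0..} = at t" if "0 < t" for t :: real using that by (intro at_within_interior) simp
  have xc: "isCont x t" if "0 < t" for t
    using has_vector_derivative_continuous[OF x[of t]] that at[OF that] by simp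
  have "(LBINT t=ereal 0..\<infinity>. ?f t) = 0 - (- ?V 0)"
  proof (rule interval_integral_FTC_nonneg(2)[where F = "\<lambda>t. - ?V t"])
    fix t assume "ereal 0 < ereal t"
    then have t: "0 < t" by simp
    show "((\<lambda>t. - ?V t) has_real_derivative ?f t) (at t)"
      using DERIV_minus[OF dV[of t]] at[OF t] t by simp
    show "isCont ?f t" by (intro continuous_intros xc[OF t] bounded_linear.isCont[OF matrix_vector_mul_bounded_linear])
  next
    have "((\<lambda>t. - ?V t) \<longlongrightarrow> - ?V 0) (at_right 0)" by (intro tendsto_intros Vright)
    then show "(((\<lambda>t. - ?V t) \<circ> real_of_ereal) \<longlongrightarrow> - ?V 0) (at_right (ereal 0))"
      by (simp add: ereal_tendsto_simps)
    have "((\<lambda>t. - ?V t) \<longlongrightarrow> - 0) at_top" by (intro tendsto_minus Vlim)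
    then show "(((\<lambda>t. - ?V t) \<circ> real_of_ereal) \<longlongrightarrow> 0) (at_left \<infinity>)"
      by (simp add: ereal_tendsto_simps)
  qed (use M in \<open>auto simp: pos_semidef_def\<close>)
  then have "(LINT t:{0<..}|lborel. ?f t) = ?V 0" by (simp add: interval_integral_to_infinity_eq)
  \<comment> \<open>The fundamental theorem is applied on the open half-line; the endpoint is a null
    set.\<close>
  moreover have "(LINT t:{0<..}|lborel. ?f t) = (LINT t:{0..}|lborel. ?f t)"
  proof (rule set_integral_cong_set)
    show "AE t in lborel. (t \<in> {0..}) = (t \<in> {0::real<..})"
      using AE_lborel_singleton[of 0] by eventually_elim auto
    have "continuous_on {0..} x" unfolding continuous_on_eq_continuous_within
      using has_vector_derivative_continuous[OF x] by auto
    then have c: "continuous_on {0..} ?f"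
      by (intro continuous_on_inner bounded_linear.continuous_on[OF matrix_vector_mul_bounded_linear])
    show "set_borel_measurable lborel {0..} ?f"
      using borel_measurable_continuous_on_indicator[OF _ c] unfolding set_borel_measurable_def by simp
    show "set_borel_measurable lborel {0<..} ?f"
      using borel_measurable_continuous_on_indicator[OF _ continuous_on_subset[OF c], of "{0<..}"]
      unfolding set_borel_measurable_def by (simp add: subset_eq)
  qed
  ultimately show ?thesis by simp
qed

definition cost_matrix :: "real^'n^'n \<Rightarrow> real^'n^'n \<Rightarrow> real^'n^'n \<Rightarrow> real^'n^'n" where
  "cost_matrix Q R K = Q + transpose K ** R ** K"

lemma quad_cost_matrix: "x \<bullet> (cost_matrix Q R K *v x) = x \<bullet> (Q *v x) + (K *v x) \<bullet> (R *v (K *v x))"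
  using inner_transpose[of K "R *v (K *v x)" x]
  by (simp add: cost_matrix_def matrix_vector_mult_add_rdistrib inner_add_right inner_commute
    flip: matrix_vector_mul_assoc del: transpose_matrix_vector)

lemma pos_semidef_cost_matrix:
  assumes "pos_semidef Q" "pos_semidef R"
  shows "pos_semidef (cost_matrix Q R K)"
proof -
  have "symmetric_matrix (cost_matrix Q R K)"
    using assms by (simp add: cost_matrix_def pos_semidef_def symmetric_matrix_def transpose_add
      matrix_transpose_mul matrix_mul_assoc)
  then show ?thesis using assms by (simp add: pos_semidef_def quad_cost_matrix)
qed

text \<open>The cost formula holds for every solution of the initial value problem, so existence
  alone is enough to evaluate it on the chosen \<open>trajectory\<close>.\<close>

lemma pathwise_cost_eq:
  fixes A B Q R K :: "real^'n^'n"
  assumes F: "lyap_stable (damped A \<alpha> + B ** K)" and Q: "pos_semidef Q" and R: "pos_semidef R"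
    and P: "lyap (damped A \<alpha> + B ** K) (cost_matrix Q R K) P"
  shows "pathwise_cost A B Q R \<alpha> K \<xi> = \<xi> \<bullet> (P *v \<xi>)"
proof -
  let ?F = "damped A \<alpha> + B ** K" and ?x = "trajectory A B \<alpha> K \<xi>"
  have e: "damped A \<alpha> *v y + B *v (K *v y) = ?F *v y" for y
    by (simp add: matrix_vector_mult_add_rdistrib matrix_vector_mul_assoc)
  have "\<exists>x. x 0 = \<xi> \<and> (\<forall>t\<ge>0. (x has_vector_derivative (damped A \<alpha> *v x t + B *v (K *v x t))) (at t within {0..}))"
    unfolding e using linear_ode_solution[of \<xi> ?F "{0..}"] by blast
  from someI_ex[OF this, folded trajectory_def]
  have x: "?x 0 = \<xi>" "\<And>t. 0 \<le> t \<Longrightarrow> (?x has_vector_derivative ?F *v ?x t) (at t within {0..})"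
    unfolding e by auto
  show ?thesis
    using integral_quadratic_cost[OF F P pos_semidef_cost_matrix[OF Q R] x(2)] x(1)
    by (simp add: pathwise_cost_def Let_def quad_cost_matrix)
qed

text \<open>The entrywise inner product \<open>P \<bullet> D\<^sub>0\<close> equals the trace of the
  product of \<open>D\<^sub>0\<close> and \<open>P\<close>, as \<open>P\<close> is
  symmetric.\<close>

lemma expected_cost_eq:
  fixes A B Q R K D\<^sub>0 :: "real^'n^'n"
  assumes F: "lyap_stable (damped A \<alpha> + B ** K)" and Q: "pos_semidef Q" and R: "pos_semidef R"
    and P: "lyap (damped A \<alpha> + B ** K) (cost_matrix Q R K) P"
    and x0: "random_initial_state M x\<^sub>0 D\<^sub>0"
  shows "expected_cost M x\<^sub>0 A B Q R K \<alpha> = P \<bullet> D\<^sub>0"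
proof -
  have i: "integrable M (\<lambda>\<omega>. x\<^sub>0 \<omega> $ i * x\<^sub>0 \<omega> $ j)" "integral\<^sup>L M (\<lambda>\<omega>. x\<^sub>0 \<omega> $ i * x\<^sub>0 \<omega> $ j) = D\<^sub>0 $ i $ j" for i j
    using x0 by (auto simp: random_initial_state_def)
  have "expected_cost M x\<^sub>0 A B Q R K \<alpha> = integral\<^sup>L M (\<lambda>\<omega>. \<Sum>i\<in>UNIV. \<Sum>j\<in>UNIV. P $ i $ j * (x\<^sub>0 \<omega> $ i * x\<^sub>0 \<omega> $ j))"
    unfolding expected_cost_def pathwise_cost_eq[OF F Q R P]
    by (simp add: inner_vec_def matrix_vector_mult_def sum_distrib_left algebra_simps)
  also have "\<dots> = (\<Sum>i\<in>UNIV. \<Sum>j\<in>UNIV. P $ i $ j * D\<^sub>0 $ i $ j)"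
    using i by simp
  also have "\<dots> = P \<bullet> D\<^sub>0" by (simp add: inner_vec_def)
  finally show ?thesis .
qed

section \<open>Bounds and convexity of the cost\<close>

lemma norm_transpose: "norm (transpose (A::real^'n^'m)) = norm A"
proof -
  have "transpose A \<bullet> transpose A = A \<bullet> A"
    by (simp add: inner_vec_def transpose_def) (rule sum.swap)
  then show ?thesis by (simp add: norm_eq_sqrt_inner)
qed

text \<open>The norm of a matrix is the Frobenius norm here, so the estimate is made row by
  row.\<close>

lemma norm_matrix_mul_le: "norm ((A::real^'n^'m) ** (B::real^'k^'n)) \<le> norm A * norm B"
proof -
  have row: "(A ** B) $ i = transpose B *v (A $ i)" for i
    by (simp add: vec_eq_iff matrix_matrix_mult_def matrix_vector_mult_def transpose_def mult.commute del: transpose_matrix_vector)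
  have "norm (A ** B) \<le> L2_set (\<lambda>i. norm (A $ i) * norm B) UNIV"
    unfolding norm_vec_def[of "A ** B"] row
  proof (intro L2_set_mono)
    fix i
    show "norm (transpose B *v (A $ i)) \<le> norm (A $ i) * norm B"
      using norm_matrix_vector_le[of "transpose B" "A $ i"] by (simp add: norm_transpose mult.commute del: transpose_matrix_vector)
  qed simp
  also have "\<dots> = norm A * norm B" by (simp add: norm_vec_def[of A] L2_set_left_distrib)
  finally show ?thesis .
qed

lemma norm_matrix_mul_mono: "norm A \<le> a \<Longrightarrow> norm B \<le> b \<Longrightarrow> norm ((A::real^'n^'m) ** (B::real^'k^'n)) \<le> a * b"
  by (rule order_trans[OF norm_matrix_mul_le]) (intro mult_mono, auto intro: order_trans[OF norm_ge_zero])

lemma pos_def_lower_bound: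
  fixes R :: "real^'n^'n"
  assumes "pos_def R"
  obtains \<rho> where "0 < \<rho>" "\<And>y. \<rho> * (y \<bullet> y) \<le> y \<bullet> (R *v y)"
proof -
  let ?q = "\<lambda>x. x \<bullet> (R *v x)"
  have "continuous_on (sphere 0 1) ?q" by (intro continuous_intros)
  from continuous_attains_inf[OF compact_sphere sphere_nonempty this]
  obtain u where u: "u \<in> sphere 0 1" "\<forall>x\<in>sphere 0 1. ?q u \<le> ?q x" by blast
  have "norm u = 1" using u(1) by simp
  then have "u \<noteq> 0" by force
  show ?thesis
  proof (rule that[of "?q u"])
    show "0 < ?q u" using assms \<open>u \<noteq> 0\<close> by (simp add: pos_def_def)
    fix y :: "real^'n"
    show "?q u * (y \<bullet> y) \<le> ?q y"
    proof (cases "y = 0")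
      case False
      then obtain w r where w: "norm w = 1" "0 < r" "y = r *\<^sub>R w" by (rule unit_vector_scale)
      have "w \<bullet> w = 1" using w(1) by (simp add: dot_square_norm)
      moreover have "?q u \<le> ?q w" using bspec[OF u(2), of w] w(1) by simp
      ultimately show ?thesis using w(2) by (simp add: w(3) matrix_vector_mult_scaleR)
    qed simp
  qed
qed

lemma norm_square_columns: "(norm (K::real^'n^'m))\<^sup>2 = (\<Sum>i\<in>UNIV. (K *v axis i 1) \<bullet> (K *v axis i 1))"
proof -
  have "(norm K)\<^sup>2 = transpose K \<bullet> transpose K" by (simp add: dot_square_norm norm_transpose)
  also have "\<dots> = (\<Sum>i\<in>UNIV. (transpose K $ i) \<bullet> (transpose K $ i))" by (simp add: inner_vec_def[of "transpose K"])
  moreover have "transpose K $ i = K *v axis i 1" for i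
    by (simp add: vec_eq_iff transpose_def matrix_vector_mult_basis column_def)
  ultimately show ?thesis by simp
qed

text \<open>The squared Frobenius norm sums the squared lengths of the columns K e_i, each at most C
  / \<rho>; hence the factor \<open>CARD('n)\<close>.\<close>

lemma quad_gain_bound:
  fixes K R :: "real^'n^'n"
  assumes \<rho>: "0 < \<rho>" "\<And>y. \<rho> * (y \<bullet> y) \<le> y \<bullet> (R *v y)"
    and C: "\<And>x. (K *v x) \<bullet> (R *v (K *v x)) \<le> C * (x \<bullet> x)"
  shows "\<rho> * (norm K)\<^sup>2 \<le> real CARD('n) * C"
proof -
  have "\<rho> * (norm K)\<^sup>2 = (\<Sum>i\<in>UNIV. \<rho> * ((K *v axis i 1) \<bullet> (K *v axis i 1)))"
    by (simp add: norm_square_columns sum_distrib_left)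
  also have "\<dots> \<le> (\<Sum>i\<in>(UNIV::'n set). C)"
  proof (rule sum_mono)
    fix i :: 'n
    have "axis i (1::real) \<bullet> axis i 1 = 1" by (simp add: inner_axis_axis)
    then show "\<rho> * ((K *v axis i 1) \<bullet> (K *v axis i 1)) \<le> C"
      using \<rho>(2)[of "K *v axis i 1"] C[of "axis i 1"] by simp
  qed
  finally show ?thesis by simp
qed

lemma damped_mult: "damped A \<alpha> + B ** K = (A + B ** K) - \<alpha> *\<^sub>R mat 1"
  by (simp add: damped_def)

lemma lyap_eq: "lyap F M P \<Longrightarrow> M = - (transpose F ** P + P ** F)"
  unfolding lyap_def using minus_unique by metis

lemma lyap_norm_rhs:
  assumes "lyap F M P"
  shows "norm M \<le> 2 * norm F * norm P"
proof -
  have "norm M \<le> norm (transpose F ** P) + norm (P ** F)"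
    unfolding lyap_eq[OF assms] norm_minus_cancel by (rule norm_triangle_ineq)
  also have "\<dots> \<le> norm F * norm P + norm P * norm F"
    by (intro add_mono norm_matrix_mul_mono) (auto simp: norm_transpose)
  finally show ?thesis by simp
qed

text \<open>The damping contributes 2 \<alpha> P and the undamped part at most \<alpha> * norm P, so
  half of the damping survives. Solutions are thus smaller than their right-hand sides by a factor
  \<alpha>.\<close>

lemma lyap_norm_bound:
  assumes P: "lyap (G - \<alpha> *\<^sub>R mat 1) M P" and G: "norm G \<le> \<alpha> / 2"
  shows "\<alpha> * norm P \<le> norm M"
proof -
  have "M - (2 * \<alpha>) *\<^sub>R P = - (transpose G ** P + P ** G)"
    using P unfolding lyap_shift by (rule lyap_eq)
  then have "(2 * \<alpha>) *\<^sub>R P = M + (transpose G ** P + P ** G)" by (simp add: algebra_simps)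
  then have "norm ((2 * \<alpha>) *\<^sub>R P) \<le> norm M + (norm (transpose G ** P) + norm (P ** G))"
    by (metis norm_triangle_ineq norm_triangle_le add_left_mono)
  also have "\<dots> \<le> norm M + (\<alpha> / 2 * norm P + norm P * (\<alpha> / 2))"
    using G by (intro add_mono norm_matrix_mul_mono) (auto simp: norm_transpose)
  finally have "\<bar>2 * \<alpha>\<bar> * norm P \<le> norm M + \<alpha> * norm P" by simp
  moreover have "0 \<le> \<alpha>" using G norm_ge_zero[of G] by linarith
  ultimately show ?thesis by simp
qed

text \<open>Pairing the two real eigenvalue equations with \<open>a\<close> and \<open>b\<close> and
  adding cancels the \<omega> terms, which bounds \<sigma> + \<alpha> by norm G.\<close>

lemma stable_of_norm:
  assumes "norm (G::real^'n^'n) < \<alpha>"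
  shows "stable (G - \<alpha> *\<^sub>R mat 1)"
  unfolding stable_iff shift_mult
proof (intro allI impI)
  fix \<sigma> \<omega> and a b :: "real^'n"
  assume "G *v a - \<alpha> *\<^sub>R a = \<sigma> *\<^sub>R a - \<omega> *\<^sub>R b" "G *v b - \<alpha> *\<^sub>R b = \<sigma> *\<^sub>R b + \<omega> *\<^sub>R a"
  then have e: "G *v a = (\<sigma> + \<alpha>) *\<^sub>R a - \<omega> *\<^sub>R b" "G *v b = (\<sigma> + \<alpha>) *\<^sub>R b + \<omega> *\<^sub>R a" by (simp_all add: algebra_simps)
  have "(\<sigma> + \<alpha>) * (a \<bullet> a + b \<bullet> b) = a \<bullet> (G *v a) + b \<bullet> (G *v b)"
    unfolding e by (simp add: inner_diff_right inner_add_right inner_commute algebra_simps)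
  also have "\<dots> \<le> norm G * (a \<bullet> a + b \<bullet> b)" using quad_le_norm[of a G] quad_le_norm[of b G] by (simp add: distrib_left)
  finally have le: "(\<sigma> + \<alpha>) * (a \<bullet> a + b \<bullet> b) \<le> norm G * (a \<bullet> a + b \<bullet> b)" .
  show "a = 0 \<and> b = 0 \<or> \<sigma> < 0"
  proof (cases "a = 0 \<and> b = 0")
    case False
    then have "0 < a \<bullet> a + b \<bullet> b" by (metis add_pos_nonneg add_nonneg_pos inner_ge_zero inner_gt_zero_iff)
    then have "\<sigma> + \<alpha> \<le> norm G" using le by simp
    then show ?thesis using assms by linarith
  qed simp
qed

text \<open>A bound on the cost bounds \<open>P\<close>, hence \<open>transpose K ** R ** K\<close> by a multiple of \<open>norm F\<close>, which is only
  linear in \<open>norm K\<close>.\<close>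
lemma gain_bound_of_cost:
  fixes A B Q R :: "real^'n^'n"
  assumes Q: "pos_semidef Q" and R: "pos_def R"
  obtains c where "0 < c" "\<And>\<alpha> K P. 1 \<le> \<alpha> \<Longrightarrow> lyap (damped A \<alpha> + B ** K) (cost_matrix Q R K) P \<Longrightarrow> norm P \<le> p
    \<Longrightarrow> norm K \<le> c * sqrt \<alpha>"
proof -
  obtain \<rho> where \<rho>: "0 < \<rho>" "\<And>y. \<rho> * (y \<bullet> y) \<le> y \<bullet> (R *v y)" using pos_def_lower_bound[OF R] by blast
  define m where "m = norm A + norm (mat 1 :: real^'n^'n) + norm B"
  have m0: "0 \<le> m" by (simp add: m_def)
  \<comment> \<open>Chosen so that the bound m (\<alpha> + norm K) on the closed loop, the Lyapunov
    bound on the cost matrix and the column estimate combine to norm K squared \<le> a (\<alpha> +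
    norm K).\<close>
  define a where "a = real CARD('n) * (2 * \<bar>p\<bar> * m) / \<rho>"
  have a0: "0 \<le> a" using m0 \<rho>(1) by (simp add: a_def)
  have main: "norm K \<le> sqrt (2 * a + a\<^sup>2 + 1) * sqrt \<alpha>"
    if \<alpha>: "1 \<le> \<alpha>" and P: "lyap (damped A \<alpha> + B ** K) (cost_matrix Q R K) P" and p: "norm P \<le> p" for \<alpha> K P
  proof -
    let ?F = "damped A \<alpha> + B ** K"
    have "norm ?F \<le> norm A + norm (\<alpha> *\<^sub>R mat 1 :: real^'n^'n) + norm (B ** K)"
      unfolding damped_def by (rule order_trans[OF norm_triangle_ineq]) (intro add_right_mono norm_triangle_ineq4)
    also have "\<dots> \<le> norm A + \<alpha> * norm (mat 1 :: real^'n^'n) + norm B * norm K"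
      using \<alpha> norm_matrix_mul_le[of B K] by simp
    also have "\<dots> \<le> m * (\<alpha> + norm K)"
    proof -
      have "norm A * 1 \<le> norm A * (\<alpha> + norm K)" using \<alpha> by (intro mult_left_mono add_increasing2) auto
      moreover have "norm (mat 1 :: real^'n^'n) * \<alpha> \<le> norm (mat 1 :: real^'n^'n) * (\<alpha> + norm K)" by (intro mult_left_mono) auto
      moreover have "norm B * norm K \<le> norm B * (\<alpha> + norm K)" using \<alpha> by (intro mult_left_mono) auto
      ultimately show ?thesis unfolding m_def distrib_right by (simp only: mult.commute[of \<alpha>] mult_1_right)
    qed
    finally have nF: "norm ?F \<le> m * (\<alpha> + norm K)" .
    have "(K *v x) \<bullet> (R *v (K *v x)) \<le> (2 * \<bar>p\<bar> * (m * (\<alpha> + norm K))) * (x \<bullet> x)" for x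
    proof -
      have "(K *v x) \<bullet> (R *v (K *v x)) \<le> x \<bullet> (cost_matrix Q R K *v x)"
        using Q by (simp add: quad_cost_matrix pos_semidef_def)
      also have "\<dots> \<le> norm (cost_matrix Q R K) * (x \<bullet> x)" by (rule quad_le_norm)
      also have "\<dots> \<le> (2 * norm ?F * norm P) * (x \<bullet> x)" by (intro mult_right_mono lyap_norm_rhs P) auto
      also have "\<dots> \<le> (2 * (m * (\<alpha> + norm K)) * \<bar>p\<bar>) * (x \<bullet> x)"
        using nF p m0 \<alpha> by (intro mult_right_mono mult_mono) auto
      finally show ?thesis by (simp add: algebra_simps)
    qed
    from quad_gain_bound[OF \<rho> this]
    have "\<rho> * (norm K)\<^sup>2 \<le> (\<rho> * a) * (\<alpha> + norm K)" using \<rho>(1) by (simp add: a_def mult.assoc)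
    then have "\<rho> * (norm K)\<^sup>2 \<le> \<rho> * (a * (\<alpha> + norm K))" by (simp only: mult.assoc)
    then have "(norm K)\<^sup>2 \<le> a * (\<alpha> + norm K)" using \<rho>(1) by simp
    then have "(norm K)\<^sup>2 \<le> a * \<alpha> + a * norm K" by (simp only: distrib_left)
    \<comment> \<open>This square absorbs the linear term: 2 a norm K is at most norm K squared plus
      a squared.\<close>
    moreover have "0 \<le> (norm K - a)\<^sup>2" by simp
    ultimately have "(norm K)\<^sup>2 \<le> 2 * a * \<alpha> + a\<^sup>2" by (simp add: power2_diff algebra_simps)
    also have "\<dots> \<le> (2 * a + a\<^sup>2 + 1) * \<alpha>"
    proof -
      have "a\<^sup>2 * 1 \<le> a\<^sup>2 * \<alpha>" using \<alpha> by (intro mult_left_mono) auto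
      then show ?thesis using \<alpha> by (simp add: algebra_simps)
    qed
    finally show ?thesis by (simp add: real_le_rsqrt flip: real_sqrt_mult)
  qed
  moreover have "0 < sqrt (2 * a + a\<^sup>2 + 1)" using a0 by (simp add: add_nonneg_pos)
  ultimately show ?thesis using that by blast
qed

lemma cost_matrix_diff:
  "cost_matrix Q R K1 - cost_matrix Q R K0 =
    transpose (K1 - K0) ** R ** K1 + transpose K0 ** R ** (K1 - K0)"
  by (simp add: cost_matrix_def transpose_diff matrix_mul_diff_left matrix_mul_diff_right)

text \<open>With \<open>Z = K1 - K0\<close>, substituting \<open>(1 - t) P0 + t P1\<close> into the equation for the gain \<open>K0 + t Z\<close> leaves a residual
  proportional to \<open>t (1 - t)\<close>.\<close>
lemma lyap_interpolation:
  fixes A B Q R :: "real^'n^'n"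
  assumes P0: "lyap (A + B ** K0) (cost_matrix Q R K0) P0"
    and P1: "lyap (A + B ** (K0 + Z)) (cost_matrix Q R (K0 + Z)) P1"
    and Pt: "lyap (A + B ** (K0 + t *\<^sub>R Z)) (cost_matrix Q R (K0 + t *\<^sub>R Z)) Pt"
  defines "W \<equiv> transpose Z ** R ** Z + (P1 - P0) ** (B ** Z) + transpose (B ** Z) ** (P1 - P0)"
  shows "lyap (A + B ** (K0 + t *\<^sub>R Z)) ((t * (1 - t)) *\<^sub>R W) (((1 - t) *\<^sub>R P0 + t *\<^sub>R P1) - Pt)"
proof -
  define F where "F = A + B ** K0"
  define Y where "Y = B ** Z"
  define T where "T = transpose Z ** R ** Z"
  define N where "N = transpose Z ** R ** K0 + transpose K0 ** R ** Z"
  define M where "M = cost_matrix Q R K0"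
  have F1: "A + B ** (K0 + Z) = F + Y" and Ft: "A + B ** (K0 + t *\<^sub>R Z) = F + t *\<^sub>R Y"
    by (simp_all add: F_def Y_def matrix_mul_add_right matrix_mul_scaleR_right)
  have Mt: "cost_matrix Q R (K0 + s *\<^sub>R Z) = M + s *\<^sub>R N + (s * s) *\<^sub>R T" for s
    by (simp add: M_def N_def T_def cost_matrix_def transpose_add transpose_scaleR matrix_mul_add_left
      matrix_mul_add_right matrix_mul_scaleR_left matrix_mul_scaleR_right scaleR_add_right algebra_simps)
  have M1: "cost_matrix Q R (K0 + Z) = M + N + T" using Mt[of 1] by simp
  have e0: "transpose F ** P0 + P0 ** F + M = 0" using P0 by (simp add: lyap_def F_def M_def)
  have e1: "transpose F ** P1 + transpose Y ** P1 + (P1 ** F + P1 ** Y) + (M + N + T) = 0"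
    using P1 unfolding F1 M1 by (simp add: lyap_def transpose_add matrix_mul_add_left matrix_mul_add_right)
  have et: "transpose (F + t *\<^sub>R Y) ** Pt + Pt ** (F + t *\<^sub>R Y) + (M + t *\<^sub>R N + (t * t) *\<^sub>R T) = 0"
    using Pt unfolding Ft Mt by (simp add: lyap_def)
  let ?X = "(1 - t) *\<^sub>R P0 + t *\<^sub>R P1"
  have "transpose (F + t *\<^sub>R Y) ** ?X + ?X ** (F + t *\<^sub>R Y) + (M + t *\<^sub>R N + (t * t) *\<^sub>R T) + (t * (1 - t)) *\<^sub>R W
    = (1 - t) *\<^sub>R (transpose F ** P0 + P0 ** F + M)
      + t *\<^sub>R (transpose F ** P1 + transpose Y ** P1 + (P1 ** F + P1 ** Y) + (M + N + T))"
    unfolding W_def Y_def[symmetric] T_def[symmetric]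
    by (simp add: transpose_add transpose_scaleR matrix_mul_bilinear algebra_simps)
  also have "\<dots> = 0" unfolding e0 e1 by simp
  finally have eX: "transpose (F + t *\<^sub>R Y) ** ?X + ?X ** (F + t *\<^sub>R Y) + (M + t *\<^sub>R N + (t * t) *\<^sub>R T) + (t * (1 - t)) *\<^sub>R W = 0" .
  have rearrange: "(a - p) + (b - q) + w = (a + b + m + w) - (p + q + m)" for a b p q m w :: "real^'n^'n" by simp
  have "transpose (F + t *\<^sub>R Y) ** (?X - Pt) + (?X - Pt) ** (F + t *\<^sub>R Y) + (t * (1 - t)) *\<^sub>R W
    = (transpose (F + t *\<^sub>R Y) ** ?X + ?X ** (F + t *\<^sub>R Y) + (M + t *\<^sub>R N + (t * t) *\<^sub>R T) + (t * (1 - t)) *\<^sub>R W)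
      - (transpose (F + t *\<^sub>R Y) ** Pt + Pt ** (F + t *\<^sub>R Y) + (M + t *\<^sub>R N + (t * t) *\<^sub>R T))"
    unfolding matrix_mul_diff_left matrix_mul_diff_right by (rule rearrange)
  also have "\<dots> = 0" unfolding eX et by simp
  finally have "transpose (F + t *\<^sub>R Y) ** (?X - Pt) + (?X - Pt) ** (F + t *\<^sub>R Y) + (t * (1 - t)) *\<^sub>R W = 0" .
  moreover have "symmetric_matrix (?X - Pt)"
    using P0 P1 Pt by (simp add: lyap_def symmetric_matrix_def transpose_linear)
  ultimately show ?thesis unfolding Ft lyap_def by blast
qed

lemma lyap_add:
  assumes "lyap F M P" "lyap F N P'"
  shows "lyap F (M + N) (P + P')"
proof -
  have "lyap F (-1 *\<^sub>R N) (-1 *\<^sub>R P')" by (rule lyap_scaleR[OF assms(2)])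
  from lyap_diff[OF assms(1) this] show ?thesis by simp
qed

text \<open>Such gains contribute only order sqrt \<alpha>, and the threshold (2 m + 1) squared
  makes m sqrt \<alpha> at most \<alpha> / 2, the margin that \<open>lyap_norm_bound\<close> asks
  for.\<close>

lemma closed_loop_norm_bound:
  fixes A B :: "real^'n^'n"
  assumes c: "0 \<le> c"
  shows "\<exists>a\<ge>1. \<forall>\<alpha>\<ge>a. \<forall>K. norm K \<le> c * sqrt \<alpha> \<longrightarrow> norm (A + B ** K) \<le> \<alpha> / 2"
proof -
  define m where "m = norm A + norm B * c"
  have m0: "0 \<le> m" using c by (simp add: m_def)
  have "norm (A + B ** K) \<le> \<alpha> / 2" if \<alpha>: "(2 * m + 1)\<^sup>2 \<le> \<alpha>" and K: "norm K \<le> c * sqrt \<alpha>" for \<alpha> K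
  proof -
    have s: "2 * m + 1 \<le> sqrt \<alpha>" using \<alpha> by (rule real_le_rsqrt)
    then have s1: "1 \<le> sqrt \<alpha>" using m0 by linarith
    have "norm (A + B ** K) \<le> norm A + norm B * (c * sqrt \<alpha>)"
      by (rule order_trans[OF norm_triangle_ineq]) (intro add_left_mono norm_matrix_mul_mono K order_refl)
    also have "\<dots> \<le> norm A * sqrt \<alpha> + norm B * (c * sqrt \<alpha>)"
      using mult_left_mono[OF s1 norm_ge_zero[of A]] by simp
    also have "\<dots> = m * sqrt \<alpha>" by (simp add: m_def algebra_simps)
    also have "\<dots> \<le> (sqrt \<alpha> / 2) * sqrt \<alpha>"
    proof (rule mult_right_mono)
      show "m \<le> sqrt \<alpha> / 2" using s by linarith
      show "0 \<le> sqrt \<alpha>" using s1 by linarith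
    qed
    also have "\<dots> = \<alpha> / 2" using order_trans[OF zero_le_power2 \<alpha>] by simp
    finally show ?thesis .
  qed
  moreover have "1 \<le> (2 * m + 1)\<^sup>2" using m0 by simp
  ultimately show ?thesis by blast
qed

text \<open>The convexity defect is t (1 - t) times the cost of X1 + X2. Here X1 comes from the
  semidefinite term T = Z' R Z and is at least of order norm T / \<alpha>, whereas X2 comes from the
  cross terms with P1 - P0 and is smaller by a factor of order 1 / sqrt \<alpha>. Large \<alpha>
  lets X1 win; \<open>d\<close> measures how strongly the cost sees it.\<close>

lemma cost_convex:
  fixes A B Q R D :: "real^'n^'n"
  assumes R: "pos_def R" and d: "0 < d" and D: "\<And>P. pos_semidef P \<Longrightarrow> d * norm P \<le> P \<bullet> D" and c: "0 \<le> c"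
  shows "\<exists>a. \<forall>\<alpha>\<ge>a. \<forall>K Z. norm K \<le> c * sqrt \<alpha> \<longrightarrow> norm (K + Z) \<le> c * sqrt \<alpha> \<longrightarrow>
    (\<forall>t P0 P1 Pt. 0 \<le> t \<longrightarrow> t \<le> 1 \<longrightarrow>
      lyap (damped A \<alpha> + B ** K) (cost_matrix Q R K) P0 \<longrightarrow>
      lyap (damped A \<alpha> + B ** (K + Z)) (cost_matrix Q R (K + Z)) P1 \<longrightarrow>
      lyap (damped A \<alpha> + B ** (K + t *\<^sub>R Z)) (cost_matrix Q R (K + t *\<^sub>R Z)) Pt \<longrightarrow>
      Pt \<bullet> D \<le> (1 - t) * (P0 \<bullet> D) + t * (P1 \<bullet> D))"
proof -
  obtain a where a: "1 \<le> a" "\<And>\<alpha> K. a \<le> \<alpha> \<Longrightarrow> norm K \<le> c * sqrt \<alpha> \<Longrightarrow> norm (A + B ** K) \<le> \<alpha> / 2"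
    using closed_loop_norm_bound[OF c] by meson
  obtain \<rho> where \<rho>: "0 < \<rho>" "\<And>y. \<rho> * (y \<bullet> y) \<le> y \<bullet> (R *v y)" using pos_def_lower_bound[OF R] by blast
  \<comment> \<open>With s = sqrt \<alpha> the constants mean: norm P0 \<le> p, s * norm \<Delta>
    \<le> n * norm Z, 2 * norm of the closed loop \<le> \<alpha> * \<nu>, and s * norm X2 \<le> k *
    norm X1.\<close>
  define p where "p = norm Q + norm R * c\<^sup>2"
  define n where "n = 2 * norm R * c + 2 * norm B * p"
  define \<nu> where "\<nu> = 1 + 2 * norm (mat 1 :: real^'n^'n)"
  define k where "k = 2 * n * norm B * (real CARD('n) / \<rho>) * \<nu>"
  have nonneg: "0 \<le> p" "0 \<le> n" "0 \<le> \<nu>" using c by (auto simp: p_def n_def \<nu>_def)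
  then have k0: "0 \<le> k" using \<rho>(1) by (simp add: k_def)
  have main: "Pt \<bullet> D \<le> (1 - t) * (P0 \<bullet> D) + t * (P1 \<bullet> D)"
    if \<alpha>: "max a ((norm D * k / d)\<^sup>2) \<le> \<alpha>" and K: "norm K \<le> c * sqrt \<alpha>" "norm (K + Z) \<le> c * sqrt \<alpha>"
      and t: "0 \<le> t" "t \<le> 1"
      and P0: "lyap (damped A \<alpha> + B ** K) (cost_matrix Q R K) P0"
      and P1: "lyap (damped A \<alpha> + B ** (K + Z)) (cost_matrix Q R (K + Z)) P1"
      and Pt: "lyap (damped A \<alpha> + B ** (K + t *\<^sub>R Z)) (cost_matrix Q R (K + t *\<^sub>R Z)) Pt"
    for \<alpha> K Z t P0 P1 Pt
  proof -
    define s where "s = sqrt \<alpha>"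
    have \<alpha>1: "a \<le> \<alpha>" "1 \<le> \<alpha>" using \<alpha> a(1) by auto
    have s: "1 \<le> s" "s * s = \<alpha>" "norm D * k / d \<le> s"
      using \<alpha>1 real_le_rsqrt[of "norm D * k / d" \<alpha>] \<alpha> by (auto simp: s_def)
    have Ks: "norm K \<le> c * s" "norm (K + Z) \<le> c * s" using K by (auto simp: s_def)
    have Kt: "norm (K + t *\<^sub>R Z) \<le> c * sqrt \<alpha>"
    proof -
      have "K + t *\<^sub>R Z = (1 - t) *\<^sub>R K + t *\<^sub>R (K + Z)" by (simp add: algebra_simps)
      also have "norm \<dots> \<le> norm ((1 - t) *\<^sub>R K) + norm (t *\<^sub>R (K + Z))" by (rule norm_triangle_ineq)
      also have "\<dots> \<le> (1 - t) * (c * sqrt \<alpha>) + t * (c * sqrt \<alpha>)"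
        using t K by (simp add: add_mono mult_left_mono)
      finally show ?thesis by (simp add: algebra_simps)
    qed
    let ?F0 = "damped A \<alpha> + B ** K" and ?F1 = "damped A \<alpha> + B ** (K + Z)" and ?Ft = "damped A \<alpha> + B ** (K + t *\<^sub>R Z)"
    have Gt: "norm (A + B ** (K + t *\<^sub>R Z)) \<le> \<alpha> / 2" by (rule a(2)[OF \<alpha>1(1) Kt])
    have ls: "lyap_stable ?Ft"
      unfolding damped_mult using Gt \<alpha>1 by (intro stable_imp_lyap_stable stable_of_norm) auto
    define Y where "Y = B ** Z"
    define \<Delta> where "\<Delta> = P1 - P0"
    have nY: "norm Y \<le> norm B * norm Z" unfolding Y_def by (rule norm_matrix_mul_le)
    have nP0: "norm P0 \<le> p"
    proof -
      have "\<alpha> * norm P0 \<le> norm (cost_matrix Q R K)"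
        by (rule lyap_norm_bound[OF P0[unfolded damped_mult] a(2)[OF \<alpha>1(1) K(1)]])
      also have "\<dots> \<le> norm Q + (c * s * norm R) * (c * s)"
        unfolding cost_matrix_def using Ks(1)
        by (intro order_trans[OF norm_triangle_ineq] add_left_mono norm_matrix_mul_mono) (auto simp: norm_transpose)
      also have "\<dots> = norm Q + norm R * c\<^sup>2 * \<alpha>" by (simp add: s(2)[symmetric] power2_eq_square)
      also have "\<dots> \<le> norm Q * \<alpha> + norm R * c\<^sup>2 * \<alpha>" using \<alpha>1(2) mult_left_mono[of 1 \<alpha> "norm Q"] by simp
      finally have "\<alpha> * norm P0 \<le> \<alpha> * p" by (simp add: p_def algebra_simps)
      then show ?thesis using \<alpha>1(2) by simp
    qed
    have F1: "?F1 = ?F0 + Y" by (simp add: Y_def matrix_mul_add_right)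
    \<comment> \<open>The equation for \<open>P0\<close> is rewritten for the closed loop of
      \<open>K + Z\<close>, so that P1 - P0 solves a single Lyapunov equation whose right-hand side
      is at most of order s * norm Z.\<close>
    have "lyap ?F1 (cost_matrix Q R K - (transpose Y ** P0 + P0 ** Y)) P0"
      using P0 unfolding F1 lyap_def by (simp add: transpose_add matrix_mul_add_left matrix_mul_add_right algebra_simps)
    from lyap_diff[OF P1 this]
    have "lyap ?F1 (cost_matrix Q R (K + Z) - (cost_matrix Q R K - (transpose Y ** P0 + P0 ** Y))) \<Delta>" unfolding \<Delta>_def .
    from lyap_norm_bound[OF this[unfolded damped_mult] a(2)[OF \<alpha>1(1) K(2)]]
    have "\<alpha> * norm \<Delta> \<le> norm ((cost_matrix Q R (K + Z) - cost_matrix Q R K) + (transpose Y ** P0 + P0 ** Y))"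
      by (simp add: algebra_simps)
    also have "\<dots> \<le> norm (cost_matrix Q R (K + Z) - cost_matrix Q R K) + norm (transpose Y ** P0 + P0 ** Y)"
      by (rule norm_triangle_ineq)
    also have "\<dots> \<le> ((norm Z * norm R) * (c * s) + (c * s * norm R) * norm Z) + ((norm B * norm Z) * p + p * (norm B * norm Z))"
    proof (rule add_mono)
      have "norm (transpose Z ** R ** (K + Z)) \<le> (norm Z * norm R) * (c * s)" "norm (transpose K ** R ** Z) \<le> (c * s * norm R) * norm Z"
        by (intro norm_matrix_mul_mono; use Ks in \<open>simp add: norm_transpose\<close>)+
      then show "norm (cost_matrix Q R (K + Z) - cost_matrix Q R K) \<le> (norm Z * norm R) * (c * s) + (c * s * norm R) * norm Z"
        unfolding cost_matrix_diff add_diff_cancel_left' by (rule norm_triangle_mono)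
      show "norm (transpose Y ** P0 + P0 ** Y) \<le> (norm B * norm Z) * p + p * (norm B * norm Z)"
        by (intro add_mono order_trans[OF norm_triangle_ineq] norm_matrix_mul_mono)
          (use nY nP0 in \<open>auto simp: norm_transpose\<close>)
    qed
    also have "\<dots> = (2 * norm R * c) * s * norm Z + 1 * (2 * norm B * p) * norm Z" by simp
    also have "\<dots> \<le> (2 * norm R * c) * s * norm Z + s * (2 * norm B * p) * norm Z"
      using s(1) nonneg by (intro add_left_mono mult_right_mono) auto
    also have "\<dots> = s * (n * norm Z)" by (simp add: n_def algebra_simps)
    finally have "s * (s * norm \<Delta>) \<le> s * (n * norm Z)" by (simp add: s(2)[symmetric])
    then have n\<Delta>: "s * norm \<Delta> \<le> n * norm Z" using s(1) by simp
    define T where "T = transpose Z ** R ** Z"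
    define S where "S = \<Delta> ** Y + transpose Y ** \<Delta>"
    have \<Delta>sym: "symmetric_matrix \<Delta>" using P0 P1 by (simp add: \<Delta>_def lyap_def symmetric_matrix_def transpose_diff)
    have Rsym: "symmetric_matrix R" and Rpsd: "pos_semidef R" using R pos_def_semidef by (auto simp: pos_def_def)
    have Ssym: "symmetric_matrix S"
      using \<Delta>sym by (simp add: S_def symmetric_matrix_def transpose_add matrix_transpose_mul add.commute)
    have quadT: "x \<bullet> (T *v x) = (Z *v x) \<bullet> (R *v (Z *v x))" for x
      using quad_cost_matrix[of x 0 R Z] by (simp add: cost_matrix_def T_def)
    have Tpsd: "pos_semidef T"
    proof -
      have "pos_semidef (0 :: real^'n^'n)" by (simp add: pos_semidef_def symmetric_matrix_def transpose_zero)
      from pos_semidef_cost_matrix[OF this Rpsd, of Z] show ?thesis by (simp add: cost_matrix_def T_def)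
    qed
    obtain X1 where X1: "lyap ?Ft T X1" using lyap_exists[OF ls] Tpsd by (auto simp: pos_semidef_def)
    obtain X2 where X2: "lyap ?Ft S X2" using lyap_exists[OF ls Ssym] by blast
    have X: "((1 - t) *\<^sub>R P0 + t *\<^sub>R P1) - Pt = (t * (1 - t)) *\<^sub>R (X1 + X2)"
    proof (rule lyap_unique[OF ls])
      show "lyap ?Ft ((t * (1 - t)) *\<^sub>R (T + \<Delta> ** Y + transpose Y ** \<Delta>)) (((1 - t) *\<^sub>R P0 + t *\<^sub>R P1) - Pt)"
        using lyap_interpolation[OF P0 P1 Pt] by (simp add: T_def Y_def \<Delta>_def)
      show "lyap ?Ft ((t * (1 - t)) *\<^sub>R (T + \<Delta> ** Y + transpose Y ** \<Delta>)) ((t * (1 - t)) *\<^sub>R (X1 + X2))"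
        using lyap_scaleR[OF lyap_add[OF X1 X2]] by (simp add: S_def add.assoc)
    qed
    have "\<rho> * (norm Z)\<^sup>2 \<le> real CARD('n) * norm T"
      by (rule quad_gain_bound[OF \<rho>]) (use quad_le_norm[of _ T] quadT in auto)
    then have Z2: "(norm Z)\<^sup>2 \<le> real CARD('n) / \<rho> * norm T" using \<rho>(1) by (simp add: pos_le_divide_eq mult.commute)
    have "norm ?Ft \<le> norm (A + B ** (K + t *\<^sub>R Z)) + norm (\<alpha> *\<^sub>R mat 1 :: real^'n^'n)"
      unfolding damped_mult by (rule norm_triangle_ineq4)
    also have "\<dots> \<le> \<alpha> / 2 + \<alpha> * norm (mat 1 :: real^'n^'n)" using Gt \<alpha>1(2) by simp
    finally have "2 * norm ?Ft \<le> \<alpha> * \<nu>" by (simp add: \<nu>_def algebra_simps)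
    \<comment> \<open>Used as a lower bound for X1: the closed loop has norm of order \<alpha>, so
      \<open>T\<close> cannot have too small a solution.\<close>
    then have nT: "norm T \<le> \<alpha> * \<nu> * norm X1"
      by (intro order_trans[OF lyap_norm_rhs[OF X1]] mult_right_mono) auto
    have "\<alpha> * norm X2 \<le> norm S" by (rule lyap_norm_bound[OF X2[unfolded damped_mult] Gt])
    also have "\<dots> \<le> norm \<Delta> * (norm B * norm Z) + (norm B * norm Z) * norm \<Delta>"
      unfolding S_def using nY
      by (intro order_trans[OF norm_triangle_ineq] add_mono norm_matrix_mul_mono) (auto simp: norm_transpose)
    also have "\<dots> = 2 * norm \<Delta> * (norm B * norm Z)" by simp
    finally have "s * (\<alpha> * norm X2) \<le> s * (2 * norm \<Delta> * (norm B * norm Z))"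
      using s(1) by (intro mult_left_mono) auto
    also have "\<dots> = (s * norm \<Delta>) * (2 * norm B * norm Z)" by simp
    also have "\<dots> \<le> (n * norm Z) * (2 * norm B * norm Z)" by (intro mult_right_mono n\<Delta>) auto
    also have "\<dots> = (2 * n * norm B) * (norm Z)\<^sup>2" by (simp add: power2_eq_square)
    also have "\<dots> \<le> (2 * n * norm B) * (real CARD('n) / \<rho> * (\<alpha> * \<nu> * norm X1))"
      using nonneg \<rho>(1) nT by (intro mult_left_mono order_trans[OF Z2]) auto
    also have "\<dots> = \<alpha> * (k * norm X1)" by (simp add: k_def)
    finally have "\<alpha> * (s * norm X2) \<le> \<alpha> * (k * norm X1)" by (simp add: mult.left_commute)
    then have sX2: "s * norm X2 \<le> k * norm X1" using \<alpha>1(2) by simp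
    have "s * (norm D * norm X2) \<le> norm D * (k * norm X1)"
      using mult_left_mono[OF sX2, of "norm D"] by (simp add: mult.left_commute)
    also have "\<dots> = d * (norm D * k / d) * norm X1" using d by simp
    also have "\<dots> \<le> d * s * norm X1" using d s(3) by (intro mult_right_mono mult_left_mono) auto
    also have "\<dots> = s * (d * norm X1)" by simp
    finally have "norm D * norm X2 \<le> d * norm X1" using s(1) by simp
    also have "\<dots> \<le> X1 \<bullet> D" by (rule D[OF lyap_pos_semidef[OF ls X1 Tpsd]])
    finally have "norm D * norm X2 \<le> X1 \<bullet> D" .
    moreover have "- (X2 \<bullet> D) \<le> norm D * norm X2"
      using Cauchy_Schwarz_ineq2[of X2 D] by (simp add: mult.commute abs_le_iff)
    ultimately have "0 \<le> (X1 + X2) \<bullet> D" by (simp add: inner_add_left)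
    then have "0 \<le> (t * (1 - t)) * ((X1 + X2) \<bullet> D)" using t by (intro mult_nonneg_nonneg) auto
    also have "\<dots> = (((1 - t) *\<^sub>R P0 + t *\<^sub>R P1) - Pt) \<bullet> D" unfolding X by simp
    finally show ?thesis by (simp add: inner_diff_left inner_add_left)
  qed
  then show ?thesis by (intro exI[of _ "max a ((norm D * k / d)\<^sup>2)"] allI impI) (rule main; assumption)
qed

text \<open>Subtracting the two equations shows that P - P' solves one with right-hand side 2 s P',
  so it is semidefinite. If it were 0, then P' and hence P would vanish, against positive cost; the
  coercivity constant \<open>d\<close> makes the drop strict.\<close>

lemma cost_strict_decreasing:
  fixes D :: "real^'n^'n"
  assumes d: "0 < d" and D: "\<And>P. pos_semidef P \<Longrightarrow> d * norm P \<le> P \<bullet> D"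
    and F: "lyap_stable F" and M: "pos_semidef M" and P: "lyap F M P" and s: "0 < s"
    and P': "lyap (F - s *\<^sub>R mat 1) M P'" and pos: "0 < P \<bullet> D"
  shows "P' \<bullet> D < P \<bullet> D"
proof -
  have Fs: "lyap_stable (F - s *\<^sub>R mat 1)"
    by (rule lyap_stable_shift_mono[of F 0]) (use F s in auto)
  have P'0: "pos_semidef P'" by (rule lyap_pos_semidef[OF Fs P' M])
  have "lyap F (M - (M - (2 * s) *\<^sub>R P')) (P - P')" by (rule lyap_diff[OF P P'[unfolded lyap_shift]])
  then have l: "lyap F ((2 * s) *\<^sub>R P') (P - P')" by simp
  have "pos_semidef ((2 * s) *\<^sub>R P')"
    using P'0 s by (simp add: pos_semidef_def symmetric_matrix_def transpose_scaleR flip: scaleR_matrix_vector_assoc)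
  then have "pos_semidef (P - P')" by (rule lyap_pos_semidef[OF F l])
  then have le: "d * norm (P - P') \<le> (P - P') \<bullet> D" by (rule D)
  have "P \<noteq> P'"
  proof
    assume "P = P'"
    then have "(2 * s) *\<^sub>R P' = 0" using l by (simp add: lyap_def)
    then have "P' = 0" using s by simp
    then show False using pos \<open>P = P'\<close> by simp
  qed
  then have "0 < d * norm (P - P')" using d by simp
  then have "0 < (P - P') \<bullet> D" using le by linarith
  then show ?thesis by (simp add: inner_diff_left)
qed

section \<open>Absence of spurious local minima\<close>

lemma random_state_inner:
  fixes P :: "real^'n^'n"
  assumes "random_initial_state M x\<^sub>0 D"
  shows "integrable M (\<lambda>\<omega>. x\<^sub>0 \<omega> \<bullet> (P *v x\<^sub>0 \<omega>))" "integral\<^sup>L M (\<lambda>\<omega>. x\<^sub>0 \<omega> \<bullet> (P *v x\<^sub>0 \<omega>)) = P \<bullet> D"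
proof -
  have i: "integrable M (\<lambda>\<omega>. x\<^sub>0 \<omega> $ i * x\<^sub>0 \<omega> $ j)" "integral\<^sup>L M (\<lambda>\<omega>. x\<^sub>0 \<omega> $ i * x\<^sub>0 \<omega> $ j) = D $ i $ j" for i j
    using assms by (auto simp: random_initial_state_def)
  have e: "x\<^sub>0 \<omega> \<bullet> (P *v x\<^sub>0 \<omega>) = (\<Sum>i\<in>UNIV. \<Sum>j\<in>UNIV. P $ i $ j * (x\<^sub>0 \<omega> $ i * x\<^sub>0 \<omega> $ j))" for \<omega>
    by (simp add: inner_vec_def matrix_vector_mult_def sum_distrib_left algebra_simps)
  show "integrable M (\<lambda>\<omega>. x\<^sub>0 \<omega> \<bullet> (P *v x\<^sub>0 \<omega>))" unfolding e using i by simp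
  show "integral\<^sup>L M (\<lambda>\<omega>. x\<^sub>0 \<omega> \<bullet> (P *v x\<^sub>0 \<omega>)) = P \<bullet> D"
    unfolding e using i by (simp add: inner_vec_def)
qed

text \<open>The random state replaces a square root of \<open>D\<close>: the expectation of the
  nonnegative form is 0, so P annihilates the state almost surely. Then P D, the expectation of P
  times the second moment of the state, is 0, and \<open>D\<close> is invertible.\<close>

lemma pos_semidef_inner_eq_0:
  fixes P D :: "real^'n^'n"
  assumes x0: "random_initial_state M x\<^sub>0 D" and D: "pos_def D" and P: "pos_semidef P" and z: "P \<bullet> D = 0"
  shows "P = 0"
proof -
  have nn: "0 \<le> x\<^sub>0 \<omega> \<bullet> (P *v x\<^sub>0 \<omega>)" for \<omega> using P by (simp add: pos_semidef_def)
  have "AE \<omega> in M. x\<^sub>0 \<omega> \<bullet> (P *v x\<^sub>0 \<omega>) = 0"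
    using integral_nonneg_eq_0_iff_AE[OF random_state_inner(1)[OF x0, of P]] nn random_state_inner(2)[OF x0, of P] z by simp
  then have ae: "AE \<omega> in M. P *v x\<^sub>0 \<omega> = 0"
    by eventually_elim (rule pos_semidef_kernel[OF P])
  have i: "integrable M (\<lambda>\<omega>. x\<^sub>0 \<omega> $ i * x\<^sub>0 \<omega> $ j)" "integral\<^sup>L M (\<lambda>\<omega>. x\<^sub>0 \<omega> $ i * x\<^sub>0 \<omega> $ j) = D $ i $ j" for i j
    using x0 by (auto simp: random_initial_state_def)
  have "(P ** D) $ i $ j = 0" for i j
  proof -
    have "(P ** D) $ i $ j = (\<Sum>k\<in>UNIV. P $ i $ k * integral\<^sup>L M (\<lambda>\<omega>. x\<^sub>0 \<omega> $ k * x\<^sub>0 \<omega> $ j))"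
      by (simp add: matrix_matrix_mult_def i(2))
    also have "\<dots> = integral\<^sup>L M (\<lambda>\<omega>. \<Sum>k\<in>UNIV. P $ i $ k * (x\<^sub>0 \<omega> $ k * x\<^sub>0 \<omega> $ j))"
      using i(1) by simp
    also have "\<dots> = integral\<^sup>L M (\<lambda>\<omega>. (P *v x\<^sub>0 \<omega>) $ i * x\<^sub>0 \<omega> $ j)"
      by (simp add: matrix_vector_mult_def sum_distrib_right mult.assoc)
    also have "\<dots> = integral\<^sup>L M (\<lambda>\<omega>. 0)"
    proof (rule Bochner_Integration.integral_cong_AE)
      have m: "x\<^sub>0 \<in> borel_measurable M" using x0 by (simp add: random_initial_state_def)
      have "(\<lambda>\<omega>. P *v x\<^sub>0 \<omega>) \<in> borel_measurable M"
        by (rule borel_measurable_continuous_on[OF _ m]) (intro linear_continuous_on matrix_vector_mul_bounded_linear)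
      moreover have "(\<lambda>v :: real^'n. v $ k) \<in> borel_measurable borel" for k
        by (intro borel_measurable_continuous_onI continuous_intros)
      ultimately show "(\<lambda>\<omega>. (P *v x\<^sub>0 \<omega>) $ i * x\<^sub>0 \<omega> $ j) \<in> borel_measurable M"
        using m by (intro borel_measurable_times) (auto intro: measurable_compose)
      show "AE \<omega> in M. (P *v x\<^sub>0 \<omega>) $ i * x\<^sub>0 \<omega> $ j = 0" using ae by eventually_elim simp
    qed simp
    finally show ?thesis by simp
  qed
  then have PD: "P ** D = 0" by (simp add: vec_eq_iff)
  have "inj ((*v) D)"
    unfolding linear_injective_0[OF matrix_vector_mul_linear]
  proof (intro allI impI)
    fix x assume "D *v x = 0"
    then have "\<not> 0 < x \<bullet> (D *v x)" by simp
    then show "x = 0" using D unfolding pos_def_def by blast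
  qed
  then have "surj ((*v) D)" by (intro linear_injective_imp_surjective) auto
  have "P *v y = 0" for y
  proof -
    obtain z where "y = D *v z" using \<open>surj ((*v) D)\<close> by (metis surjD)
    then show ?thesis using PD by (simp add: matrix_vector_mul_assoc)
  qed
  then show ?thesis by (simp add: matrix_eq)
qed

lemma closed_pos_semidef: "closed {P :: real^'n^'n. pos_semidef P}"
proof -
  have lin: "linear (\<lambda>P :: real^'n^'n. transpose P)" by (rule linearI) (simp_all add: transpose_linear)
  have linq: "linear (\<lambda>P :: real^'n^'n. x \<bullet> (P *v x))" for x
    by (rule linearI) (simp_all add: matrix_vector_mult_add_rdistrib inner_add_right flip: scaleR_matrix_vector_assoc)
  have "closed ({P :: real^'n^'n. transpose P = P} \<inter> (\<Inter>x. {P. 0 \<le> x \<bullet> (P *v x)}))"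
    by (intro closed_Int closed_INT ballI closed_Collect_eq closed_Collect_le linear_continuous_on continuous_on_id continuous_on_const)
      (use lin linq in \<open>auto simp: linear_conv_bounded_linear\<close>)
  also have "{P :: real^'n^'n. transpose P = P} \<inter> (\<Inter>x. {P. 0 \<le> x \<bullet> (P *v x)}) = {P. pos_semidef P}"
    by (auto simp: pos_semidef_def symmetric_matrix_def)
  finally show ?thesis .
qed

text \<open>Minimizing over the compact set of semidefinite matrices of norm 1 gives a coercivity
  constant: bounds on the cost become bounds on the Lyapunov solution.\<close>

lemma pos_semidef_inner_lower_bound:
  fixes D :: "real^'n^'n"
  assumes x0: "random_initial_state M x\<^sub>0 D" and D: "pos_def D"
  obtains d where "0 < d" "\<And>P. pos_semidef P \<Longrightarrow> d * norm P \<le> P \<bullet> D"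
proof -
  let ?S = "{P :: real^'n^'n. pos_semidef P} \<inter> sphere 0 1"
  have nn: "0 \<le> P \<bullet> D" if "pos_semidef P" for P
    unfolding random_state_inner(2)[OF x0, symmetric]
    by (rule integral_nonneg_AE) (use that in \<open>auto simp: pos_semidef_def\<close>)
  have scale: "pos_semidef (r *\<^sub>R P)" if "pos_semidef P" "0 \<le> r" for P :: "real^'n^'n" and r
    using that by (simp add: pos_semidef_def symmetric_matrix_def transpose_scaleR flip: scaleR_matrix_vector_assoc)
  have "compact ?S" by (intro closed_Int_compact closed_pos_semidef compact_sphere)
  moreover have "?S \<noteq> {}"
  proof -
    have "norm (mat 1 :: real^'n^'n) \<noteq> 0" by (auto simp: vec_eq_iff mat_def)
    then have "inverse (norm (mat 1 :: real^'n^'n)) *\<^sub>R mat 1 \<in> ?S"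
      using scale[OF pos_def_semidef[OF pos_def_mat_1]] by auto
    then show ?thesis by blast
  qed
  moreover have "continuous_on ?S (\<lambda>P. P \<bullet> D)" by (intro continuous_intros)
  ultimately obtain U where U: "U \<in> ?S" "\<forall>P\<in>?S. U \<bullet> D \<le> P \<bullet> D" using continuous_attains_inf by blast
  have "U \<noteq> 0" using U(1) by auto
  then have "U \<bullet> D \<noteq> 0" using pos_semidef_inner_eq_0[OF x0 D] U(1) by blast
  then have "0 < U \<bullet> D" using nn[of U] U(1) by auto
  moreover have "(U \<bullet> D) * norm P \<le> P \<bullet> D" if P: "pos_semidef P" for P
  proof (cases "P = 0")
    case False
    then have "inverse (norm P) *\<^sub>R P \<in> ?S" using scale[OF P] by auto
    then have "U \<bullet> D \<le> (inverse (norm P) *\<^sub>R P) \<bullet> D" using U(2) by blast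
    then show ?thesis using False by (simp add: field_simps)
  qed simp
  ultimately show ?thesis using that by blast
qed

text \<open>Feasibility of \<open>K\<close> at \<open>\<alpha>\<close> with cost \<open>c\<close>, phrased as a first-order formula over the reals.\<close>
definition gain_cost :: "real^'n^'n \<Rightarrow> real^'n^'n \<Rightarrow> real^'n^'n \<Rightarrow> real^'n^'n \<Rightarrow> real^'n^'n \<Rightarrow> ('n \<times> 'n) set
    \<Rightarrow> real^'n^'n \<Rightarrow> real \<Rightarrow> real \<Rightarrow> bool" where
  "gain_cost A B Q R D Z K \<alpha> c \<longleftrightarrow> (\<forall>(i, j)\<in>Z. K $ i $ j = 0) \<and> stable (damped A \<alpha> + B ** K) \<and>
    (\<exists>P. lyap (damped A \<alpha> + B ** K) (cost_matrix Q R K) P \<and> P \<bullet> D = c)"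

text \<open>The matrix may read scalar slots 0 and 1; the bound \<sigma> and \<omega> use slots 2
  and 3, and the bound vectors use vector slots that the matrix does not read.\<close>

lemma sign_determined_stable:
  assumes "polymat (m :: 'n::finite env \<Rightarrow> real^'n^'n)"
    "\<And>e k x. m (put_sc e (Suc (Suc k)) x) = m e" "\<And>e k x. m (put_vc e k x) = m e"
  shows "sign_determined (\<lambda>e. stable (m e))"
  unfolding stable_iff
proof (rule sign_determined_all_sc[where k = 2], rule sign_determined_all_sc[where k = 3],
    rule sign_determined_all_vc[where k = 0], rule sign_determined_all_vc[where k = 1])
  show "sign_determined (\<lambda>e. m e *v vc e 0 = sc e 2 *\<^sub>R vc e 0 - sc e 3 *\<^sub>R vc e 1 \<longrightarrow>
      m e *v vc e 1 = sc e 2 *\<^sub>R vc e 1 + sc e 3 *\<^sub>R vc e 0 \<longrightarrow> vc e 0 = 0 \<and> vc e 1 = 0 \<or> sc e 2 < 0)"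
    by (intro sign_determined_imp sign_determined_disj sign_determined_conj sign_determined_vec_eq
      sign_determined_less polyvec_intros polyfun_sc polyfun_const assms(1))
qed (use assms(2)[of _ 0] assms(2)[of _ 1] assms(3) in \<open>simp_all add: numeral_2_eq_2 numeral_3_eq_3\<close>)

lemma sign_determined_gain_cost:
  fixes A :: "real^'n^'n"
  shows "sign_determined (\<lambda>e. gain_cost A B Q R D Z (mt e k) (sc e i) (sc e j))"
proof (rule sign_determined_rename_vars[of "gain_cost A B Q R D Z"])
  have F: "polymat (\<lambda>e. damped A (sc e 0) + B ** mt e 0)"
    unfolding damped_def by (intro polymat_intros polyfun_sc)
  have Z: "finite Z" by simp
  have "sign_determined (\<lambda>e. \<exists>P. lyap (damped A (sc e 0) + B ** mt e 0) (cost_matrix Q R (mt e 0)) P \<and> P \<bullet> D = sc e 1)"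
    unfolding lyap_def symmetric_matrix_def cost_matrix_def
  proof (rule sign_determined_ex_mt[where k = 1])
    show "sign_determined (\<lambda>e. (transpose (mt e 1) = mt e 1 \<and>
        transpose (damped A (sc e 0) + B ** mt e 0) ** mt e 1 + mt e 1 ** (damped A (sc e 0) + B ** mt e 0) +
        (Q + transpose (mt e 0) ** R ** mt e 0) = 0) \<and> mt e 1 \<bullet> D = sc e 1)"
      by (intro sign_determined_conj sign_determined_mat_eq sign_determined_eq polyfun_inner_mat polyfun_sc polymat_intros F)
  qed simp
  moreover have "sign_determined (\<lambda>e. stable (damped A (sc e 0) + B ** mt e 0))"
    by (rule sign_determined_stable[OF F]) simp_all
  moreover have "sign_determined (\<lambda>e. \<forall>(i, j)\<in>Z. mt e 0 $ i $ j = 0)"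
    unfolding case_prod_beta
    by (rule sign_determined_ball[OF Z], rule sign_determined_eq)
      (use polymat_intros(1) in \<open>auto simp: polymat_def intro: polyfun_const\<close>)
  ultimately show "sign_determined (\<lambda>e. gain_cost A B Q R D Z (mt e 0) (sc e 0) (sc e 1))"
    unfolding gain_cost_def by (intro sign_determined_conj)
qed

text \<open>With \<open>V\<close> the graph of the cost, these are the values of local minima that
  are not global. Distance is compared through its square, with \<open>r\<close> a squared radius,
  to keep the condition polynomial.\<close>

definition loc_value :: "(real^'n^'n \<Rightarrow> real \<Rightarrow> real \<Rightarrow> bool) \<Rightarrow> real \<Rightarrow> real \<Rightarrow> bool" where
  "loc_value V \<alpha> c \<longleftrightarrow>
    (\<exists>K. V K \<alpha> c \<and> (\<exists>r. 0 < r \<and> (\<forall>L c'. V L \<alpha> c' \<longrightarrow> (L - K) \<bullet> (L - K) < r \<longrightarrow> c \<le> c')) \<and>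
      \<not> (\<forall>L c'. V L \<alpha> c' \<longrightarrow> c \<le> c'))"

definition least_loc_value :: "(real^'n^'n \<Rightarrow> real \<Rightarrow> real \<Rightarrow> bool) \<Rightarrow> real \<Rightarrow> real \<Rightarrow> bool" where
  "least_loc_value V \<alpha> c \<longleftrightarrow> loc_value V \<alpha> c \<and> (\<forall>c'. loc_value V \<alpha> c' \<longrightarrow> c \<le> c')"

lemma sign_determined_loc_value:
  fixes V :: "real^'n^'n \<Rightarrow> real \<Rightarrow> real \<Rightarrow> bool"
  assumes V: "\<And>k i j. sign_determined (\<lambda>e. V (mt e k) (sc e i) (sc e j))"
  shows "sign_determined (\<lambda>e :: 'n env. loc_value V (sc e i) (sc e j))"
proof (rule sign_determined_rename_vars[of "\<lambda>_. loc_value V"])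
  have near: "sign_determined (\<lambda>e. \<forall>L c'. V L (sc e 0) c' \<longrightarrow> (L - mt e 0) \<bullet> (L - mt e 0) < sc e 2 \<longrightarrow> sc e 1 \<le> c')"
    by (rule sign_determined_all_mt[where k = 1], rule sign_determined_all_sc[where k = 3],
      intro sign_determined_imp sign_determined_less sign_determined_le V polyfun_inner_mat polymat_intros polyfun_sc)
      simp_all
  have locmin: "sign_determined (\<lambda>e. \<exists>r. 0 < r \<and> (\<forall>L c'. V L (sc e 0) c' \<longrightarrow> (L - mt e 0) \<bullet> (L - mt e 0) < r \<longrightarrow> sc e 1 \<le> c'))"
    by (rule sign_determined_ex_sc[where k = 2], intro sign_determined_conj near sign_determined_less polyfun_const polyfun_sc) simp
  have global: "sign_determined (\<lambda>e :: 'n env. \<forall>L c'. V L (sc e 0) c' \<longrightarrow> sc e 1 \<le> c')"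
    by (rule sign_determined_all_mt[where k = 1], rule sign_determined_all_sc[where k = 3],
      intro sign_determined_imp sign_determined_le V polyfun_sc) simp_all
  show "sign_determined (\<lambda>e :: 'n env. loc_value V (sc e 0) (sc e 1))"
    unfolding loc_value_def
    by (rule sign_determined_ex_mt[where k = 0], intro sign_determined_conj V locmin sign_determined_not global) simp
qed

lemma sign_determined_least_loc_value:
  fixes V :: "real^'n^'n \<Rightarrow> real \<Rightarrow> real \<Rightarrow> bool"
  assumes V: "\<And>k i j. sign_determined (\<lambda>e. V (mt e k) (sc e i) (sc e j))"
  shows "sign_determined (\<lambda>e :: 'n env. least_loc_value V (sc e i) (sc e j))"
proof (rule sign_determined_rename_vars[of "\<lambda>_. least_loc_value V"])
  have "sign_determined (\<lambda>e :: 'n env. \<forall>c'. loc_value V (sc e 0) c' \<longrightarrow> sc e 1 \<le> c')"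
    by (rule sign_determined_all_sc[where k = 2],
      intro sign_determined_imp sign_determined_le sign_determined_loc_value V polyfun_sc) simp
  then show "sign_determined (\<lambda>e :: 'n env. least_loc_value V (sc e 0) (sc e 1))"
    unfolding least_loc_value_def by (intro sign_determined_conj sign_determined_loc_value V)
qed

lemma sign_determined_locally_decreasing:
  fixes G :: "real \<Rightarrow> real \<Rightarrow> bool"
  assumes G: "\<And>i j. sign_determined (\<lambda>e :: 'n::finite env. G (sc e i) (sc e j))"
  shows "sign_determined (\<lambda>e :: 'n env. \<exists>\<epsilon>>0. \<forall>c. G (sc e 1) c \<longrightarrow>
        (\<forall>t x. G t x \<longrightarrow> (sc e 1 < t \<and> t < sc e 1 + \<epsilon> \<longrightarrow> x < c) \<and> (sc e 1 - \<epsilon> < t \<and> t < sc e 1 \<longrightarrow> c < x)))"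
proof (rule sign_determined_ex_sc[where k = 2], intro sign_determined_conj)
  have inner: "sign_determined (\<lambda>e :: 'n env. \<forall>t x. G t x \<longrightarrow> (sc e 1 < t \<and> t < sc e 1 + sc e 2 \<longrightarrow> x < sc e 3)
      \<and> (sc e 1 - sc e 2 < t \<and> t < sc e 1 \<longrightarrow> sc e 3 < x))"
    by (rule sign_determined_all_sc[where k = 4], rule sign_determined_all_sc[where k = 5],
      intro sign_determined_imp sign_determined_conj sign_determined_less G polyfun_sc polyfun_add polyfun_diff) simp_all
  show "sign_determined (\<lambda>e :: 'n env. \<forall>c. G (sc e 1) c \<longrightarrow>
        (\<forall>t x. G t x \<longrightarrow> (sc e 1 < t \<and> t < sc e 1 + sc e 2 \<longrightarrow> x < c) \<and> (sc e 1 - sc e 2 < t \<and> t < sc e 1 \<longrightarrow> c < x)))"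
    by (rule sign_determined_all_sc[where k = 3], rule sign_determined_imp[OF G inner]) simp
  show "sign_determined (\<lambda>e :: 'n env. 0 < sc e 2)" by (intro sign_determined_less polyfun_const polyfun_sc)
qed simp

lemma global_subset_local: "global_minimizers f X \<subseteq> local_minimizers f X"
  by (auto simp: global_minimizers_def local_minimizers_def intro!: exI[of _ 1])

lemma stable_damped_mono:
  assumes "stable (damped A \<alpha> + B ** K)" "\<alpha> \<le> \<beta>"
  shows "stable (damped A \<beta> + B ** K)"
proof -
  have "damped A \<beta> + B ** K = (damped A \<alpha> + B ** K) - (\<beta> - \<alpha>) *\<^sub>R mat 1"
    by (simp add: damped_def algebra_simps)
  then show ?thesis using stable_shift[OF assms(1), of "\<beta> - \<alpha>"] assms(2) by (simp only: diff_ge_0_iff_ge)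
qed

lemma convex_local_imp_global:
  fixes f :: "'a::real_normed_vector \<Rightarrow> real"
  assumes K: "K \<in> local_minimizers f X" and y: "y \<in> X" "f y < f K"
    and seg: "\<And>t. 0 < t \<Longrightarrow> t \<le> 1 \<Longrightarrow> K + t *\<^sub>R (y - K) \<in> X \<and> f (K + t *\<^sub>R (y - K)) \<le> (1 - t) * f K + t * f y"
  shows False
proof -
  obtain e where e: "0 < e" "\<And>z. z \<in> X \<Longrightarrow> dist K z < e \<Longrightarrow> f K \<le> f z"
    using K by (auto simp: local_minimizers_def)
  define t where "t = min 1 (e / (2 * norm (y - K)))"
  have nz: "0 < norm (y - K)" using y by auto
  then have t: "0 < t" "t \<le> 1" "t * norm (y - K) < e"
  proof -
    show "0 < t" "t \<le> 1" using e nz by (auto simp: t_def)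
    have "t * norm (y - K) \<le> e / (2 * norm (y - K)) * norm (y - K)"
      unfolding t_def by (intro mult_right_mono) auto
    also have "\<dots> < e" using nz e(1) by simp
    finally show "t * norm (y - K) < e" .
  qed
  have "f K \<le> f (K + t *\<^sub>R (y - K))" using t seg[OF t(1,2)] by (intro e(2)) (auto simp: dist_norm)
  also have "\<dots> \<le> (1 - t) * f K + t * f y" using seg[OF t(1,2)] by blast
  finally have "t * f K \<le> t * f y" by (simp add: algebra_simps)
  then show False using t(1) y(2) by simp
qed

theorem eventually_locally_optimal_eq_globally_optimal:
  fixes A B Q R D\<^sub>0 :: "real^'n^'n" and S :: "(real^'n^'n) set"
  assumes "pos_semidef Q" "pos_def R" "pos_def D\<^sub>0" "random_initial_state M x\<^sub>0 D\<^sub>0" "sparsity_subspace S"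
  shows "\<exists>\<alpha>\<^sub>0. \<forall>\<alpha>\<ge>\<alpha>\<^sub>0.
    locally_optimal M x\<^sub>0 A B Q R S \<alpha> = globally_optimal M x\<^sub>0 A B Q R S \<alpha>"
proof -
  note Q = assms(1) and R = assms(2)
  have Rpsd: "pos_semidef R" by (rule pos_def_semidef[OF R])
  obtain Z where S: "S = {K. \<forall>(i, j)\<in>Z. K $ i $ j = 0}" using assms(5) by (auto simp: sparsity_subspace_def)
  obtain d where d: "0 < d" and D: "\<And>P. pos_semidef P \<Longrightarrow> d * norm P \<le> P \<bullet> D\<^sub>0"
    using pos_semidef_inner_lower_bound[OF assms(4,3)] by blast
  define feas where "feas = feasible A B S"
  define J where "J K \<alpha> = expected_cost M x\<^sub>0 A B Q R K \<alpha>" for K \<alpha>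
  let ?F = "\<lambda>K \<alpha>. damped A \<alpha> + B ** K"
  have Mpsd: "pos_semidef (cost_matrix Q R K)" for K by (rule pos_semidef_cost_matrix[OF Q Rpsd])
  have feasI: "K \<in> feas \<alpha> \<longleftrightarrow> K \<in> S \<and> stable (?F K \<alpha>)" for K \<alpha> by (simp add: feas_def feasible_def)
  have ls: "lyap_stable (?F K \<alpha>)" if "K \<in> feas \<alpha>" for K \<alpha>
    using that feasI stable_imp_lyap_stable by blast
  have P_ex: "\<exists>P. lyap (?F K \<alpha>) (cost_matrix Q R K) P" if "K \<in> feas \<alpha>" for K \<alpha>
    using lyap_exists[OF ls[OF that]] Mpsd by (auto simp: pos_semidef_def)
  have J_eq: "J K \<alpha> = P \<bullet> D\<^sub>0" if "K \<in> feas \<alpha>" "lyap (?F K \<alpha>) (cost_matrix Q R K) P" for K \<alpha> P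
    unfolding J_def by (rule expected_cost_eq[OF ls[OF that(1)] Q Rpsd that(2) assms(4)])
  have P_psd: "pos_semidef P" if "K \<in> feas \<alpha>" "lyap (?F K \<alpha>) (cost_matrix Q R K) P" for K \<alpha> P
    by (rule lyap_pos_semidef[OF ls[OF that(1)] that(2) Mpsd])
  have P_norm: "norm P \<le> J K \<alpha> / d" if "K \<in> feas \<alpha>" "lyap (?F K \<alpha>) (cost_matrix Q R K) P" for K \<alpha> P
    using D[OF P_psd[OF that]] J_eq[OF that] d by (simp add: pos_le_divide_eq mult.commute)
  have mono: "feas \<alpha> \<subseteq> feas \<beta>" if "\<alpha> \<le> \<beta>" for \<alpha> \<beta>
    using stable_damped_mono that by (auto simp: feasI)
  have nonneg: "0 \<le> J K \<alpha>" if K: "K \<in> feas \<alpha>" for K \<alpha>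
  proof -
    obtain P where P: "lyap (?F K \<alpha>) (cost_matrix Q R K) P" using P_ex[OF K] by blast
    have "0 \<le> d * norm P" using d by simp
    also have "\<dots> \<le> P \<bullet> D\<^sub>0" by (rule D[OF P_psd[OF K P]])
    finally show ?thesis by (simp add: J_eq[OF K P])
  qed
  have decr: "J K \<beta> < J K \<alpha>" if K: "K \<in> feas \<alpha>" and ab: "\<alpha> < \<beta>" and pos: "0 < J K \<alpha>" for K \<alpha> \<beta>
  proof -
    have K': "K \<in> feas \<beta>" using mono[of \<alpha> \<beta>] K ab by auto
    obtain P where P: "lyap (?F K \<alpha>) (cost_matrix Q R K) P" using P_ex[OF K] by blast
    obtain P' where P': "lyap (?F K \<beta>) (cost_matrix Q R K) P'" using P_ex[OF K'] by blast
    have "?F K \<beta> = ?F K \<alpha> - (\<beta> - \<alpha>) *\<^sub>R mat 1" by (simp add: damped_def algebra_simps)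
    then have "lyap (?F K \<alpha> - (\<beta> - \<alpha>) *\<^sub>R mat 1) (cost_matrix Q R K) P'" using P' by (simp only:)
    from cost_strict_decreasing[OF d D ls[OF K] Mpsd P _ this] show ?thesis
      using ab pos by (simp add: J_eq[OF K P] J_eq[OF K' P'])
  qed
  define V where "V = gain_cost A B Q R D\<^sub>0 Z"
  \<comment> \<open>Every Lyapunov solution for a feasible gain yields the value \<open>J\<close>,
    so the definable relation \<open>V\<close> is the graph of the cost on the feasible set.\<close>
  have V: "V K \<alpha> c \<longleftrightarrow> K \<in> feas \<alpha> \<and> J K \<alpha> = c" for K \<alpha> c
  proof -
    have "V K \<alpha> c \<longleftrightarrow> K \<in> feas \<alpha> \<and> (\<exists>P. lyap (?F K \<alpha>) (cost_matrix Q R K) P \<and> P \<bullet> D\<^sub>0 = c)"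
      unfolding V_def gain_cost_def feasI S mem_Collect_eq by blast
    also have "\<dots> \<longleftrightarrow> K \<in> feas \<alpha> \<and> J K \<alpha> = c"
    proof (cases "K \<in> feas \<alpha>")
      case True
      obtain P where P: "lyap (?F K \<alpha>) (cost_matrix Q R K) P" using P_ex[OF True] by blast
      have "J K \<alpha> = P' \<bullet> D\<^sub>0" if "lyap (?F K \<alpha>) (cost_matrix Q R K) P'" for P' by (rule J_eq[OF True that])
      then show ?thesis using True P by metis
    qed simp
    finally show ?thesis .
  qed
  have Vsd: "sign_determined (\<lambda>e. V (mt e k) (sc e i) (sc e j))" for k i j
    unfolding V_def by (rule sign_determined_gain_cost)
  let ?bad = "\<lambda>\<alpha>. local_minimizers (\<lambda>K. J K \<alpha>) (feas \<alpha>) - global_minimizers (\<lambda>K. J K \<alpha>) (feas \<alpha>)"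
  have dist_iff: "dist K L < r \<longleftrightarrow> (L - K) \<bullet> (L - K) < r * r" if "0 < r" for K L :: "real^'n^'n" and r
    using that norm_lt_square[of "L - K" r] by (simp add: dist_norm norm_minus_commute power2_eq_square)
  have T: "(\<exists>K\<in>?bad \<alpha>. J K \<alpha> = c) \<longleftrightarrow> loc_value V \<alpha> c" for \<alpha> c
  proof -
    have loc: "(\<exists>r. 0 < r \<and> (\<forall>L c'. V L \<alpha> c' \<longrightarrow> (L - K) \<bullet> (L - K) < r \<longrightarrow> J K \<alpha> \<le> c')) \<longleftrightarrow>
        (\<exists>e>0. \<forall>y\<in>feas \<alpha> \<inter> ball K e. J K \<alpha> \<le> J y \<alpha>)" (is "?L \<longleftrightarrow> ?R") for K
    proof
      assume ?L
      then obtain r where r: "0 < r" "\<And>L. L \<in> feas \<alpha> \<Longrightarrow> (L - K) \<bullet> (L - K) < r \<Longrightarrow> J K \<alpha> \<le> J L \<alpha>" by (auto simp: V)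
      then show ?R using dist_iff[of "sqrt r" K] by (intro exI[of _ "sqrt r"]) auto
    next
      assume ?R
      then obtain e where e: "0 < e" "\<forall>y\<in>feas \<alpha> \<inter> ball K e. J K \<alpha> \<le> J y \<alpha>" by blast
      then show ?L using dist_iff[OF e(1), of K] by (intro exI[of _ "e * e"]) (auto simp: V)
    qed
    have "loc_value V \<alpha> c \<longleftrightarrow> (\<exists>K. K \<in> feas \<alpha> \<and> J K \<alpha> = c \<and>
        (\<exists>r. 0 < r \<and> (\<forall>L c'. V L \<alpha> c' \<longrightarrow> (L - K) \<bullet> (L - K) < r \<longrightarrow> J K \<alpha> \<le> c')) \<and> \<not> (\<forall>L\<in>feas \<alpha>. J K \<alpha> \<le> J L \<alpha>))"
      unfolding loc_value_def V by blast
    then show ?thesis unfolding loc local_minimizers_def global_minimizers_def by blast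
  qed
  have Tsd: "sign_determined (\<lambda>e :: 'n env. loc_value V (sc e i) (sc e j))" for i j
    by (rule sign_determined_loc_value) (rule Vsd)
  have Gsd: "sign_determined (\<lambda>e :: 'n env. least_loc_value V (sc e i) (sc e j))" for i j
    by (rule sign_determined_least_loc_value) (rule Vsd)
  have "(\<forall>\<^sub>F \<alpha> in at_top. ?bad \<alpha> = {}) \<or> (\<exists>C. \<forall>\<^sub>F \<alpha> in at_top. \<exists>K\<in>?bad \<alpha>. J K \<alpha> \<le> C)"
  proof (rule local_minimum_values_bounded[OF mono nonneg decr], unfold T least_loc_value_def[symmetric])
    show "(\<forall>\<^sub>F x in at_right c. loc_value V \<alpha> x) \<or> (\<forall>\<^sub>F x in at_right c. \<not> loc_value V \<alpha> x)" for \<alpha> c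
      by (rule sign_determined_germ_sc[where \<Psi> = "loc_value V", OF Tsd tame_at_right])
    have "sign_determined (\<lambda>e :: 'n env. \<exists>c. loc_value V (sc e 1) c)"
      by (rule sign_determined_ex_sc[where k = 2], rule Tsd) simp
    from sign_determined_germ_sc[where \<Psi> = "\<lambda>_ \<alpha>. \<exists>c. loc_value V \<alpha> c", OF this tame_at_top]
    show "(\<forall>\<^sub>F \<alpha> in at_top. \<exists>c. loc_value V \<alpha> c) \<or> (\<forall>\<^sub>F \<alpha> in at_top. \<not> (\<exists>c. loc_value V \<alpha> c))" .
    have "sign_determined (\<lambda>e :: 'n env. \<exists>x. sc e 0 < x \<and> least_loc_value V (sc e 1) x)"
      "sign_determined (\<lambda>e :: 'n env. \<exists>x. x < sc e 0 \<and> least_loc_value V (sc e 1) x)"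
      by (rule sign_determined_ex_sc[where k = 2], intro sign_determined_conj sign_determined_less polyfun_sc Gsd, simp)+
    then show "(\<forall>\<^sub>F t in at_left s. \<exists>x>c. least_loc_value V t x) \<or> (\<forall>\<^sub>F t in at_left s. \<not> (\<exists>x>c. least_loc_value V t x))"
      "(\<forall>\<^sub>F t in at_right s. \<exists>x<c. least_loc_value V t x) \<or> (\<forall>\<^sub>F t in at_right s. \<not> (\<exists>x<c. least_loc_value V t x))" for s c
      using sign_determined_germ_sc[where \<Psi> = "\<lambda>c t. \<exists>x>c. least_loc_value V t x", OF _ tame_at_left]
        sign_determined_germ_sc[where \<Psi> = "\<lambda>c t. \<exists>x<c. least_loc_value V t x", OF _ tame_at_right] by blast+
    show "let P = (\<lambda>s. \<exists>\<epsilon>>0. \<forall>c. least_loc_value V s c \<longrightarrow>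
        (\<forall>t x. least_loc_value V t x \<longrightarrow> (s < t \<and> t < s + \<epsilon> \<longrightarrow> x < c) \<and> (s - \<epsilon> < t \<and> t < s \<longrightarrow> c < x)))
      in (\<forall>\<^sub>F s in at_top. P s) \<or> (\<forall>\<^sub>F s in at_top. \<not> P s)"
      unfolding Let_def
      by (rule sign_determined_germ_sc[where \<Psi> = "\<lambda>_ s. \<exists>\<epsilon>>0. \<forall>c. least_loc_value V s c \<longrightarrow>
          (\<forall>t x. least_loc_value V t x \<longrightarrow> (s < t \<and> t < s + \<epsilon> \<longrightarrow> x < c) \<and> (s - \<epsilon> < t \<and> t < s \<longrightarrow> c < x))",
          OF sign_determined_locally_decreasing[where G = "least_loc_value V", OF Gsd] tame_at_top])
  qed
  then have "\<forall>\<^sub>F \<alpha> in at_top. ?bad \<alpha> = {}"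
  proof
    \<comment> \<open>One large \<alpha> refutes this: the spurious minimizer \<open>K\<close> and a
      cheaper gain \<open>y\<close> both cost at most \<open>C\<close>, so they lie in the ball of
      radius \<open>c * sqrt \<alpha>\<close>, where convexity along the segment contradicts local
      minimality.\<close>
    assume "\<exists>C. \<forall>\<^sub>F \<alpha> in at_top. \<exists>K\<in>?bad \<alpha>. J K \<alpha> \<le> C"
    then obtain C where C: "\<forall>\<^sub>F \<alpha> in at_top. \<exists>K\<in>?bad \<alpha>. J K \<alpha> \<le> C" by blast
    obtain c where c: "0 < c" "\<And>\<alpha> K P. 1 \<le> \<alpha> \<Longrightarrow> lyap (?F K \<alpha>) (cost_matrix Q R K) P \<Longrightarrow> norm P \<le> C / d
      \<Longrightarrow> norm K \<le> c * sqrt \<alpha>" using gain_bound_of_cost[OF Q R, of A B "C / d"] by blast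
    obtain a1 where a1: "1 \<le> a1" "\<And>\<alpha> K. a1 \<le> \<alpha> \<Longrightarrow> norm K \<le> c * sqrt \<alpha> \<Longrightarrow> norm (A + B ** K) \<le> \<alpha> / 2"
      using closed_loop_norm_bound[of c A B] c(1) by (meson less_imp_le)
    obtain a2 where a2: "\<And>\<alpha> K Z t P0 P1 Pt. a2 \<le> \<alpha> \<Longrightarrow> norm K \<le> c * sqrt \<alpha> \<Longrightarrow> norm (K + Z) \<le> c * sqrt \<alpha> \<Longrightarrow>
        0 \<le> t \<Longrightarrow> t \<le> 1 \<Longrightarrow> lyap (?F K \<alpha>) (cost_matrix Q R K) P0 \<Longrightarrow>
        lyap (?F (K + Z) \<alpha>) (cost_matrix Q R (K + Z)) P1 \<Longrightarrow>
        lyap (?F (K + t *\<^sub>R Z) \<alpha>) (cost_matrix Q R (K + t *\<^sub>R Z)) Pt \<Longrightarrow>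
        Pt \<bullet> D\<^sub>0 \<le> (1 - t) * (P0 \<bullet> D\<^sub>0) + t * (P1 \<bullet> D\<^sub>0)"
      using cost_convex[OF R d D, of c A B Q] c(1) by (metis less_imp_le)
    have "\<forall>\<^sub>F \<alpha> in at_top. (\<exists>K\<in>?bad \<alpha>. J K \<alpha> \<le> C) \<and> max a1 a2 \<le> \<alpha>"
      using C eventually_ge_at_top by (rule eventually_conj)
    then obtain \<alpha> K where \<alpha>: "a1 \<le> \<alpha>" "a2 \<le> \<alpha>" and K: "K \<in> ?bad \<alpha>" "J K \<alpha> \<le> C"
      using eventually_happens'[OF trivial_limit_at_top_linorder] by fastforce
    have Kl: "K \<in> local_minimizers (\<lambda>K. J K \<alpha>) (feas \<alpha>)" using K(1) by simp
    then have Kf: "K \<in> feas \<alpha>" by (simp add: local_minimizers_def)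
    obtain y where y: "y \<in> feas \<alpha>" "J y \<alpha> < J K \<alpha>" using K(1) Kf by (auto simp: global_minimizers_def not_le)
    have small: "norm L \<le> c * sqrt \<alpha>" if L: "L \<in> feas \<alpha>" "J L \<alpha> \<le> C" for L
    proof -
      obtain P where P: "lyap (?F L \<alpha>) (cost_matrix Q R L) P" using P_ex[OF L(1)] by blast
      have "norm P \<le> C / d" using P_norm[OF L(1) P] L(2) d by (meson divide_right_mono less_imp_le order_trans)
      then show ?thesis using c(2)[OF _ P] \<alpha>(1) a1(1) by auto
    qed
    have nK: "norm K \<le> c * sqrt \<alpha>" by (rule small[OF Kf K(2)])
    have ny: "norm y \<le> c * sqrt \<alpha>" using small[OF y(1)] y(2) K(2) by simp
    have False
    proof (rule convex_local_imp_global[OF Kl y])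
      fix t :: real assume t: "0 < t" "t \<le> 1"
      let ?L = "K + t *\<^sub>R (y - K)"
      have "?L = (1 - t) *\<^sub>R K + t *\<^sub>R y" by (simp add: algebra_simps)
      then have "norm ?L \<le> norm ((1 - t) *\<^sub>R K) + norm (t *\<^sub>R y)" by (simp only: norm_triangle_ineq)
      also have "\<dots> \<le> (1 - t) * (c * sqrt \<alpha>) + t * (c * sqrt \<alpha>)"
        using t nK ny by (simp add: add_mono mult_left_mono)
      finally have nL: "norm ?L \<le> c * sqrt \<alpha>" by (simp add: algebra_simps)
      \<comment> \<open>Convexity of the feasible set is not assumed: the segment stays feasible
        because its gains remain in the ball, where every gain is stabilizing, and because
        \<open>S\<close> is linear.\<close>
      have "norm (A + B ** ?L) < \<alpha>" using a1(2)[OF \<alpha>(1) nL] \<alpha>(1) a1(1) by linarith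
      from stable_of_norm[OF this] have "stable (?F ?L \<alpha>)" by (simp only: damped_mult)
      moreover have "?L \<in> S" using Kf y(1) by (force simp: feasI S)
      ultimately have Lf: "?L \<in> feas \<alpha>" by (simp add: feasI)
      obtain P0 where P0: "lyap (?F K \<alpha>) (cost_matrix Q R K) P0" using P_ex[OF Kf] by blast
      obtain P1 where P1: "lyap (?F y \<alpha>) (cost_matrix Q R y) P1" using P_ex[OF y(1)] by blast
      obtain Pt where Pt: "lyap (?F ?L \<alpha>) (cost_matrix Q R ?L) Pt" using P_ex[OF Lf] by blast
      have "Pt \<bullet> D\<^sub>0 \<le> (1 - t) * (P0 \<bullet> D\<^sub>0) + t * (P1 \<bullet> D\<^sub>0)"
        by (rule a2[OF \<alpha>(2) nK _ _ _ P0 _ Pt]) (use ny t P1 in auto)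
      then show "?L \<in> feas \<alpha> \<and> J ?L \<alpha> \<le> (1 - t) * J K \<alpha> + t * J y \<alpha>"
        using Lf by (simp add: J_eq[OF Kf P0] J_eq[OF y(1) P1] J_eq[OF Lf Pt])
    qed
    then show ?thesis ..
  qed
  then obtain \<alpha>\<^sub>0 where "\<And>\<alpha>. \<alpha>\<^sub>0 \<le> \<alpha> \<Longrightarrow> ?bad \<alpha> = {}" by (auto simp: eventually_at_top_linorder)
  then have "locally_optimal M x\<^sub>0 A B Q R S \<alpha> = globally_optimal M x\<^sub>0 A B Q R S \<alpha>" if "\<alpha>\<^sub>0 \<le> \<alpha>" for \<alpha>
    using that global_subset_local[of "\<lambda>K. J K \<alpha>" "feas \<alpha>"]
    unfolding locally_optimal_def globally_optimal_def J_def feas_def by blast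
  then show ?thesis by blast
qed

theorem corollary1:
  fixes A B Q R D\<^sub>0 :: "real^('n::{finite,linorder})^('n::{finite,linorder})"
    and S :: "(real^('n::{finite,linorder})^('n::{finite,linorder})) set"
    and M :: "'w measure"
    and x\<^sub>0 :: "'w \<Rightarrow> real^('n::{finite,linorder})"
  assumes "pos_semidef Q"
    and "pos_def R"
    and "pos_def D\<^sub>0"
    and "random_initial_state M x\<^sub>0 D\<^sub>0"
    and "sparsity_subspace S"
    and "block_diagonal (indicator_matrix S)"
    and "has_sparsity_pattern R (indicator_matrix S)"
  shows "\<exists>\<alpha>\<^sub>0. \<forall>\<alpha>\<ge>\<alpha>\<^sub>0.
    locally_optimal M x\<^sub>0 A B Q R S \<alpha> = globally_optimal M x\<^sub>0 A B Q R S \<alpha>"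
  using assms(1-5) by (rule eventually_locally_optimal_eq_globally_optimal)

end
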